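(* The enumeration problem All-Cluster-Editing is in $\mathrm{DelayFPT}$.
   Context: Parameterized enumeration: a parameterized enumeration problem with ordering consists of a set of instances $I$, a polynomial-time computable parameterization $\kappa\colon I\to\mathbb N$, a function assigning to each instance $x$ a finite set $\mathrm{Sol}(x)$ of solutions, and an ordering of solutions; in this paper solutions are finite sets and are ordered by non-decreasing cardinality. An enumeration algorithm for such a problem, on every instance $x$, terminates after finitely many steps and outputs exactly the elements of $\mathrm{Sol}(x)$, each exactly once, such that whenever $y,z\in\mathrm{Sol}(x)$ with $|y|<|z|$, $y$ is output before $z$. The problem is in $\mathrm{TotalFPT}$ if it has an enumeration algorithm whose total running time on every instance $x$ is at most $t(\kappa(x))\cdot p(|x|)$ for some computable $t\colon\mathbb N\to\mathbb N$ and polynomial $p$. It is in $\mathrm{DelayFPT}$ if it has an enumeration algorithm such that, for some computable $t$ and polynomial $p$ and every instance $x$, the time from the start to the first output, the time between any two consecutive outputs, and the time from the last output to termination are each at most $t(\kappa(x))\cdot p(|x|)$. Cluster editing: a cluster is a graph each of whose connected components is a clique. For a finite undirected graph $G=(V,E)$, allowed operations are addition of an edge $\{u,v\}$ ($u,v\in V$) and deletion of an edge; a set of such operations is consistent if it does not both add and delete the same edge, and $S(G)$ is the result of applying $S$. For $k\in\mathbb N$, a solution for $(G,k)$ is a consistent set $S$ of such operations with $|S|\le k$ such that $S(G)$ is a cluster; it is minimal if no proper subset is a solution. The parameter is $k$. Min-Cluster-Editing: given $(G,k)$, output all minimal solutions ordered by non-decreasing size. All-Cluster-Editing: given $(G,k)$,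 output all solutions ordered by non-decreasing size. *)

theory Defs
  imports Main
begin

text \<open>Symbols are natural numbers; 0 is the blank. Input/output words are lists of
  nonzero symbols. States and symbols are bounded by tm_states / tm_syms, so a
  well-formed machine is a finite object (its transition function only matters on
  the finite table of valid arguments).\<close>

datatype dir = MoveL | MoveR | Stay

record tm =
  tm_tapes  :: nat
  tm_states :: nat
  tm_syms   :: nat
  tm_start  :: nat
  tm_halt   :: nat
  tm_out    :: nat
  tm_delta  :: "nat \<Rightarrow> nat list \<Rightarrow> nat \<times> nat list \<times> dir list"

definition wf_tm :: "tm \<Rightarrow> bool" where
  "wf_tm M \<longleftrightarrow> tm_tapes M \<ge> 1 \<and> tm_syms M \<ge> 6 \<and>
     tm_start M < tm_states M \<and> tm_halt M < tm_states M \<and> tm_out M < tm_states M \<and>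
     tm_out M \<noteq> tm_halt M \<and>
     (\<forall>q rs. q < tm_states M \<and> length rs = tm_tapes M \<and> (\<forall>s\<in>set rs. s < tm_syms M) \<longrightarrow>
        (case tm_delta M q rs of (q', ws, ds) \<Rightarrow>
           q' < tm_states M \<and> length ws = tm_tapes M \<and> (\<forall>s\<in>set ws. s < tm_syms M) \<and>
           length ds = tm_tapes M))"

record config =
  cstate :: nat
  ctapes :: "(nat \<Rightarrow> nat) list"
  cheads :: "nat list"

fun mv :: "dir \<Rightarrow> nat \<Rightarrow> nat" where
  "mv MoveL h = h - 1"
| "mv MoveR h = Suc h"
| "mv Stay h = h"

definition step :: "tm \<Rightarrow> config \<Rightarrow> config" where
  "step M c = (if cstate c = tm_halt M then c else
     (let m = tm_tapes M;
          rs = map (\<lambda>i. (ctapes c ! i) (cheads c ! i)) [0..<m]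
      in case tm_delta M (cstate c) rs of (q', ws, ds) \<Rightarrow>
        \<lparr>cstate = q',
         ctapes = map (\<lambda>i. (ctapes c ! i)((cheads c ! i) := ws ! i)) [0..<m],
         cheads = map (\<lambda>i. mv (ds ! i) (cheads c ! i)) [0..<m]\<rparr>))"

definition init :: "tm \<Rightarrow> nat list \<Rightarrow> config" where
  "init M w = \<lparr>cstate = tm_start M,
     ctapes = (\<lambda>j. if j < length w then w ! j else 0) # replicate (tm_tapes M - 1) (\<lambda>_. 0),
     cheads = replicate (tm_tapes M) 0\<rparr>"

definition run :: "tm \<Rightarrow> nat list \<Rightarrow> nat \<Rightarrow> config" where
  "run M w t = (step M ^^ t) (init M w)"

definition out_word :: "config \<Rightarrow> nat list" where
  "out_word c = (let tp = last (ctapes c) in map tp [0..<(LEAST j. tp j = 0)])"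

definition halts_at :: "tm \<Rightarrow> nat list \<Rightarrow> nat \<Rightarrow> bool" where
  "halts_at M w T \<longleftrightarrow> cstate (run M w T) = tm_halt M \<and> (\<forall>t<T. cstate (run M w t) \<noteq> tm_halt M)"

definition out_times :: "tm \<Rightarrow> nat list \<Rightarrow> nat \<Rightarrow> nat list" where
  "out_times M w T = filter (\<lambda>t. cstate (run M w t) = tm_out M) [0..<T]"

definition outputs :: "tm \<Rightarrow> nat list \<Rightarrow> nat \<Rightarrow> nat list list" where
  "outputs M w T = map (\<lambda>t. out_word (run M w t)) (out_times M w T)"

fun bin :: "nat \<Rightarrow> nat list" where
  "bin n = (if n < 2 then [n + 1] else bin (n div 2) @ [n mod 2 + 1])"

definition tm_computable :: "(nat \<Rightarrow> nat) \<Rightarrow> bool" where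
  "tm_computable f \<longleftrightarrow> (\<exists>M. wf_tm M \<and>
     (\<forall>x. \<exists>T. halts_at M (bin x) T \<and> out_word (run M (bin x) T) = bin (f x)))"

definition enum_algorithm ::
  "tm \<Rightarrow> 'i set \<Rightarrow> ('i \<Rightarrow> nat list) \<Rightarrow> ('i \<Rightarrow> 'a set set) \<Rightarrow> (nat list \<Rightarrow> 'a set \<Rightarrow> bool) \<Rightarrow> bool" where
  "enum_algorithm M I enc_in sol dec \<longleftrightarrow> wf_tm M \<and>
     (\<forall>x\<in>I. \<exists>T. halts_at M (enc_in x) T \<and>
        (\<exists>Ss. length Ss = length (outputs M (enc_in x) T) \<and>
              (\<forall>i<length Ss. dec (outputs M (enc_in x) T ! i) (Ss ! i)) \<and>
              distinct Ss \<and> set Ss = sol x \<and>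
              (\<forall>i j. i < j \<and> j < length Ss \<longrightarrow> card (Ss ! i) \<le> card (Ss ! j))))"

definition delay_bounded :: "tm \<Rightarrow> nat list \<Rightarrow> nat \<Rightarrow> bool" where
  "delay_bounded M w B \<longleftrightarrow> (\<forall>T. halts_at M w T \<longrightarrow>
     (let ts = 0 # out_times M w T @ [T] in \<forall>i. Suc i < length ts \<longrightarrow> ts ! Suc i - ts ! i \<le> B))"

definition DelayFPT ::
  "'i set \<Rightarrow> ('i \<Rightarrow> nat list) \<Rightarrow> ('i \<Rightarrow> nat) \<Rightarrow> ('i \<Rightarrow> 'a set set) \<Rightarrow> (nat list \<Rightarrow> 'a set \<Rightarrow> bool) \<Rightarrow> bool" where
  "DelayFPT I enc_in kappa sol dec \<longleftrightarrow>
     (\<exists>M t c d. enum_algorithm M I enc_in sol dec \<and> tm_computable t \<and>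
        (\<forall>x\<in>I. delay_bounded M (enc_in x) (t (kappa x) * (c * (length (enc_in x) + 1) ^ d))))"

definition graph :: "nat \<Rightarrow> nat set set \<Rightarrow> bool" where
  "graph n E \<longleftrightarrow> (\<forall>e\<in>E. e \<subseteq> {0..<n} \<and> card e = 2)"

definition adj :: "nat set set \<Rightarrow> (nat \<times> nat) set" where
  "adj E = {(u, v). {u, v} \<in> E}"

definition is_cluster :: "nat \<Rightarrow> nat set set \<Rightarrow> bool" where
  "is_cluster n E \<longleftrightarrow> (\<forall>u<n. \<forall>v<n. u \<noteq> v \<and> (u, v) \<in> (adj E)\<^sup>* \<longrightarrow> {u, v} \<in> E)"

datatype edit = AddE "nat set" | DelE "nat set"

fun edit_pair :: "edit \<Rightarrow> nat set" where
  "edit_pair (AddE e) = e"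
| "edit_pair (DelE e) = e"

definition valid_edit :: "nat \<Rightarrow> edit \<Rightarrow> bool" where
  "valid_edit n op \<longleftrightarrow> edit_pair op \<subseteq> {0..<n} \<and> card (edit_pair op) = 2"

definition consistent :: "edit set \<Rightarrow> bool" where
  "consistent S \<longleftrightarrow> (\<forall>e. \<not> (AddE e \<in> S \<and> DelE e \<in> S))"

definition apply_edits :: "edit set \<Rightarrow> nat set set \<Rightarrow> nat set set" where
  "apply_edits S E = (E \<union> {e. AddE e \<in> S}) - {e. DelE e \<in> S}"

definition ce_solution :: "nat \<Rightarrow> nat set set \<Rightarrow> nat \<Rightarrow> edit set \<Rightarrow> bool" where
  "ce_solution n E k S \<longleftrightarrow> (\<forall>op\<in>S. valid_edit n op) \<and> consistent S \<and> card S \<le> k \<and>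
     is_cluster n (apply_edits S E)"

definition ce_instances :: "(nat \<times> nat set set \<times> nat) set" where
  "ce_instances = {(n, E, k). graph n E}"

fun ce_kappa :: "nat \<times> nat set set \<times> nat \<Rightarrow> nat" where
  "ce_kappa (n, E, k) = k"

fun all_ce_sols :: "nat \<times> nat set set \<times> nat \<Rightarrow> edit set set" where
  "all_ce_sols (n, E, k) = {S. ce_solution n E k S}"

fun enc_ce :: "nat \<times> nat set set \<times> nat \<Rightarrow> nat list" where
  "enc_ce (n, E, k) = bin n @ [3] @ bin k @ [3] @
     concat (map (\<lambda>i. map (\<lambda>j. if {i, j} \<in> E then 2 else 1) [0..<n]) [0..<n])"

fun edit_marker :: "edit \<Rightarrow> nat" where
  "edit_marker (AddE e) = 4"
| "edit_marker (DelE e) = 5"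

definition encodes_edit :: "nat list \<Rightarrow> edit \<Rightarrow> bool" where
  "encodes_edit w op \<longleftrightarrow> (\<exists>u v. u \<noteq> v \<and> edit_pair op = {u, v} \<and>
     w = [edit_marker op] @ bin u @ [3] @ bin v @ [3])"

definition encodes_edits :: "nat list \<Rightarrow> edit set \<Rightarrow> bool" where
  "encodes_edits w S \<longleftrightarrow> (\<exists>ops ws. distinct ops \<and> set ops = S \<and>
     list_all2 encodes_edit ws ops \<and> w = concat ws)"

end

theory Submission
  imports Defs
begin

text \<open>Besides its effective edits a solution may contain operations without effect.  So a solution
  assigns to every pair of vertices one of the letters 1 (no operation), 2 (addition), 3 (deletion), and a
  set of effective edits of size \<open>d\<close> extends to solutions of every size between \<open>d\<close> and the number of pairs.

  For each size \<open>s\<close> from 0 to \<open>k\<close> the assignments are explored by depth first search.  A prefix extends to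
  a solution of size \<open>s\<close> iff the budget it leaves does not exceed the number of undecided pairs and
  suffices to turn the graph into a cluster graph by flipping undecided pairs.  The latter is decided by a
  bounded search tree: as long as three vertices span exactly two edges, one of their three pairs has to
  be flipped, so it is enough to try the \<open>3 ^ s\<close> strings that say which.  As infeasible prefixes are
  abandoned at once, only polynomially many tests in \<open>n\<close> and \<open>k\<close> lie between two outputs, and the memory
  used is polynomial in \<open>n\<close> and \<open>k\<close>, so that the sequential access of a Turing machine does no harm (unlike
  for a queue of all solutions found so far).

  Reading \<open>s\<close> and the assignment as one number, the search visits increasing numbers; hence nothing is
  output twice and the sizes do not decrease.\<close>

section \<open>While programs on tapes and their Turing machines\<close>

text \<open>The delay rests on the feasibility test being exact: a prefix passes iff some solution
  of size \<open>s\<close> extends it. Hence a descent never ends in a dead end, and a size without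
  solutions is dismissed at the empty prefix. Operations without effect help here: any set of flips
  that stays within the remaining budget can be padded to the exact size on undecided pairs, so that
  only their number matters.

  Trying strings instead of recursing keeps the search tree off the tapes: a string is a counter in
  base 3, and it fails harmlessly when it asks for a frozen pair. No flip set is missed, because a
  bad triple of the current matrix contains a pair in which it still differs from the target.

  Constants: let K be \<open>2 ^ k\<close> and N the input length plus one. One search for a bad
  triple costs order \<open>N ^ 3\<close>, a string has at most \<open>k\<close> letters, there are
  at most \<open>3 ^ k \<le> K ^ 2\<close> strings, and order \<open>K * N\<close> tests separate
  two outputs. This gives \<open>K ^ 4 * N ^ 4\<close> and the parameter function
  \<open>2 ^ (4 * k)\<close>.\<close>

type_synonym tape = "(nat \<Rightarrow> nat) \<times> nat"
type_synonym store = "nat \<Rightarrow> tape"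
type_synonym action = "nat \<times> nat option \<times> dir"

definition rdt :: "tape \<Rightarrow> nat" where "rdt t = fst t (snd t)"
definition wrt :: "nat \<Rightarrow> tape \<Rightarrow> tape" where "wrt x t = ((fst t)(snd t := x), snd t)"
definition mvt :: "dir \<Rightarrow> tape \<Rightarrow> tape" where "mvt d t = (fst t, mv d (snd t))"
definition actt :: "nat option \<Rightarrow> dir \<Rightarrow> tape \<Rightarrow> tape" where
  "actt w d t = mvt d (case w of None \<Rightarrow> t | Some x \<Rightarrow> wrt x t)"

definition rd :: "store \<Rightarrow> nat \<Rightarrow> nat" where "rd \<sigma> i = rdt (\<sigma> i)"

text \<open>One action models one machine transition: all tapes change simultaneously, so the
  symbols to be written are computed from the old scanned symbols.\<close>

definition act_store :: "action list \<Rightarrow> store \<Rightarrow> store" where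
  "act_store l \<sigma> = (\<lambda>i. case map_of l i of None \<Rightarrow> \<sigma> i | Some (w, d) \<Rightarrow> actt w d (\<sigma> i))"

lemma act_store_Nil [simp]: "act_store [] \<sigma> = \<sigma>"
  by (simp add: act_store_def)

lemma act_store_Cons [simp]:
  "act_store ((i, w, d) # l) \<sigma> = (act_store l \<sigma>)(i := actt w d (\<sigma> i))"
  by (auto simp: act_store_def fun_eq_iff)

datatype cmd =
    Act "(nat \<Rightarrow> nat) \<Rightarrow> action list"
  | Seq cmd cmd (infixr ";;" 60)
  | Cond "(nat \<Rightarrow> nat) \<Rightarrow> bool" cmd cmd
  | While "(nat \<Rightarrow> nat) \<Rightarrow> bool" cmd

text \<open>One unit is charged for each rewriting of the control stack, including the unfolding of
  \<open>;;\<close> and every evaluation of a loop test. In this way the costs are exactly the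
  numbers of machine steps.\<close>

inductive exec :: "cmd \<Rightarrow> store \<Rightarrow> nat \<Rightarrow> store \<Rightarrow> bool" where
  exec_Act: "exec (Act f) \<sigma> 1 (act_store (f (rd \<sigma>)) \<sigma>)"
| exec_Seq: "exec a \<sigma> t \<sigma>' \<Longrightarrow> exec b \<sigma>' u \<sigma>'' \<Longrightarrow> exec (a ;; b) \<sigma> (1 + (t + u)) \<sigma>''"
| exec_CondT: "p (rd \<sigma>) \<Longrightarrow> exec a \<sigma> t \<sigma>' \<Longrightarrow> exec (Cond p a b) \<sigma> (1 + t) \<sigma>'"
| exec_CondF: "\<not> p (rd \<sigma>) \<Longrightarrow> exec b \<sigma> t \<sigma>' \<Longrightarrow> exec (Cond p a b) \<sigma> (1 + t) \<sigma>'"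
| exec_WhileF: "\<not> p (rd \<sigma>) \<Longrightarrow> exec (While p a) \<sigma> 1 \<sigma>"
| exec_WhileT: "p (rd \<sigma>) \<Longrightarrow> exec a \<sigma> t \<sigma>' \<Longrightarrow> exec (While p a) \<sigma>' u \<sigma>'' \<Longrightarrow>
    exec (While p a) \<sigma> (1 + (t + u)) \<sigma>''"

text \<open>Written symbols are bounded only under the assumption that the scanned ones are, because
  some actions copy what they read.\<close>

primrec wf_cmd :: "nat \<Rightarrow> nat \<Rightarrow> cmd \<Rightarrow> bool" where
  "wf_cmd m y (Act f) \<longleftrightarrow> (\<forall>r. \<forall>x\<in>set (f r). fst x < m) \<and>
     (\<forall>r. (\<forall>i. r i < y) \<longrightarrow> (\<forall>x\<in>set (f r). \<forall>w. fst (snd x) = Some w \<longrightarrow> w < y))"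
| "wf_cmd m y (a ;; b) \<longleftrightarrow> wf_cmd m y a \<and> wf_cmd m y b"
| "wf_cmd m y (Cond p a b) \<longleftrightarrow> wf_cmd m y a \<and> wf_cmd m y b"
| "wf_cmd m y (While p a) \<longleftrightarrow> wf_cmd m y a"

text \<open>The control states of the machine running a program are the stacks of commands that
  remain to be executed; only finitely many arise from a given program.\<close>

primrec conts :: "cmd \<Rightarrow> cmd list \<Rightarrow> cmd list set" where
  "conts (Act f) K = {Act f # K}"
| "conts (a ;; b) K = insert ((a ;; b) # K) (conts a (b # K) \<union> conts b K)"
| "conts (Cond p a b) K = insert (Cond p a b # K) (conts a K \<union> conts b K)"
| "conts (While p a) K = insert (While p a # K) (conts a (While p a # K))"

fun next_stack :: "cmd list \<Rightarrow> (nat \<Rightarrow> nat) \<Rightarrow> cmd list" where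
  "next_stack [] r = []"
| "next_stack (Act f # K) r = K"
| "next_stack ((a ;; b) # K) r = a # b # K"
| "next_stack (Cond p a b # K) r = (if p r then a else b) # K"
| "next_stack (While p a # K) r = (if p r then a # While p a # K else K)"

fun next_acts :: "cmd list \<Rightarrow> (nat \<Rightarrow> nat) \<Rightarrow> action list" where
  "next_acts (Act f # K) r = f r"
| "next_acts K r = []"

lemma finite_conts: "finite (conts c K)"
  by (induction c arbitrary: K) auto

lemma conts_self: "c # K \<in> conts c K"
  by (cases c) auto

text \<open>Besides the continuations of \<open>c\<close>, the stack \<open>K\<close> itself
  appears: it is exposed as soon as \<open>c\<close> has been completed.\<close>

lemma conts_closed: "J \<in> conts c K \<Longrightarrow> next_stack J r \<in> insert K (conts c K)"
proof (induction c arbitrary: K)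
  case (Seq a b)
  from Seq.prems consider "J = (a ;; b) # K" | "J \<in> conts a (b # K)" | "J \<in> conts b K" by auto
  then show ?case
    by cases (use conts_self[of a "b # K"] conts_self[of b K] Seq.IH(1)[of "b # K"] Seq.IH(2)[of K] in auto)
next
  case (Cond p a b)
  from Cond.prems consider "J = Cond p a b # K" | "J \<in> conts a K" | "J \<in> conts b K" by auto
  then show ?case
    by cases (use conts_self[of a K] conts_self[of b K] Cond.IH(1)[of K] Cond.IH(2)[of K] in auto)
next
  case (While p a)
  from While.prems consider "J = While p a # K" | "J \<in> conts a (While p a # K)" by auto
  then show ?case
    by cases (use conts_self[of a "While p a # K"] While.IH[of "While p a # K"] in auto)
qed simp

lemma conts_wf:
  "J \<in> conts c K \<Longrightarrow> wf_cmd m y c \<Longrightarrow> list_all (wf_cmd m y) K \<Longrightarrow> list_all (wf_cmd m y) J"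
proof (induction c arbitrary: K)
  case (Seq a b)
  from Seq.prems(1) consider "J = (a ;; b) # K" | "J \<in> conts a (b # K)" | "J \<in> conts b K" by auto
  then show ?case
    by cases (use Seq.prems Seq.IH(1)[of "b # K"] Seq.IH(2)[of K] in simp_all)
next
  case (Cond p a b)
  from Cond.prems(1) consider "J = Cond p a b # K" | "J \<in> conts a K" | "J \<in> conts b K" by auto
  then show ?case
    by cases (use Cond.prems Cond.IH(1)[of K] Cond.IH(2)[of K] in simp_all)
next
  case (While p a)
  from While.prems(1) consider "J = While p a # K" | "J \<in> conts a (While p a # K)" by auto
  then show ?case
    by cases (use While.prems While.IH[of "While p a # K"] in simp_all)
qed simp

section \<open>Compilation of programs into Turing machines\<close>

definition stacks :: "cmd \<Rightarrow> cmd \<Rightarrow> cmd list set" where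
  "stacks A B = insert [] (conts A [] \<union> conts B [])"

text \<open>The numbering starts at 2 because the states 0 and 1 are reserved for halting and
  output.\<close>

definition stack_code :: "cmd list set \<Rightarrow> cmd list \<Rightarrow> nat" where
  "stack_code S = (SOME e. bij_betw e S {2..<card S + 2})"

definition blank :: tape where "blank = (\<lambda>_. 0, 0)"

text \<open>The empty stack is the state in which a program has just ended. There \<open>p\<close>
  chooses between output and halting, and the output state starts \<open>B\<close>. A run is thus
  \<open>A\<close>, followed by rounds of output and \<open>B\<close>, until \<open>p\<close>
  fails.\<close>

definition machine :: "nat \<Rightarrow> nat \<Rightarrow> ((nat \<Rightarrow> nat) \<Rightarrow> bool) \<Rightarrow> cmd \<Rightarrow> cmd \<Rightarrow> tm" where
  "machine m y p A B = (let S = stacks A B; e = stack_code S in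
    \<lparr>tm_tapes = m, tm_states = card S + 2, tm_syms = y, tm_start = e [A], tm_halt = 0, tm_out = 1,
     tm_delta = (\<lambda>q rs. let r = (\<lambda>i. if i < length rs then rs ! i else 0) in
       if q = 0 then (0, rs, replicate m Stay)
       else if q = 1 then (e [B], rs, replicate m Stay)
       else let J = inv_into S e q; l = next_acts J r in
         (if J = [] then if p r then 1 else 0 else e (next_stack J r),
          map (\<lambda>i. case map_of l i of Some (Some w, d) \<Rightarrow> w | _ \<Rightarrow> rs ! i) [0..<m],
          map (\<lambda>i. case map_of l i of Some (w, d) \<Rightarrow> d | None \<Rightarrow> Stay) [0..<m]))\<rparr>)"

definition conf :: "nat \<Rightarrow> nat \<Rightarrow> store \<Rightarrow> config" where
  "conf m q \<sigma> = \<lparr>cstate = q, ctapes = map (\<lambda>i. fst (\<sigma> i)) [0..<m], cheads = map (\<lambda>i. snd (\<sigma> i)) [0..<m]\<rparr>"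

definition init_store :: "nat list \<Rightarrow> store" where
  "init_store w = (\<lambda>i. if i = 0 then (\<lambda>j. if j < length w then w ! j else 0, 0) else blank)"

text \<open>Programs see the scanned symbols of infinitely many tapes, the machine those of
  \<open>m\<close> tapes padded with 0. On supported stores the two views agree.\<close>

definition supported :: "nat \<Rightarrow> store \<Rightarrow> bool" where
  "supported m \<sigma> \<longleftrightarrow> (\<forall>i\<ge>m. \<sigma> i = blank)"

text \<open>The endpoint is exempt from \<open>P\<close>, so paths can be concatenated.\<close>

definition path :: "('a \<Rightarrow> 'a) \<Rightarrow> ('a \<Rightarrow> bool) \<Rightarrow> nat \<Rightarrow> 'a \<Rightarrow> 'a \<Rightarrow> bool" where
  "path f P t x y \<longleftrightarrow> (f ^^ t) x = y \<and> (\<forall>u<t. P ((f ^^ u) x))"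

lemma path_one: "P x \<Longrightarrow> f x = y \<Longrightarrow> path f P 1 x y"
  by (simp add: path_def)

lemma path_trans:
  assumes "path f P t x y" "path f P u y z"
  shows "path f P (t + u) x z"
proof -
  have *: "(f ^^ (v + t)) x = (f ^^ v) y" for v
    using assms(1) by (simp add: path_def funpow_add)
  have "P ((f ^^ v) x)" if "v < t + u" for v
  proof (cases "v < t")
    case False
    then have "v = (v - t) + t" by simp
    then have "(f ^^ v) x = (f ^^ (v - t)) y" using * by metis
    then show ?thesis using False that assms(2) by (simp add: path_def)
  qed (use assms(1) in \<open>simp add: path_def\<close>)
  moreover have "(f ^^ (t + u)) x = z"
    using *[of u] assms(2) by (simp add: path_def add.commute)
  ultimately show ?thesis by (simp add: path_def)
qed

lemma path_step: "P x \<Longrightarrow> path f P t (f x) z \<Longrightarrow> path f P (1 + t) x z"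
  by (rule path_trans[OF path_one[OF _ refl]])

context
  fixes m y :: nat and p :: "(nat \<Rightarrow> nat) \<Rightarrow> bool" and A B :: cmd and e :: "cmd list \<Rightarrow> nat"
    and S :: "cmd list set" and M :: tm
  assumes S: "S = stacks A B" and e: "e = stack_code S" and M: "M = machine m y p A B"
    and m: "m \<ge> 1" and y: "y \<ge> 6" and wfA: "wf_cmd m y A" and wfB: "wf_cmd m y B"
begin

lemma finite_S: "finite S"
  by (simp add: S stacks_def finite_conts)

lemma e_bij: "bij_betw e S {2..<card S + 2}"
proof -
  have "\<exists>e. bij_betw e S {2..<card S + 2}"
    by (rule finite_same_card_bij) (simp_all add: finite_S)
  then show ?thesis unfolding e stack_code_def by (rule someI_ex)
qed

lemma e_ge: "J \<in> S \<Longrightarrow> 2 \<le> e J" and e_less: "J \<in> S \<Longrightarrow> e J < card S + 2"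
  using e_bij by (auto simp: bij_betw_def)

lemma inv_e: "J \<in> S \<Longrightarrow> inv_into S e (e J) = J"
  using e_bij by (auto simp: bij_betw_def)

lemma inv_e_in: "2 \<le> q \<Longrightarrow> q < card S + 2 \<Longrightarrow> inv_into S e q \<in> S"
  using e_bij by (metis atLeastLessThan_iff bij_betw_def inv_into_into)

lemma start_in: "[] \<in> S" "[A] \<in> S" "[B] \<in> S"
  by (auto simp: S stacks_def conts_self)

lemma S_closed: "J \<in> S \<Longrightarrow> next_stack J r \<in> S"
  using conts_closed[of J A "[]" r] conts_closed[of J B "[]" r] by (auto simp: S stacks_def)

lemma S_wf: "J \<in> S \<Longrightarrow> x \<in> set J \<Longrightarrow> wf_cmd m y x"
  using conts_wf[of J A "[]" m y] conts_wf[of J B "[]" m y] wfA wfB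
  by (auto simp: S stacks_def list_all_iff)

lemma M_simps: "tm_tapes M = m" "tm_states M = card S + 2" "tm_syms M = y" "tm_start M = e [A]"
    "tm_halt M = 0" "tm_out M = 1"
  by (simp_all add: M machine_def S e Let_def)

lemma M_delta: "tm_delta M q rs = (let r = (\<lambda>i. if i < length rs then rs ! i else 0) in
       if q = 0 then (0, rs, replicate m Stay)
       else if q = 1 then (e [B], rs, replicate m Stay)
       else let J = inv_into S e q; l = next_acts J r in
         (if J = [] then if p r then 1 else 0 else e (next_stack J r),
          map (\<lambda>i. case map_of l i of Some (Some w, d) \<Rightarrow> w | _ \<Rightarrow> rs ! i) [0..<m],
          map (\<lambda>i. case map_of l i of Some (w, d) \<Rightarrow> d | None \<Rightarrow> Stay) [0..<m]))"
  by (simp add: M machine_def S e Let_def)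

lemma next_acts_wf:
  assumes "J \<in> S" "(i, w, d) \<in> set (next_acts J r)"
  shows "i < m" "\<And>x. w = Some x \<Longrightarrow> \<forall>i. r i < y \<Longrightarrow> x < y"
proof -
  obtain f K where J: "J = Act f # K" using assms(2)
    by (cases "(J, r)" rule: next_acts.cases) auto
  have "wf_cmd m y (Act f)" using S_wf[OF assms(1), of "Act f"] J by simp
  then show "i < m" "\<And>x. w = Some x \<Longrightarrow> \<forall>i. r i < y \<Longrightarrow> x < y"
    using assms(2) J by fastforce+
qed

lemma wf_M: "wf_tm M"
proof -
  have "case tm_delta M q rs of (q', ws, ds) \<Rightarrow>
           q' < card S + 2 \<and> length ws = m \<and> (\<forall>s\<in>set ws. s < y) \<and> length ds = m"
    if "q < card S + 2" "length rs = m" "\<forall>s\<in>set rs. s < y" for q rs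
  proof -
    consider "q = 0" | "q = 1" | "q \<ge> 2" by linarith
    then show ?thesis
    proof cases
      case 3
      define r where "r = (\<lambda>i. if i < length rs then rs ! i else 0)"
      have r: "\<forall>i. r i < y" using that y by (auto simp: r_def)
      define J where "J = inv_into S e q"
      have J: "J \<in> S" using inv_e_in 3 that(1) by (simp add: J_def)
      have "(case map_of (next_acts J r) i of Some (Some w, d) \<Rightarrow> w | _ \<Rightarrow> rs ! i) < y" if i: "i < m" for i
      proof -
        have "rs ! i < y" using i that \<open>length rs = m\<close> \<open>\<forall>s\<in>set rs. s < y\<close> by simp
        moreover have "x < y" if "map_of (next_acts J r) i = Some (Some x, d)" for x d
          using next_acts_wf(2)[OF J map_of_SomeD[OF that] refl r] .
        ultimately show ?thesis by (auto split: option.split)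
      qed
      moreover have "e (next_stack J r) < card S + 2" using S_closed[OF J] e_less by blast
      ultimately show ?thesis using 3 unfolding M_delta
        by (auto simp: Let_def r_def[symmetric] J_def[symmetric])
    qed (use that e_less[OF start_in(3)] in \<open>auto simp: M_delta\<close>)
  qed
  then show ?thesis
    using m y e_less[OF start_in(2)] by (auto simp: wf_tm_def M_simps)
qed

lemma reads_conf:
  assumes "supported m \<sigma>"
  shows "(\<lambda>i. if i < m then map (\<lambda>i. fst (\<sigma> i) (snd (\<sigma> i))) [0..<m] ! i else 0) = rd \<sigma>"
  using assms by (auto simp: fun_eq_iff rd_def rdt_def supported_def blank_def)

lemma step_conf:
  assumes J: "J \<in> S" and sup: "supported m \<sigma>" and ne: "J \<noteq> []"
  shows "step M (conf m (e J) \<sigma>) = conf m (e (next_stack J (rd \<sigma>))) (act_store (next_acts J (rd \<sigma>)) \<sigma>)"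
proof -
  have rs: "map (\<lambda>i. (ctapes (conf m (e J) \<sigma>) ! i) (cheads (conf m (e J) \<sigma>) ! i)) [0..<m] =
     map (\<lambda>i. fst (\<sigma> i) (snd (\<sigma> i))) [0..<m]"
    by (simp add: conf_def)
  show ?thesis
    using e_ge[OF J] ne unfolding step_def M_simps rs Let_def M_delta
    by (auto simp: reads_conf[OF sup] inv_e[OF J] conf_def act_store_def actt_def wrt_def mvt_def
        split: option.split)
qed

lemma supported_acts:
  assumes "J \<in> S" "supported m \<sigma>"
  shows "supported m (act_store (next_acts J (rd \<sigma>)) \<sigma>)"
proof -
  have "map_of (next_acts J (rd \<sigma>)) i = None" if "i \<ge> m" for i
    using next_acts_wf(1)[OF assms(1)] that
    by (metis map_of_SomeD not_le option.exhaust surj_pair)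
  then show ?thesis using assms(2) by (simp add: supported_def act_store_def)
qed

abbreviation "stepping \<equiv> path (step M) (\<lambda>c. cstate c \<ge> 2)"

lemma stepping_stack:
  assumes "J \<in> S" "supported m \<sigma>" "J \<noteq> []"
    and "stepping t (conf m (e (next_stack J (rd \<sigma>))) (act_store (next_acts J (rd \<sigma>)) \<sigma>)) z"
  shows "stepping (1 + t) (conf m (e J) \<sigma>) z"
  by (rule path_step) (use assms step_conf[OF assms(1-3)] e_ge in \<open>auto simp: conf_def\<close>)

text \<open>The stack \<open>K\<close> below the command is arbitrary because the induction meets
  subcommands with longer stacks. All states before the end are at least 2, so a program can neither
  produce an output nor halt on its way.\<close>

lemma exec_stepping:
  "exec c \<sigma> t \<sigma>' \<Longrightarrow> insert K (conts c K) \<subseteq> S \<Longrightarrow> supported m \<sigma> \<Longrightarrow>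
   stepping t (conf m (e (c # K)) \<sigma>) (conf m (e K) \<sigma>') \<and> supported m \<sigma>'"
proof (induction arbitrary: K rule: exec.induct)
  case (exec_Act f \<sigma>)
  then show ?case
    using stepping_stack[of "Act f # K" \<sigma> 0] supported_acts[of "Act f # K" \<sigma>] by (simp add: path_def)
next
  case (exec_Seq a \<sigma> t \<sigma>' b u \<sigma>'')
  have 1: "stepping t (conf m (e (a # b # K)) \<sigma>) (conf m (e (b # K)) \<sigma>') \<and> supported m \<sigma>'"
    using exec_Seq.IH(1)[of "b # K"] exec_Seq.prems conts_self[of b K] by auto
  moreover have "stepping u (conf m (e (b # K)) \<sigma>') (conf m (e K) \<sigma>'') \<and> supported m \<sigma>''"
    using exec_Seq.IH(2)[of K] exec_Seq.prems 1 by auto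
  ultimately show ?case
    using stepping_stack[of "(a ;; b) # K" \<sigma> "t + u"] exec_Seq.prems path_trans by fastforce
next
  case (exec_CondT p \<sigma> a t \<sigma>' b)
  then show ?case using stepping_stack[of "Cond p a b # K" \<sigma> t] exec_CondT.IH[of K] by auto
next
  case (exec_CondF p \<sigma> b t \<sigma>' a)
  then show ?case using stepping_stack[of "Cond p a b # K" \<sigma> t] exec_CondF.IH[of K] by auto
next
  case (exec_WhileF p \<sigma> a)
  then show ?case using stepping_stack[of "While p a # K" \<sigma> 0] by (simp add: path_def)
next
  case (exec_WhileT p \<sigma> a t \<sigma>' u \<sigma>'')
  have 1: "stepping t (conf m (e (a # While p a # K)) \<sigma>) (conf m (e (While p a # K)) \<sigma>') \<and> supported m \<sigma>'"
    using exec_WhileT.IH(1)[of "While p a # K"] exec_WhileT.prems by auto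
  moreover have "stepping u (conf m (e (While p a # K)) \<sigma>') (conf m (e K) \<sigma>'') \<and> supported m \<sigma>''"
    using exec_WhileT.IH(2)[of K] exec_WhileT.prems 1 by auto
  ultimately show ?case
    using stepping_stack[of "While p a # K" \<sigma> "t + u"] exec_WhileT.hyps(1) exec_WhileT.prems path_trans
    by fastforce
qed

lemma step_done:
  assumes "supported m \<sigma>"
  shows "step M (conf m (e []) \<sigma>) = conf m (if p (rd \<sigma>) then 1 else 0) \<sigma>"
proof -
  have rs: "map (\<lambda>i. (ctapes (conf m q \<sigma>) ! i) (cheads (conf m q \<sigma>) ! i)) [0..<m] =
     map (\<lambda>i. fst (\<sigma> i) (snd (\<sigma> i))) [0..<m]" for q
    by (simp add: conf_def)
  show ?thesis
    using e_ge[OF start_in(1)] unfolding step_def M_simps rs Let_def M_delta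
    by (auto simp: reads_conf[OF assms] inv_e[OF start_in(1)] conf_def)
qed

lemma step_out:
  assumes "supported m \<sigma>"
  shows "step M (conf m 1 \<sigma>) = conf m (e [B]) \<sigma>"
  unfolding step_def M_simps Let_def M_delta by (auto simp: conf_def)

lemma init_conf: "init M w = conf m (e [A]) (init_store w)"
  using m by (auto simp: init_def conf_def M_simps init_store_def blank_def nth_Cons'
      intro!: nth_equalityI)

lemma supported_init: "supported m (init_store w)"
  using m by (simp add: supported_def init_store_def)

text \<open>This turns a bound \<open>D\<close> for each single program run into a delay bound. The
  two additional steps of a round lead into the output state and out of it.\<close>

lemma machine_run:
  fixes \<sigma>s :: "nat \<Rightarrow> store" and D nn :: nat
  assumes A: "\<exists>t\<le>D. exec A (init_store w) t (\<sigma>s 0)"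
    and B: "\<And>j. j < nn \<Longrightarrow> p (rd (\<sigma>s j)) \<and> (\<exists>t\<le>D. exec B (\<sigma>s j) t (\<sigma>s (Suc j)))"
    and fin: "\<not> p (rd (\<sigma>s nn))"
  shows "\<exists>T. halts_at M w T \<and> run M w T = conf m 0 (\<sigma>s nn) \<and>
     outputs M w T = map (\<lambda>j. out_word (conf m 1 (\<sigma>s j))) [0..<nn] \<and> delay_bounded M w (D + 2)"
proof -
  obtain tA where tA: "tA \<le> D" "exec A (init_store w) tA (\<sigma>s 0)" using A by blast
  obtain tB where tB: "\<And>j. j < nn \<Longrightarrow> tB j \<le> D \<and> exec B (\<sigma>s j) (tB j) (\<sigma>s (Suc j))"
    using B by metis
  \<comment> \<open>\<open>\<tau> j\<close> is the time at which the program leading to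
    \<open>\<sigma>s j\<close> has ended, with the empty stack as control state.\<close>
  define \<tau> where "\<tau> j = tA + (\<Sum>i<j. 2 + tB i)" for j
  have inv: "run M w (\<tau> j) = conf m (e []) (\<sigma>s j) \<and> supported m (\<sigma>s j) \<and>
      (\<forall>t<\<tau> j. cstate (run M w t) \<noteq> 0) \<and> out_times M w (\<tau> j) = map (\<lambda>i. \<tau> i + 1) [0..<j]"
    if "j \<le> nn" for j
    using that
  proof (induction j)
    case 0
    have "stepping tA (conf m (e [A]) (init_store w)) (conf m (e []) (\<sigma>s 0)) \<and> supported m (\<sigma>s 0)"
      using exec_stepping[OF tA(2), of "[]"] supported_init[of w] by (auto simp: S stacks_def)
    then show ?case
      by (fastforce simp: \<tau>_def path_def run_def init_conf out_times_def M_simps filter_empty_conv)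
  next
    case (Suc j)
    then have j: "j < nn" and IH: "run M w (\<tau> j) = conf m (e []) (\<sigma>s j)" "supported m (\<sigma>s j)"
      "\<forall>t<\<tau> j. cstate (run M w t) \<noteq> 0" "out_times M w (\<tau> j) = map (\<lambda>i. \<tau> i + 1) [0..<j]" by auto
    have st: "stepping (tB j) (conf m (e [B]) (\<sigma>s j)) (conf m (e []) (\<sigma>s (Suc j))) \<and> supported m (\<sigma>s (Suc j))"
      using exec_stepping[of B "\<sigma>s j" "tB j" "\<sigma>s (Suc j)" "[]"] tB[OF j] IH(2) by (auto simp: S stacks_def)
    have r1: "run M w (\<tau> j + 1) = conf m 1 (\<sigma>s j)"
      using step_done[OF IH(2)] B[OF j] IH(1) by (simp add: run_def)
    have r2: "run M w (\<tau> j + 2) = conf m (e [B]) (\<sigma>s j)"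
      using step_out[OF IH(2)] r1 by (simp add: run_def)
    have r3: "run M w (\<tau> j + 2 + u) = (step M ^^ u) (conf m (e [B]) (\<sigma>s j))" for u
      using r2 by (metis add.commute comp_apply funpow_add run_def)
    have eq: "\<tau> (Suc j) = \<tau> j + 2 + tB j" by (simp add: \<tau>_def)
    have ge: "cstate (run M w t) \<ge> 2" if "\<tau> j + 2 \<le> t" "t < \<tau> (Suc j)" for t
    proof -
      have "cstate (run M w (\<tau> j + 2 + (t - (\<tau> j + 2)))) \<ge> 2"
        unfolding r3 using st that eq by (auto simp: path_def)
      moreover have "\<tau> j + 2 + (t - (\<tau> j + 2)) = t" using that by simp
      ultimately show ?thesis by metis
    qed
    have e2: "cstate (run M w (\<tau> j)) \<ge> 2" using IH(1) e_ge[OF start_in(1)] by (simp add: conf_def)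
    have o1: "cstate (run M w (\<tau> j + 1)) = 1" using r1 by (simp add: conf_def)
    have "[0..<\<tau> (Suc j)] = [0..<\<tau> j] @ [\<tau> j, \<tau> j + 1] @ [\<tau> j + 2..<\<tau> (Suc j)]"
      using eq by (simp add: upt_add_eq_append[of 0 "\<tau> j + 2" "tB j", simplified])
    moreover have "filter (\<lambda>t. cstate (run M w t) = 1) [\<tau> j + 2..<\<tau> (Suc j)] = []"
      using ge by (fastforce simp: filter_empty_conv)
    ultimately have "out_times M w (\<tau> (Suc j)) = map (\<lambda>i. \<tau> i + 1) [0..<Suc j]"
      using IH(4) e2 o1 by (simp add: out_times_def M_simps)
    moreover have "cstate (run M w t) \<noteq> 0" if "t < \<tau> (Suc j)" for t
    proof -
      consider "t < \<tau> j" | "t = \<tau> j" | "t = \<tau> j + 1" | "\<tau> j + 2 \<le> t" by linarith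
      then show ?thesis
        by cases (use IH(3) e2 o1 ge[of t] that in auto)
    qed
    ultimately show ?case using st r3[of "tB j"] eq by (simp add: path_def)
  qed
  have f: "run M w (\<tau> nn) = conf m (e []) (\<sigma>s nn)" "supported m (\<sigma>s nn)"
     "\<forall>t<\<tau> nn. cstate (run M w t) \<noteq> 0" "out_times M w (\<tau> nn) = map (\<lambda>i. \<tau> i + 1) [0..<nn]"
    using inv[of nn] by auto
  define T where "T = \<tau> nn + 1"
  have rT: "run M w T = conf m 0 (\<sigma>s nn)"
    using step_done[OF f(2)] fin f(1) by (simp add: run_def T_def)
  have e2: "cstate (run M w (\<tau> nn)) \<ge> 2" using f(1) e_ge[OF start_in(1)] by (simp add: conf_def)
  have hT: "halts_at M w T"
    using rT f(3) e2 unfolding halts_at_def M_simps T_def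
    by (auto simp: conf_def less_Suc_eq)
  have oT: "out_times M w T = map (\<lambda>i. \<tau> i + 1) [0..<nn]"
    using f(4) e2 by (simp add: out_times_def M_simps T_def)
  have r1: "run M w (\<tau> j + 1) = conf m 1 (\<sigma>s j)" if "j < nn" for j
    using step_done[of "\<sigma>s j"] B[OF that] inv[of j] that by (simp add: run_def)
  have out: "outputs M w T = map (\<lambda>j. out_word (conf m 1 (\<sigma>s j))) [0..<nn]"
    using r1 by (simp add: outputs_def oT)
  have "T' = T" if "halts_at M w T'" for T'
    using that hT unfolding halts_at_def by (metis linorder_neqE_nat)
  moreover have "\<forall>i. Suc i < length (0 # out_times M w T @ [T]) \<longrightarrow>
      (0 # out_times M w T @ [T]) ! Suc i - (0 # out_times M w T @ [T]) ! i \<le> D + 2"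
  proof (intro allI impI)
    fix i assume i: "Suc i < length (0 # out_times M w T @ [T])"
    \<comment> \<open>Halting fits the pattern of the outputs: like the output number
      \<open>i\<close>, it takes place one step after \<open>\<tau> i\<close>, here for
      \<open>i = nn\<close>.\<close>
    have 1: "(0 # out_times M w T @ [T]) ! Suc i = \<tau> i + 1"
    proof (cases "i < nn")
      case False
      then have "i = nn" using i by (simp add: oT)
      then show ?thesis by (simp add: oT nth_append) (simp add: T_def)
    qed (simp add: oT nth_append)
    show "(0 # out_times M w T @ [T]) ! Suc i - (0 # out_times M w T @ [T]) ! i \<le> D + 2"
    proof (cases i)
      case 0
      then show ?thesis using 1 tA(1) by (simp add: \<tau>_def)
    next
      case (Suc j)
      then have j: "j < nn" using i by (simp add: oT)
      have "(0 # out_times M w T @ [T]) ! i = \<tau> j + 1"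
        using j Suc by (simp add: oT nth_append)
      then show ?thesis using 1 Suc tB[OF j] by (simp add: \<tau>_def)
    qed
  qed
  ultimately have "delay_bounded M w (D + 2)"
    unfolding delay_bounded_def Let_def by blast
  then show ?thesis using hT rT out by blast
qed

end

section \<open>Tapes\<close>

definition runs :: "cmd \<Rightarrow> store \<Rightarrow> nat \<Rightarrow> store \<Rightarrow> bool" where
  "runs c \<sigma> T \<sigma>' \<longleftrightarrow> (\<exists>t\<le>T. exec c \<sigma> t \<sigma>')"

lemma runs_mono: "runs c \<sigma> T \<sigma>' \<Longrightarrow> T \<le> T' \<Longrightarrow> runs c \<sigma> T' \<sigma>'"
  unfolding runs_def by (meson order_trans)

lemma runs_Act: "\<sigma>' = act_store (f (rd \<sigma>)) \<sigma> \<Longrightarrow> 1 \<le> T \<Longrightarrow> runs (Act f) \<sigma> T \<sigma>'"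
  unfolding runs_def using exec_Act by blast

lemma runs_Seq:
  assumes "runs a \<sigma> T1 \<sigma>1" "runs b \<sigma>1 T2 \<sigma>2" "T1 + T2 + 1 \<le> T"
  shows "runs (a ;; b) \<sigma> T \<sigma>2"
proof -
  obtain t1 t2 where "t1 \<le> T1" "exec a \<sigma> t1 \<sigma>1" "t2 \<le> T2" "exec b \<sigma>1 t2 \<sigma>2"
    using assms(1,2) by (auto simp: runs_def)
  then have "exec (a ;; b) \<sigma> (1 + (t1 + t2)) \<sigma>2" "1 + (t1 + t2) \<le> T"
    using exec_Seq assms(3) by auto
  then show ?thesis unfolding runs_def by blast
qed

lemma runs_CondT: "p (rd \<sigma>) \<Longrightarrow> runs a \<sigma> T1 \<sigma>' \<Longrightarrow> T1 + 1 \<le> T \<Longrightarrow> runs (Cond p a b) \<sigma> T \<sigma>'"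
proof -
  assume "p (rd \<sigma>)" "runs a \<sigma> T1 \<sigma>'" "T1 + 1 \<le> T"
  then obtain t where "t \<le> T1" "exec (Cond p a b) \<sigma> (1 + t) \<sigma>'"
    using exec_CondT[of p \<sigma> a] by (auto simp: runs_def)
  then show ?thesis using \<open>T1 + 1 \<le> T\<close> unfolding runs_def by (intro exI[of _ "1 + t"]) simp
qed

lemma runs_CondF: "\<not> p (rd \<sigma>) \<Longrightarrow> runs b \<sigma> T1 \<sigma>' \<Longrightarrow> T1 + 1 \<le> T \<Longrightarrow> runs (Cond p a b) \<sigma> T \<sigma>'"
proof -
  assume "\<not> p (rd \<sigma>)" "runs b \<sigma> T1 \<sigma>'" "T1 + 1 \<le> T"
  then obtain t where "t \<le> T1" "exec (Cond p a b) \<sigma> (1 + t) \<sigma>'"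
    using exec_CondF[of p \<sigma> b] by (auto simp: runs_def)
  then show ?thesis using \<open>T1 + 1 \<le> T\<close> unfolding runs_def by (intro exI[of _ "1 + t"]) simp
qed

lemma runs_WhileF: "\<not> p (rd \<sigma>) \<Longrightarrow> 1 \<le> T \<Longrightarrow> runs (While p a) \<sigma> T \<sigma>"
  unfolding runs_def using exec_WhileF by blast

lemma runs_WhileT:
  assumes "p (rd \<sigma>)" "runs a \<sigma> T1 \<sigma>1" "runs (While p a) \<sigma>1 T2 \<sigma>2" "T1 + T2 + 1 \<le> T"
  shows "runs (While p a) \<sigma> T \<sigma>2"
proof -
  obtain t1 t2 where "t1 \<le> T1" "exec a \<sigma> t1 \<sigma>1" "t2 \<le> T2" "exec (While p a) \<sigma>1 t2 \<sigma>2"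
    using assms(2,3) by (auto simp: runs_def)
  then have "exec (While p a) \<sigma> (1 + (t1 + t2)) \<sigma>2" "1 + (t1 + t2) \<le> T"
    using exec_WhileT[of p \<sigma> a, OF assms(1)] assms(4) by auto
  then show ?thesis unfolding runs_def by blast
qed

text \<open>Since \<open>f\<close> names the store after each round explicitly, every loop below is
  verified by exhibiting its sequence of stores. The induction runs over the number of remaining
  rounds.\<close>

lemma runs_While_index:
  fixes f :: "nat \<Rightarrow> store"
  assumes "\<sigma> = f 0" "\<sigma>' = f N"
    and "\<And>t. t < N \<Longrightarrow> p (rd (f t))" "\<And>t. t < N \<Longrightarrow> runs c (f t) C (f (Suc t))"
    and "\<not> p (rd (f N))" and "N * (C + 1) + 1 \<le> T"
  shows "runs (While p c) \<sigma> T \<sigma>'"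
proof -
  have "runs (While p c) (f (N - d)) (d * (C + 1) + 1) (f N)" if "d \<le> N" for d
    using that
  proof (induction d)
    case 0
    then show ?case using runs_WhileF[of p "f N", OF assms(5)] by simp
  next
    case (Suc d)
    then have "Suc (N - Suc d) = N - d" by simp
    then show ?case
      using runs_WhileT[of p "f (N - Suc d)", OF assms(3)[of "N - Suc d"] assms(4)[of "N - Suc d"]] Suc by simp
  qed
  from this[of N] show ?thesis using assms(1,2,6) runs_mono by simp
qed

definition tq :: "nat list \<Rightarrow> nat \<Rightarrow> tape" where
  "tq w p = (\<lambda>j. if j < length w then w ! j else 0, p)"

text \<open>A work tape carries the end marker 7 in cell 0, so that its contents start in cell 1.\<close>

definition tp :: "nat list \<Rightarrow> nat \<Rightarrow> tape" where
  "tp h p = tq (7 # h) p"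

text \<open>A tape whose head never leaves cell 0 serves as a variable with finitely many
  values.\<close>

definition reg :: "nat \<Rightarrow> tape" where
  "reg v = (\<lambda>j. if j = 0 then v else 0, 0)"

lemma rd_simp [simp]: "rd \<sigma> i = rdt (\<sigma> i)"
  by (simp add: rd_def)

lemma rdt_tq [simp]: "rdt (tq w p) = (if p < length w then w ! p else 0)"
  by (simp add: rdt_def tq_def)

lemma rdt_tp [simp]: "rdt (tp h 0) = 7" "rdt (tp h (Suc p)) = (if p < length h then h ! p else 0)"
  by (simp_all add: tp_def)

lemma rdt_reg [simp]: "rdt (reg v) = v"
  by (simp add: rdt_def reg_def)

lemma wrt_reg [simp]: "wrt x (reg v) = reg x"
  by (auto simp: wrt_def reg_def)

lemma mvt_Stay [simp]: "mvt Stay t = t"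
  by (simp add: mvt_def)

lemma mvt_tq [simp]: "mvt MoveR (tq w p) = tq w (Suc p)" "mvt MoveL (tq w p) = tq w (p - 1)"
  by (simp_all add: mvt_def tq_def)

lemma mvt_tp [simp]: "mvt MoveR (tp w p) = tp w (Suc p)" "mvt MoveL (tp w p) = tp w (p - 1)"
  by (simp_all add: tp_def)

lemma actt_simps [simp]: "actt None d t = mvt d t" "actt (Some x) d t = mvt d (wrt x t)"
  by (simp_all add: actt_def)

lemma wrt_tq_append: "x \<noteq> 0 \<Longrightarrow> wrt x (tq w (length w)) = tq (w @ [x]) (length w)"
  by (auto simp: wrt_def tq_def nth_append fun_eq_iff)

lemma wrt_tq_update: "p < length w \<Longrightarrow> wrt x (tq w p) = tq (w[p := x]) p"
  by (auto simp: wrt_def tq_def fun_eq_iff nth_list_update)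

lemma wrt_tq_erase: "length w = p \<Longrightarrow> wrt 0 (tq (w @ [x]) p) = tq w p"
  by (auto simp: wrt_def tq_def nth_append fun_eq_iff)

lemma wrt_tq_blank: "length w \<le> p \<Longrightarrow> wrt 0 (tq w p) = tq w p"
  by (auto simp: wrt_def tq_def fun_eq_iff)

lemma wrt_tp_append: "x \<noteq> 0 \<Longrightarrow> p = Suc (length w) \<Longrightarrow> wrt x (tp w p) = tp (w @ [x]) p"
  using wrt_tq_append[of x "7 # w"] by (simp add: tp_def)

lemma wrt_tp_update: "p < length w \<Longrightarrow> wrt x (tp w (Suc p)) = tp (w[p := x]) (Suc p)"
  using wrt_tq_update[of "Suc p" "7 # w" x] by (simp add: tp_def)

lemma wrt_tp_erase: "length w = p \<Longrightarrow> wrt 0 (tp (w @ [x]) (Suc p)) = tp w (Suc p)"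
  using wrt_tq_erase[of "7 # w" "Suc p" x] by (simp add: tp_def)

text \<open>A tape has a single head. Three copies of the matrix allow the three pairs of a vertex
  triple to be inspected at the same time.\<close>

abbreviation copies :: "nat list \<Rightarrow> nat \<Rightarrow> store \<Rightarrow> store" where
  "copies h p \<sigma> \<equiv> \<sigma>(5 := tp h p, 6 := tp h p, 7 := tp h p)"

definition mvR :: "nat \<Rightarrow> cmd" where "mvR i = Act (\<lambda>r. [(i, None, MoveR)])"
definition mvL :: "nat \<Rightarrow> cmd" where "mvL i = Act (\<lambda>r. [(i, None, MoveL)])"
definition put :: "nat \<Rightarrow> nat \<Rightarrow> cmd" where "put i x = Act (\<lambda>r. [(i, Some x, Stay)])"

lemma runs_mvR: "1 \<le> T \<Longrightarrow> \<sigma>' = \<sigma>(i := mvt MoveR (\<sigma> i)) \<Longrightarrow> runs (mvR i) \<sigma> T \<sigma>'"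
  unfolding mvR_def by (rule runs_Act) simp_all

lemma runs_mvL: "1 \<le> T \<Longrightarrow> \<sigma>' = \<sigma>(i := mvt MoveL (\<sigma> i)) \<Longrightarrow> runs (mvL i) \<sigma> T \<sigma>'"
  unfolding mvL_def by (rule runs_Act) simp_all

lemma runs_put: "1 \<le> T \<Longrightarrow> \<sigma>' = \<sigma>(i := wrt x (\<sigma> i)) \<Longrightarrow> runs (put i x) \<sigma> T \<sigma>'"
  unfolding put_def by (rule runs_Act) simp_all

definition skip :: cmd where "skip = Act (\<lambda>r. [])"

lemma runs_skip: "1 \<le> T \<Longrightarrow> runs skip \<sigma> T \<sigma>"
  unfolding skip_def by (rule runs_Act) simp_all

definition to_mark :: "nat \<Rightarrow> cmd" where "to_mark i = While (\<lambda>r. r i \<noteq> 7) (mvL i)"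
definition rewind :: "nat \<Rightarrow> cmd" where "rewind i = to_mark i ;; mvR i"
definition to_end :: "nat \<Rightarrow> cmd" where "to_end i = While (\<lambda>r. r i \<noteq> 0) (mvR i)"
definition clear :: "nat \<Rightarrow> cmd" where
  "clear i = to_end i ;; mvL i ;; While (\<lambda>r. r i \<noteq> 7) (Act (\<lambda>r. [(i, Some 0, MoveL)])) ;; mvR i"

lemma rdt_tp_ne7: "7 \<notin> set h \<Longrightarrow> 0 < p \<Longrightarrow> rdt (tp h p) \<noteq> 7"
  by (cases p) (auto simp: in_set_conv_nth)

lemma runs_to_mark:
  assumes "\<sigma> i = tp h p" "7 \<notin> set h" "2 * p + 1 \<le> T"
  shows "runs (to_mark i) \<sigma> T (\<sigma>(i := tp h 0))"
  unfolding to_mark_def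
  by (rule runs_While_index[where f = "\<lambda>t. \<sigma>(i := tp h (p - t))" and N = p and C = 1])
    (use assms in \<open>auto simp: rdt_tp_ne7 fun_eq_iff intro!: runs_mvL\<close>)

lemma runs_rewind:
  assumes "\<sigma> i = tp h p" "7 \<notin> set h" "2 * p + 3 \<le> T"
  shows "runs (rewind i) \<sigma> T (\<sigma>(i := tp h 1))"
  unfolding rewind_def
proof (rule runs_Seq)
  show "runs (to_mark i) \<sigma> (2 * p + 1) (\<sigma>(i := tp h 0))"
    by (rule runs_to_mark) (use assms in auto)
  show "runs (mvR i) (\<sigma>(i := tp h 0)) 1 (\<sigma>(i := tp h 1))"
    by (rule runs_mvR) auto
qed (use assms in auto)

lemma runs_to_end:
  assumes "\<sigma> i = tp h (Suc p)" "p \<le> length h" "0 \<notin> set h" "2 * length h + 1 \<le> T"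
  shows "runs (to_end i) \<sigma> T (\<sigma>(i := tp h (Suc (length h))))"
  unfolding to_end_def
  by (rule runs_While_index[where f = "\<lambda>t. \<sigma>(i := tp h (Suc (p + t)))" and N = "length h - p" and C = 1])
    (use assms in \<open>auto simp: fun_eq_iff in_set_conv_nth intro!: runs_mvR\<close>)

lemma runs_erase:
  assumes "\<sigma> i = tp h (length h)" "7 \<notin> set h" "2 * length h + 1 \<le> T"
  shows "runs (While (\<lambda>r. r i \<noteq> 7) (Act (\<lambda>r. [(i, Some 0, MoveL)]))) \<sigma> T (\<sigma>(i := tp [] 0))"
proof (rule runs_While_index[where f = "\<lambda>t. \<sigma>(i := tp (take (length h - t) h) (length h - t))"
      and N = "length h" and C = 1])
  fix t assume t: "t < length h"
  have e: "length h - t = Suc (length h - Suc t)" using t by simp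
  show "runs (Act (\<lambda>r. [(i, Some 0, MoveL)])) (\<sigma>(i := tp (take (length h - t) h) (length h - t))) 1
        (\<sigma>(i := tp (take (length h - Suc t) h) (length h - Suc t)))"
    by (rule runs_Act) (use t in \<open>simp_all add: e take_Suc_conv_app_nth wrt_tp_erase\<close>)
  show "rd (\<sigma>(i := tp (take (length h - t) h) (length h - t))) i \<noteq> 7"
    using t assms(2) rdt_tp_ne7[of "take (length h - t) h" "length h - t"] by (auto dest: in_set_takeD)
qed (use assms in auto)

lemma runs_clear:
  assumes "\<sigma> i = tp h (Suc p)" "p \<le> length h" "0 \<notin> set h" "7 \<notin> set h" "4 * length h + 7 \<le> T"
  shows "runs (clear i) \<sigma> T (\<sigma>(i := tp [] 1))"
proof -
  have 1: "runs (to_end i) \<sigma> (2 * length h + 1) (\<sigma>(i := tp h (Suc (length h))))"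
    by (rule runs_to_end) (use assms in auto)
  have 2: "runs (mvL i) (\<sigma>(i := tp h (Suc (length h)))) 1 (\<sigma>(i := tp h (length h)))"
    by (rule runs_mvL) auto
  have 3: "runs (While (\<lambda>r. r i \<noteq> 7) (Act (\<lambda>r. [(i, Some 0, MoveL)]))) (\<sigma>(i := tp h (length h)))
      (2 * length h + 1) (\<sigma>(i := tp [] 0))"
    using runs_erase[of "\<sigma>(i := tp h (length h))" i h] assms by simp
  have 4: "runs (mvR i) (\<sigma>(i := tp [] 0)) 1 (\<sigma>(i := tp [] 1))"
    by (rule runs_mvR) auto
  show ?thesis
    unfolding clear_def
    by (rule runs_Seq[OF 1 runs_Seq[OF 2 runs_Seq[OF 3 4 order_refl] order_refl]]) (use assms in auto)
qed

section \<open>Conversion from binary to unary\<close>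

text \<open>The head of tape \<open>j\<close>, walking over blanks to the right of its marker,
  remembers \<open>v\<close> while the head of tape \<open>i\<close> goes back to the end; unwinding
  it appends \<open>v\<close> further ones.\<close>

definition double :: "nat \<Rightarrow> nat \<Rightarrow> cmd" where
  "double i j = mvL i ;;
     While (\<lambda>r. r i \<noteq> 7) (Act (\<lambda>r. [(i, None, MoveL), (j, None, MoveR)])) ;;
     mvR i ;; to_end i ;;
     While (\<lambda>r. r j \<noteq> 7) (Act (\<lambda>r. [(j, None, MoveL), (i, Some 1, MoveR)]))"

definition unary_tape :: "nat \<Rightarrow> tape" where
  "unary_tape v = tp (replicate v 1) (Suc v)"

lemma runs_double:
  assumes "\<sigma> i = unary_tape v" "\<sigma> j = tp [] 0" "i \<noteq> j" "6 * v + 9 \<le> T"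
  shows "runs (double i j) \<sigma> T (\<sigma>(i := unary_tape (2 * v)))"
proof -
  let ?u = "replicate v 1"
  have 1: "runs (mvL i) \<sigma> 1 (\<sigma>(i := tp ?u v))"
    by (rule runs_mvL) (use assms in \<open>auto simp: unary_tape_def\<close>)
  have 2: "runs (While (\<lambda>r. r i \<noteq> 7) (Act (\<lambda>r. [(i, None, MoveL), (j, None, MoveR)])))
     (\<sigma>(i := tp ?u v)) (2 * v + 1) (\<sigma>(i := tp ?u 0, j := tp [] v))"
    by (rule runs_While_index[where f = "\<lambda>t. \<sigma>(i := tp ?u (v - t), j := tp [] t)" and N = v and C = 1])
      (use assms in \<open>auto simp: rdt_tp_ne7 intro!: runs_Act\<close>)
  have 3: "runs (mvR i) (\<sigma>(i := tp ?u 0, j := tp [] v)) 1 (\<sigma>(i := tp ?u 1, j := tp [] v))"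
    by (rule runs_mvR) (use assms in auto)
  have 4: "runs (to_end i) (\<sigma>(i := tp ?u 1, j := tp [] v)) (2 * v + 1) (\<sigma>(i := tp ?u (Suc v), j := tp [] v))"
    using runs_to_end[of "\<sigma>(i := tp ?u 1, j := tp [] v)" i ?u 0] assms by (simp add: fun_upd_twist)
  have 5: "runs (While (\<lambda>r. r j \<noteq> 7) (Act (\<lambda>r. [(j, None, MoveL), (i, Some 1, MoveR)])))
     (\<sigma>(i := tp ?u (Suc v), j := tp [] v)) (2 * v + 1) (\<sigma>(i := unary_tape (2 * v)))"
    by (rule runs_While_index[where f = "\<lambda>t. \<sigma>(i := unary_tape (v + t), j := tp [] (v - t))" and N = v and C = 1])
      (use assms in \<open>auto simp: rdt_tp_ne7 unary_tape_def wrt_tp_append replicate_append_same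
         mult_2 intro!: runs_Act\<close>)
  show ?thesis
    unfolding double_def
    by (rule runs_Seq[OF 1 runs_Seq[OF 2 runs_Seq[OF 3 runs_Seq[OF 4 5 order_refl] order_refl] order_refl]])
      (use assms in auto)
qed

definition bits_val :: "nat \<Rightarrow> nat list \<Rightarrow> nat" where
  "bits_val = foldl (\<lambda>v d. 2 * v + (d - 1))"

text \<open>Horner's scheme on the binary digits. Unary numbers are affordable: \<open>n\<close> is
  bounded by the input, which lists \<open>n * n\<close> matrix entries, and \<open>k\<close> is the
  parameter.\<close>

definition to_unary :: "nat \<Rightarrow> nat \<Rightarrow> nat \<Rightarrow> cmd" where
  "to_unary x i j = While (\<lambda>r. r x = 1 \<or> r x = 2)
     (double i j ;; Act (\<lambda>r. (x, None, MoveR) # (if r x = 2 then [(i, Some 1, MoveR)] else [])))"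

lemma bits_val_ge: "v \<le> bits_val v ds"
proof (induction ds arbitrary: v)
  case (Cons d ds)
  have "2 * v + (d - 1) \<le> bits_val (2 * v + (d - 1)) ds" by (rule Cons)
  then show ?case by (simp add: bits_val_def)
qed (simp add: bits_val_def)

lemma runs_to_unary:
  assumes "\<sigma> x = tq (pre @ ds @ post) (length pre)" "\<sigma> i = unary_tape v" "\<sigma> j = tp [] 0"
    and "distinct [x, i, j]" "set ds \<subseteq> {1, 2}" "post = [] \<or> hd post \<notin> {1, 2}"
    and "bits_val v ds \<le> V" "length ds * (6 * V + 13) + 1 \<le> T"
  shows "runs (to_unary x i j) \<sigma> T
    (\<sigma>(x := tq (pre @ ds @ post) (length pre + length ds), i := unary_tape (bits_val v ds)))"
  using assms
proof (induction ds arbitrary: \<sigma> pre v T)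
  case Nil
  have "\<not> (rd \<sigma> x = 1 \<or> rd \<sigma> x = 2)"
    using Nil by (cases post) auto
  then have "runs (to_unary x i j) \<sigma> T \<sigma>"
    unfolding to_unary_def using Nil by (intro runs_WhileF) auto
  then show ?case using Nil by (simp add: bits_val_def fun_upd_idem)
next
  case (Cons d ds)
  let ?w = "pre @ (d # ds) @ post" and ?v = "2 * v + (d - 1)"
  let ?A = "Act (\<lambda>r. (x, None, MoveR) # (if r x = 2 then [(i, Some 1, MoveR)] else []))"
  let ?\<sigma> = "\<sigma>(x := tq ?w (Suc (length pre)), i := unary_tape ?v)"
  have d: "d = 1 \<or> d = 2" using Cons.prems(5) by auto
  have bv: "bits_val ?v ds = bits_val v (d # ds)" by (simp add: bits_val_def)
  have vV: "v \<le> V" using bits_val_ge[of v "d # ds"] Cons.prems(7) by simp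
  have 1: "runs (double i j) \<sigma> (6 * V + 9) (\<sigma>(i := unary_tape (2 * v)))"
    by (rule runs_double) (use Cons.prems vV in auto)
  have 2: "runs ?A (\<sigma>(i := unary_tape (2 * v))) 1 ?\<sigma>"
    by (rule runs_Act)
      (use Cons.prems d in \<open>auto simp: unary_tape_def wrt_tp_append replicate_append_same fun_eq_iff\<close>)
  have 3: "runs (to_unary x i j) ?\<sigma> (length ds * (6 * V + 13) + 1)
     (?\<sigma>(x := tq ((pre @ [d]) @ ds @ post) (length (pre @ [d]) + length ds), i := unary_tape (bits_val ?v ds)))"
    by (rule Cons.IH) (use Cons.prems bv in auto)
  have "runs (to_unary x i j) \<sigma> T
     (?\<sigma>(x := tq ((pre @ [d]) @ ds @ post) (length (pre @ [d]) + length ds), i := unary_tape (bits_val ?v ds)))"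
    unfolding to_unary_def
    by (rule runs_WhileT[OF _ runs_Seq[OF 1 2 order_refl] 3[unfolded to_unary_def]])
      (use Cons.prems d in auto)
  moreover have "?\<sigma>(x := tq ((pre @ [d]) @ ds @ post) (length (pre @ [d]) + length ds), i := unary_tape (bits_val ?v ds)) =
      \<sigma>(x := tq ?w (length pre + length (d # ds)), i := unary_tape (bits_val v (d # ds)))"
    using Cons.prems(4) bv by (auto simp: fun_eq_iff)
  ultimately show ?case by (simp only:)
qed

declare bin.simps [simp del]

lemma set_bin: "set (bin n) \<subseteq> {1, 2}"
proof (induction n rule: bin.induct)
  case (1 n)
  then show ?case by (subst bin.simps) auto
qed

lemma bits_val_bin: "bits_val 0 (bin n) = n"
proof (induction n rule: bin.induct)
  case (1 n)
  show ?case
  proof (cases "n < 2")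
    case False
    then have "bits_val 0 (bin n) = 2 * bits_val 0 (bin (n div 2)) + n mod 2"
      by (subst bin.simps) (simp add: bits_val_def)
    then show ?thesis using 1 False by simp
  qed (subst bin.simps, simp add: bits_val_def)
qed

section \<open>Searching for a bad triple\<close>

text \<open>The tapes: 0 input, 1 \<open>n\<close> in unary, 2 \<open>k\<close> in unary (the head stands on cell \<open>k - s\<close> while solutions of
  size \<open>s\<close> are enumerated), 3 adjacency matrix, 4 assignment, 5 to 7 copies of the edited matrix, 8 \<open>s\<close> in
  unary, 9 guess string, 10 and 11 row and column in binary, 12 head position of the output tape,
  13 row index while reading the input, 14 verdict of the feasibility test, 15 status, 16 output.

  A matrix is stored row by row.  Its letters: 3 ends a row, 4 is a cell on or below the diagonal; above
  the diagonal 1 and 2 are a missing and a present edge that may still be flipped, 5 and 6 frozen ones.\<close>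

definition bad3 :: "nat \<Rightarrow> nat \<Rightarrow> nat \<Rightarrow> bool" where
  "bad3 x y z \<longleftrightarrow> {x, y, z} \<subseteq> {1, 2, 5, 6} \<and>
     (x \<in> {2, 6} \<and> y \<in> {2, 6} \<and> z \<in> {1, 5} \<or> x \<in> {2, 6} \<and> y \<in> {1, 5} \<and> z \<in> {2, 6} \<or>
      x \<in> {1, 5} \<and> y \<in> {2, 6} \<and> z \<in> {2, 6})"

definition shape :: "nat \<Rightarrow> nat list \<Rightarrow> bool" where
  "shape n h \<longleftrightarrow> length h = n * (n + 1) \<and> (\<forall>j<length h. h ! j = 3 \<longleftrightarrow> j mod (n + 1) = n) \<and>
     set h \<subseteq> {1, 2, 3, 4, 5, 6}"

lemma shapeD:
  assumes "shape n h"
  shows "length h = n * (n + 1)" "7 \<notin> set h" "0 \<notin> set h"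
    "\<And>a. a < n \<Longrightarrow> h ! (a * (n + 1) + n) = 3" "\<And>a c. a < n \<Longrightarrow> c < n \<Longrightarrow> h ! (a * (n + 1) + c) \<noteq> 3"
    "\<And>j. j < length h \<Longrightarrow> h ! j \<noteq> 0" "\<And>j. j < length h \<Longrightarrow> h ! j \<noteq> 7"
proof -
  have less: "a * (n + 1) + c < n * (n + 1)" if "a < n" "c \<le> n" for a c
  proof -
    have "a * (n + 1) + c < Suc a * (n + 1)" using that by simp
    also have "\<dots> \<le> n * (n + 1)" using that by (intro mult_right_mono) auto
    finally show ?thesis .
  qed
  show "length h = n * (n + 1)" and 7: "7 \<notin> set h" and 0: "0 \<notin> set h" using assms by (auto simp: shape_def)
  show "h ! (a * (n + 1) + n) = 3" if "a < n" for a
    using assms less[of a n] that unfolding shape_def by (metis le_refl less_add_one mod_less mod_mult_self3)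
  show "h ! (a * (n + 1) + c) \<noteq> 3" if "a < n" "c < n" for a c
    using assms less[of a c] that unfolding shape_def
    by (metis less_SucI Suc_eq_plus1 less_imp_le mod_less mod_mult_self3 nat_neq_iff)
  show "\<And>j. j < length h \<Longrightarrow> h ! j \<noteq> 0" "\<And>j. j < length h \<Longrightarrow> h ! j \<noteq> 7"
    using 0 7 nth_mem by metis+
qed

lemma cell_less:
  fixes a c n :: nat
  assumes "a < n" "c \<le> n" shows "a * (n + 1) + c < n * (n + 1)"
proof -
  have "a * (n + 1) + c < Suc a * (n + 1)" using assms by simp
  also have "\<dots> \<le> n * (n + 1)" using assms by (intro mult_right_mono) auto
  finally show ?thesis .
qed

text \<open>The triples of vertices are visited in lexicographic order; the last coordinate also takes the
  value \<open>n\<close>, which is the row separator.\<close>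

definition va :: "nat \<Rightarrow> nat \<Rightarrow> nat" where "va n t = t div (n + 1) div n"
definition vb :: "nat \<Rightarrow> nat \<Rightarrow> nat" where "vb n t = t div (n + 1) mod n"
definition vc :: "nat \<Rightarrow> nat \<Rightarrow> nat" where "vc n t = t mod (n + 1)"

definition cell1 :: "nat \<Rightarrow> nat \<Rightarrow> nat" where "cell1 n t = va n t * (n + 1) + vb n t"
definition cell2 :: "nat \<Rightarrow> nat \<Rightarrow> nat" where "cell2 n t = va n t * (n + 1) + vc n t"
definition cell3 :: "nat \<Rightarrow> nat \<Rightarrow> nat" where "cell3 n t = vb n t * (n + 1) + vc n t"

text \<open>Triples that are not increasing are excluded by the letters: in the matrix of a graph
  one of their cells holds 3 or 4, which \<open>bad3\<close> rejects.\<close>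

definition bad_at :: "nat \<Rightarrow> nat list \<Rightarrow> nat \<Rightarrow> bool" where
  "bad_at n h t \<longleftrightarrow> t < n * n * (n + 1) \<and> bad3 (h ! cell1 n t) (h ! cell2 n t) (h ! cell3 n t)"

lemma triple_ranges:
  assumes "t < n * n * (n + 1)"
  shows "0 < n" "va n t < n" "vb n t < n" "vc n t \<le> n"
proof -
  show n: "0 < n" using assms by (cases n) auto
  show "va n t < n" unfolding va_def using assms
    by (simp add: less_mult_imp_div_less mult.commute mult.left_commute)
  show "vb n t < n" "vc n t \<le> n" using n by (simp_all add: vb_def vc_def less_Suc_eq_le[symmetric])
qed

lemma triple_step:
  assumes "t < n * n * (n + 1)"
  shows "vc n t < n \<Longrightarrow> va n (Suc t) = va n t \<and> vb n (Suc t) = vb n t \<and> vc n (Suc t) = Suc (vc n t)"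
    and "vc n t = n \<Longrightarrow> Suc (vb n t) < n \<Longrightarrow>
      va n (Suc t) = va n t \<and> vb n (Suc t) = Suc (vb n t) \<and> vc n (Suc t) = 0"
    and "vc n t = n \<Longrightarrow> Suc (vb n t) = n \<Longrightarrow>
      va n (Suc t) = Suc (va n t) \<and> vb n (Suc t) = 0 \<and> vc n (Suc t) = 0"
proof -
  note n = triple_ranges(1)[OF assms]
  show "vc n t < n \<Longrightarrow> va n (Suc t) = va n t \<and> vb n (Suc t) = vb n t \<and> vc n (Suc t) = Suc (vc n t)"
    by (auto simp: va_def vb_def vc_def mod_Suc div_Suc)
  assume "vc n t = n"
  then have 1: "vc n (Suc t) = 0" "Suc t div (n + 1) = Suc (t div (n + 1))"
    by (auto simp: vc_def mod_Suc div_Suc)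
  show "va n (Suc t) = va n t \<and> vb n (Suc t) = Suc (vb n t) \<and> vc n (Suc t) = 0" if "Suc (vb n t) < n"
    using 1 that unfolding va_def vb_def by (auto simp: mod_Suc div_Suc)
  show "va n (Suc t) = Suc (va n t) \<and> vb n (Suc t) = 0 \<and> vc n (Suc t) = 0" if "Suc (vb n t) = n"
    using 1 that unfolding va_def vb_def by (auto simp: mod_Suc div_Suc)
qed

text \<open>The heads of tapes 5, 6, 7 stand on the cells (a, b), (a, c), (b, c). A separator under
  head 6 means that c has run through. Then head 7 enters row b + 1 and head 5 moves to b + 1. If
  head 5 finds a separator there, a is increased, which puts heads 5 and 6 at the start of the next
  row and head 7 at the very first cell; otherwise head 6 returns to the start of row a.\<close>

definition advance :: cmd where
  "advance = Cond (\<lambda>r. r 6 \<noteq> 3) (Act (\<lambda>r. [(6, None, MoveR), (7, None, MoveR)]))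
     (mvR 7 ;; mvR 5 ;;
      Cond (\<lambda>r. r 5 = 3) (mvR 5 ;; mvR 6 ;; rewind 7)
        (mvL 6 ;; While (\<lambda>r. r 6 \<noteq> 3 \<and> r 6 \<noteq> 7) (mvL 6) ;; mvR 6))"

definition search :: cmd where
  "search = While (\<lambda>r. r 5 \<noteq> 0 \<and> \<not> bad3 (r 5) (r 6) (r 7)) advance"

definition at_triple :: "nat \<Rightarrow> nat list \<Rightarrow> store \<Rightarrow> nat \<Rightarrow> store" where
  "at_triple n h \<sigma> t = \<sigma>(5 := tp h (Suc (cell1 n t)), 6 := tp h (Suc (cell2 n t)), 7 := tp h (Suc (cell3 n t)))"

lemma runs_advance:
  assumes h: "shape n h" and t: "t < n * n * (n + 1)" and T: "4 * length h + 15 \<le> T"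
  shows "runs advance (at_triple n h \<sigma> t) T (at_triple n h \<sigma> (Suc t))"
proof -
  note r = triple_ranges[OF t]
  note hD = shapeD[OF h]
  let ?a = "va n t" and ?b = "vb n t" and ?c = "vc n t"
  have len: "?a * (n + 1) + ?c < length h" "?b * (n + 1) + ?c < length h" "?a * (n + 1) + ?b < length h"
      "?a * (n + 1) + Suc ?b < length h"
    using cell_less[of ?a n ?c] cell_less[of ?b n ?c] cell_less[of ?a n ?b] cell_less[of ?a n "Suc ?b"]
      r hD(1) by simp_all
  have nl: "n \<le> length h" using hD(1) by simp
  consider "?c < n" | "?c = n" "Suc ?b < n" | "?c = n" "Suc ?b = n" using r by linarith
  then show ?thesis
  proof cases
    case 1
    have "runs (Act (\<lambda>r. [(6, None, MoveR), (7, None, MoveR)])) (at_triple n h \<sigma> t) 1 (at_triple n h \<sigma> (Suc t))"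
      by (rule runs_Act) (use triple_step(1)[OF t 1] in
          \<open>auto simp: at_triple_def cell1_def cell2_def cell3_def fun_eq_iff\<close>)
    then show ?thesis
      unfolding advance_def
      by (rule runs_CondT[rotated]) (use 1 r hD(5)[of ?a ?c] len T in \<open>auto simp: at_triple_def cell2_def\<close>)
  next
    case 2
    let ?\<sigma> = "at_triple n h \<sigma> t"
    let ?r = "?a * (n + 1)"
    have e: "va n (Suc t) = ?a" "vb n (Suc t) = Suc ?b" "vc n (Suc t) = 0" using triple_step(2)[OF t 2] by auto
    have 3: "runs (mvR 7) ?\<sigma> 1 (?\<sigma>(7 := tp h (Suc (cell3 n (Suc t)))))"
      by (rule runs_mvR) (use 2 e in \<open>auto simp: at_triple_def cell3_def algebra_simps\<close>)
    have 4: "runs (mvR 5) (?\<sigma>(7 := tp h (Suc (cell3 n (Suc t))))) 1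
        (?\<sigma>(7 := tp h (Suc (cell3 n (Suc t))), 5 := tp h (Suc (cell1 n (Suc t)))))" (is "runs _ _ _ ?\<sigma>1")
      by (rule runs_mvR) (use 2 e in \<open>auto simp: at_triple_def cell1_def fun_eq_iff\<close>)
    have 5: "runs (mvL 6) ?\<sigma>1 1 (?\<sigma>1(6 := tp h (?r + n)))"
      by (rule runs_mvL) (use 2 e in \<open>auto simp: at_triple_def cell2_def fun_eq_iff\<close>)
    have 6: "runs (While (\<lambda>r. r 6 \<noteq> 3 \<and> r 6 \<noteq> 7) (mvL 6)) (?\<sigma>1(6 := tp h (?r + n))) (2 * n + 1) (?\<sigma>1(6 := tp h ?r))"
    proof (rule runs_While_index[where f = "\<lambda>u. ?\<sigma>1(6 := tp h (?r + n - u))" and N = n and C = 1])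
      fix u assume u: "u < n"
      have "?r + n - u = Suc (?r + (n - Suc u))" using u by simp
      then show "rd (?\<sigma>1(6 := tp h (?r + n - u))) 6 \<noteq> 3 \<and> rd (?\<sigma>1(6 := tp h (?r + n - u))) 6 \<noteq> 7"
        using hD(5)[of ?a "n - Suc u"] hD(7)[of "?r + (n - Suc u)"] u r by simp
      show "runs (mvL 6) (?\<sigma>1(6 := tp h (?r + n - u))) 1 (?\<sigma>1(6 := tp h (?r + n - Suc u)))"
        by (rule runs_mvL) auto
    next
      \<comment> \<open>To the left of row a lies the separator of the preceding row or, for the
        first row, the end marker 7.\<close>
      show "\<not> (rd (?\<sigma>1(6 := tp h (?r + n - n))) 6 \<noteq> 3 \<and> rd (?\<sigma>1(6 := tp h (?r + n - n))) 6 \<noteq> 7)"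
      proof (cases ?a)
        case (Suc a')
        then have "?r = Suc (a' * (n + 1) + n)" by simp
        then show ?thesis using hD(4)[of a'] Suc r cell_less[of a' n n] hD(1) by (simp add: add.assoc)
      qed simp
    qed auto
    have 7: "runs (mvR 6) (?\<sigma>1(6 := tp h ?r)) 1 (at_triple n h \<sigma> (Suc t))"
      by (rule runs_mvR) (use 2 e in \<open>auto simp: at_triple_def cell1_def cell2_def cell3_def fun_eq_iff\<close>)
    have "runs (Cond (\<lambda>r. r 5 = 3) (mvR 5 ;; mvR 6 ;; rewind 7)
        (mvL 6 ;; While (\<lambda>r. r 6 \<noteq> 3 \<and> r 6 \<noteq> 7) (mvL 6) ;; mvR 6)) ?\<sigma>1 (2 * n + 6) (at_triple n h \<sigma> (Suc t))"
      by (rule runs_CondF[OF _ runs_Seq[OF 5 runs_Seq[OF 6 7 order_refl] order_refl]])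
        (use 2 e r hD(5)[of ?a "Suc ?b"] len in \<open>auto simp: cell1_def\<close>)
    note runs_Seq[OF 3 runs_Seq[OF 4 this order_refl] order_refl]
    then show ?thesis
      unfolding advance_def
      by (rule runs_CondF[rotated]) (use 2 r hD(4)[of ?a] len T nl in \<open>auto simp: at_triple_def cell2_def\<close>)
  next
    case 3
    let ?\<sigma> = "at_triple n h \<sigma> t"
    have e: "va n (Suc t) = Suc ?a" "vb n (Suc t) = 0" "vc n (Suc t) = 0" using triple_step(3)[OF t 3] by auto
    \<comment> \<open>Here b is the last row, so head 7 has run off the matrix onto the first
      blank.\<close>
    let ?p = "Suc (Suc (cell3 n t))"
    have c1: "cell1 n (Suc t) = Suc (Suc (cell1 n t))" and c2: "cell2 n (Suc t) = Suc (cell2 n t)"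
      using 3 e by (simp_all add: cell1_def cell2_def algebra_simps)
    have "Suc (cell1 n t) = ?a * (n + 1) + n" using 3 by (simp add: cell1_def)
    then have c3: "Suc (cell1 n t) < length h" "h ! Suc (cell1 n t) = 3"
      using hD(4)[of ?a] cell_less[of ?a n n] hD(1) r by simp_all
    have 4: "runs (mvR 7) ?\<sigma> 1 (?\<sigma>(7 := tp h ?p))"
      by (rule runs_mvR) (auto simp: at_triple_def)
    have 5: "runs (mvR 5) (?\<sigma>(7 := tp h ?p)) 1 (?\<sigma>(7 := tp h ?p, 5 := tp h (Suc (Suc (cell1 n t)))))"
        (is "runs _ _ _ ?\<sigma>1")
      by (rule runs_mvR) (auto simp: at_triple_def fun_eq_iff)
    have 6: "runs (mvR 5) ?\<sigma>1 1 (?\<sigma>1(5 := tp h (Suc (cell1 n (Suc t)))))" (is "runs _ _ _ ?\<sigma>2")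
      by (rule runs_mvR) (auto simp: c1)
    have 7: "runs (mvR 6) ?\<sigma>2 1 (?\<sigma>2(6 := tp h (Suc (cell2 n (Suc t)))))" (is "runs _ _ _ ?\<sigma>3")
      by (rule runs_mvR) (auto simp: at_triple_def c2)
    have 8: "runs (rewind 7) ?\<sigma>3 (2 * length h + 5) (?\<sigma>3(7 := tp h 1))"
      by (rule runs_rewind[where p = ?p]) (use hD len in \<open>auto simp: cell3_def\<close>)
    have 9: "?\<sigma>3(7 := tp h 1) = at_triple n h \<sigma> (Suc t)"
      using e by (auto simp: at_triple_def cell3_def fun_eq_iff)
    have "runs (Cond (\<lambda>r. r 5 = 3) (mvR 5 ;; mvR 6 ;; rewind 7)
        (mvL 6 ;; While (\<lambda>r. r 6 \<noteq> 3 \<and> r 6 \<noteq> 7) (mvL 6) ;; mvR 6)) ?\<sigma>1 (2 * length h + 10) (at_triple n h \<sigma> (Suc t))"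
      by (rule runs_CondT[OF _ runs_Seq[OF 6 runs_Seq[OF 7 8[unfolded 9] order_refl] order_refl]])
        (use c3 in auto)
    note runs_Seq[OF 4 runs_Seq[OF 5 this order_refl] order_refl]
    then show ?thesis
      unfolding advance_def
      by (rule runs_CondF[rotated]) (use 3 r hD(4)[of ?a] len T nl in \<open>auto simp: at_triple_def cell2_def\<close>)
  qed
qed

lemma runs_search:
  assumes h: "shape n h" and \<sigma>: "\<sigma> 5 = tp h 1" "\<sigma> 6 = tp h 1" "\<sigma> 7 = tp h 1"
    and T: "length h * length h * (4 * length h + 16) + 1 \<le> T"
  shows "if \<exists>t. bad_at n h t then runs search \<sigma> T (at_triple n h \<sigma> (LEAST t. bad_at n h t))
     else runs search \<sigma> T (at_triple n h \<sigma> (n * n * (n + 1)))"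
proof -
  define N where "N = (if \<exists>t. bad_at n h t then LEAST t. bad_at n h t else n * n * (n + 1))"
  have init: "\<sigma> = at_triple n h \<sigma> 0"
    using \<sigma> by (auto simp: at_triple_def cell1_def cell2_def cell3_def va_def vb_def vc_def)
  have nb: "\<not> bad_at n h t" if "t < N" for t
    using that not_less_Least[of t "bad_at n h"] unfolding N_def by (auto split: if_splits)
  have Nle: "N \<le> n * n * (n + 1)"
  proof (cases "\<exists>t. bad_at n h t")
    case True
    then have "bad_at n h N" unfolding N_def by (auto intro: LeastI_ex)
    then show ?thesis by (simp add: bad_at_def)
  qed (simp add: N_def)
  have len: "length h = n * (n + 1)" using shapeD(1)[OF h] .
  have reads: "rd (at_triple n h \<sigma> t) 5 = h ! cell1 n t \<and> rd (at_triple n h \<sigma> t) 6 = h ! cell2 n t \<and>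
      rd (at_triple n h \<sigma> t) 7 = h ! cell3 n t \<and> h ! cell1 n t \<noteq> 0" if "t < n * n * (n + 1)" for t
  proof -
    note r = triple_ranges[OF that]
    have "cell1 n t < length h" "cell2 n t < length h" "cell3 n t < length h"
      using cell_less[of "va n t" n "vb n t"] cell_less[of "va n t" n "vc n t"] cell_less[of "vb n t" n "vc n t"] r
      by (auto simp: len cell1_def cell2_def cell3_def)
    then show ?thesis using shapeD(6)[OF h] by (simp add: at_triple_def)
  qed
  have "runs search \<sigma> T (at_triple n h \<sigma> N)"
    unfolding search_def
  proof (rule runs_While_index[where f = "at_triple n h \<sigma>" and N = N and C = "4 * length h + 15"])
    fix t assume t: "t < N"
    then have t': "t < n * n * (n + 1)" using Nle by simp
    show "rd (at_triple n h \<sigma> t) 5 \<noteq> 0 \<and>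
        \<not> bad3 (rd (at_triple n h \<sigma> t) 5) (rd (at_triple n h \<sigma> t) 6) (rd (at_triple n h \<sigma> t) 7)"
      using nb[OF t] reads[OF t'] t' by (simp add: bad_at_def del: rd_simp)
    show "runs advance (at_triple n h \<sigma> t) (4 * length h + 15) (at_triple n h \<sigma> (Suc t))"
      by (rule runs_advance[OF h t' order_refl])
  next
    show "\<not> (rd (at_triple n h \<sigma> N) 5 \<noteq> 0 \<and>
        \<not> bad3 (rd (at_triple n h \<sigma> N) 5) (rd (at_triple n h \<sigma> N) 6) (rd (at_triple n h \<sigma> N) 7))"
    proof (cases "\<exists>t. bad_at n h t")
      case True
      then have "bad_at n h N" unfolding N_def by (auto intro: LeastI_ex)
      then show ?thesis using reads[of N] by (simp add: bad_at_def del: rd_simp)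
    next
      case False
      then have "N = n * n * (n + 1)" by (simp add: N_def)
      then have "N div (n + 1) = n * n" by (metis Suc_eq_plus1 nat.simps(3) nonzero_mult_div_cancel_right)
      \<comment> \<open>After the last triple, head 5 stands right behind the matrix; the blank
        found there ends the loop.\<close>
      then have "cell1 n N = length h" by (cases "n = 0") (simp_all add: cell1_def va_def vb_def len)
      then show ?thesis by (simp add: at_triple_def)
    qed
  next
    have "N \<le> length h * length h"
    proof -
      have "n \<le> length h" by (simp add: len)
      then have "n * (n * (n + 1)) \<le> length h * length h"
        using len mult_le_mono1 by metis
      then show ?thesis using Nle by (metis mult.assoc order_trans)
    qed
    then have "N * (4 * length h + 16) \<le> length h * length h * (4 * length h + 16)" by (rule mult_le_mono1)
    then show "N * (4 * length h + 15 + 1) + 1 \<le> T" using T by (simp add: algebra_simps)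
  qed (use init in auto)
  then show ?thesis unfolding N_def by (cases "\<exists>t. bad_at n h t") (simp_all only: if_True if_False)
qed

text \<open>A word is replaced in place from left to right, so the tape holds a new prefix followed
  by the rest of the old word. Cells beyond the old end are included, since the copies are empty at
  first.\<close>

lemma wrt_tp_overwrite:
  assumes "j < length h" "h ! j \<noteq> 0"
  shows "wrt (h ! j) (tp (take j h @ drop j old) (Suc j)) = tp (take (Suc j) h @ drop (Suc j) old) (Suc j)"
proof (cases "j < length old")
  case True
  then have "drop j old = old ! j # drop (Suc j) old" by (metis Cons_nth_drop_Suc)
  then have "(take j h @ drop j old)[j := h ! j] = take (Suc j) h @ drop (Suc j) old"
    using assms by (simp add: list_update_append take_Suc_conv_app_nth)
  then show ?thesis using True assms wrt_tp_update[of j "take j h @ drop j old" "h ! j"] by simp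
next
  case False
  then show ?thesis using assms wrt_tp_append[of "h ! j" "Suc j" "take j h"]
    by (simp add: take_Suc_conv_app_nth)
qed

definition rewind3 :: cmd where "rewind3 = rewind 5 ;; rewind 6 ;; rewind 7"

lemma runs_rewind3:
  assumes "\<sigma> 5 = tp h5 p5" "\<sigma> 6 = tp h6 p6" "\<sigma> 7 = tp h7 p7" "7 \<notin> set h5" "7 \<notin> set h6" "7 \<notin> set h7"
    "p5 \<le> P" "p6 \<le> P" "p7 \<le> P" "6 * P + 11 \<le> T"
  shows "runs rewind3 \<sigma> T (\<sigma>(5 := tp h5 1, 6 := tp h6 1, 7 := tp h7 1))"
proof -
  have 1: "runs (rewind 5) \<sigma> (2 * P + 3) (\<sigma>(5 := tp h5 1))"
    by (rule runs_rewind[where h = h5 and p = p5]) (use assms in auto)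
  have 2: "runs (rewind 6) (\<sigma>(5 := tp h5 1)) (2 * P + 3) (\<sigma>(5 := tp h5 1, 6 := tp h6 1))"
    by (rule runs_rewind[where h = h6 and p = p6]) (use assms in auto)
  have 3: "runs (rewind 7) (\<sigma>(5 := tp h5 1, 6 := tp h6 1)) (2 * P + 3) (\<sigma>(5 := tp h5 1, 6 := tp h6 1, 7 := tp h7 1))"
    by (rule runs_rewind[where h = h7 and p = p7]) (use assms in auto)
  show ?thesis unfolding rewind3_def
    by (rule runs_Seq[OF 1 runs_Seq[OF 2 3 order_refl]]) (use assms in auto)
qed

section \<open>Following a guess string\<close>

definition cell :: "nat \<Rightarrow> nat \<Rightarrow> nat \<Rightarrow> nat" where
  "cell n x t = (if x = 1 then cell1 n t else if x = 2 then cell2 n t else cell3 n t)"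

text \<open>This is the copy whose head stands on \<open>cell n x t\<close> when the search has
  stopped at the triple \<open>t\<close>.\<close>

definition guess_tape :: "nat \<Rightarrow> nat" where
  "guess_tape x = (if x = 1 then 5 else if x = 2 then 6 else 7)"

text \<open>A guess string resolves the bad triples one after the other: its next letter says which of the
  three pairs of the first bad triple is flipped.\<close>

primrec chk :: "nat \<Rightarrow> nat list \<Rightarrow> nat list \<Rightarrow> bool" where
  "chk n [] h \<longleftrightarrow> (\<nexists>t. bad_at n h t)"
| "chk n (x # g) h \<longleftrightarrow> (\<nexists>t. bad_at n h t) \<or>
     (let y = cell n x (LEAST t. bad_at n h t) in h ! y \<in> {1, 2} \<and> chk n g (h[y := 3 - h ! y]))"

definition can_flip :: "(nat \<Rightarrow> nat) \<Rightarrow> bool" where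
  "can_flip r \<longleftrightarrow> r 9 \<noteq> 0 \<and> r (guess_tape (r 9)) \<in> {1, 2}"

definition flip :: cmd where
  "flip = Act (\<lambda>r. [(guess_tape (r 9), Some (3 - r (guess_tape (r 9))), Stay), (9, None, MoveR)])"

text \<open>After a flip on one of the three copies, the flipped value is the one that disagrees.\<close>

definition sync :: cmd where
  "sync = rewind3 ;; While (\<lambda>r. r 5 \<noteq> 0) (Act (\<lambda>r.
     let v = (if r 6 = r 7 then r 5 else if r 5 = r 7 then r 6 else r 7)
     in [(5, Some v, MoveR), (6, Some v, MoveR), (7, Some v, MoveR)]))"

text \<open>The verdict on tape 14 is 0 while the guess string is being followed, 1 when no bad
  triple is left, and 2 when the string is used up or asks for a frozen pair. The value 3, set by
  other commands, rejects the prefix for good.\<close>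

definition round :: cmd where
  "round = search ;;
     Cond (\<lambda>r. bad3 (r 5) (r 6) (r 7)) (Cond can_flip (flip ;; sync) (put 14 2)) (put 14 1) ;; rewind3"

definition checks :: cmd where "checks = While (\<lambda>r. r 14 = 0) round"

lemma runs_sync:
  fixes i y v :: nat
  assumes \<sigma>: "\<sigma> 5 = tp (if i = 5 then h[y := v] else h) p5" "\<sigma> 6 = tp (if i = 6 then h[y := v] else h) p6"
      "\<sigma> 7 = tp (if i = 7 then h[y := v] else h) p7"
    and i: "i \<in> {5, 6, 7}" and y: "y < length h" and v: "v \<noteq> 0" "v \<noteq> 7"
    and h: "0 \<notin> set h" "7 \<notin> set h"
    and p: "p5 \<le> P" "p6 \<le> P" "p7 \<le> P" and T: "6 * P + 2 * length h + 13 \<le> T"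
  shows "runs sync \<sigma> T (copies (h[y := v]) (Suc (length h)) \<sigma>)"
proof -
  define h' where "h' = h[y := v]"
  define H where "H j = (if i = j then h' else h)" for j
  have h': "0 \<notin> set h'" "7 \<notin> set h'" "length h' = length h"
    using h v set_update_subset_insert[of h y v] by (auto simp: h'_def)
  have H: "7 \<notin> set (H j)" "length (H j) = length h" for j using h h' by (auto simp: H_def)
  have h'0: "h' ! j \<noteq> 0" if "j < length h" for j using h' that by (metis nth_mem)
  let ?f = "\<lambda>j. \<sigma>(5 := tp (take j h' @ drop j (H 5)) (Suc j), 6 := tp (take j h' @ drop j (H 6)) (Suc j),
      7 := tp (take j h' @ drop j (H 7)) (Suc j))"
  have 1: "runs rewind3 \<sigma> (6 * P + 11) (?f 0)"
    using runs_rewind3[of \<sigma> "H 5" p5 "H 6" p6 "H 7" p7 P "6 * P + 11"] \<sigma> H p by (simp add: H_def h'_def)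
  have 2: "runs (While (\<lambda>r. r 5 \<noteq> 0) (Act (\<lambda>r.
     let v = (if r 6 = r 7 then r 5 else if r 5 = r 7 then r 6 else r 7)
     in [(5, Some v, MoveR), (6, Some v, MoveR), (7, Some v, MoveR)]))) (?f 0) (2 * length h + 1) (?f (length h))"
  proof (rule runs_While_index[where f = ?f and N = "length h" and C = 1])
    fix j assume j: "j < length h"
    have r: "rd (?f j) 5 = H 5 ! j" "rd (?f j) 6 = H 6 ! j" "rd (?f j) 7 = H 7 ! j"
      using j h' H by (simp_all add: nth_append min_def)
    have Hj: "H k ! j = (if i = k \<and> j = y then v else h ! j)" for k
      using j by (auto simp: H_def h'_def nth_list_update)
    have v': "(if H 6 ! j = H 7 ! j then H 5 ! j else if H 5 ! j = H 7 ! j then H 6 ! j else H 7 ! j) = h' ! j"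
      using i j unfolding Hj by (auto simp: h'_def nth_list_update)
    show "rd (?f j) 5 \<noteq> 0"
      unfolding r using h h' j by (metis H_def nth_mem)
    show "runs (Act (\<lambda>r. let v = (if r 6 = r 7 then r 5 else if r 5 = r 7 then r 6 else r 7)
     in [(5, Some v, MoveR), (6, Some v, MoveR), (7, Some v, MoveR)])) (?f j) 1 (?f (Suc j))"
      by (rule runs_Act)
        (unfold r v' Let_def, use j h' h'0[OF j] wrt_tp_overwrite[of j h'] in \<open>simp_all add: fun_eq_iff\<close>)
  qed (use h' H in auto)
  have 3: "?f (length h) = (copies h' (Suc (length h)) \<sigma>)"
    using h' H by simp
  show ?thesis unfolding sync_def h'_def[symmetric]
    by (rule runs_Seq[OF 1 2[unfolded 3]]) (use T in simp)
qed

lemma cell_lt: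
  assumes "t < n * n * (n + 1)"
  shows "cell1 n t < n * (n + 1)" "cell2 n t < n * (n + 1)" "cell3 n t < n * (n + 1)" "cell n x t < n * (n + 1)"
proof -
  note r = triple_ranges[OF assms]
  show "cell1 n t < n * (n + 1)" "cell2 n t < n * (n + 1)" "cell3 n t < n * (n + 1)"
    using cell_less[of "va n t" n "vb n t"] cell_less[of "va n t" n "vc n t"] cell_less[of "vb n t" n "vc n t"] r
    by (auto simp: cell1_def cell2_def cell3_def)
  then show "cell n x t < n * (n + 1)" by (simp add: cell_def)
qed

lemma shape_flip:
  assumes "shape n h" "h ! y \<in> {1, 2}" "y < length h"
  shows "shape n (h[y := 3 - h ! y])"
proof -
  have "set (h[y := 3 - h ! y]) \<subseteq> insert (3 - h ! y) (set h)" by (rule set_update_subset_insert)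
  then have "set (h[y := 3 - h ! y]) \<subseteq> {1, 2, 3, 4, 5, 6}" using assms by (auto simp: shape_def)
  moreover have "h[y := 3 - h ! y] ! j = 3 \<longleftrightarrow> h ! j = 3" if "j < length h" for j
    using assms(2) that by (cases "j = y") auto
  ultimately show ?thesis using assms(1) unfolding shape_def by auto
qed

lemma runs_round:
  assumes h: "shape n h" and \<sigma>: "\<sigma> 5 = tp h 1" "\<sigma> 6 = tp h 1" "\<sigma> 7 = tp h 1" "\<sigma> 9 = tp gg (Suc i)" "\<sigma> 14 = reg 0"
    and i: "i \<le> length gg" and gg: "set gg \<subseteq> {1, 2, 3}"
    and T: "length h * length h * (4 * length h + 16) + 20 * length h + 60 \<le> T"
  defines "t \<equiv> LEAST t. bad_at n h t"
  defines "y \<equiv> cell n (gg ! i) t"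
  shows "\<nexists>t. bad_at n h t \<Longrightarrow> runs round \<sigma> T (\<sigma>(14 := reg 1))"
    and "\<exists>t. bad_at n h t \<Longrightarrow> i = length gg \<or> h ! y \<notin> {1, 2} \<Longrightarrow> runs round \<sigma> T (\<sigma>(14 := reg 2))"
    and "\<exists>t. bad_at n h t \<Longrightarrow> i < length gg \<Longrightarrow> h ! y \<in> {1, 2} \<Longrightarrow>
      runs round \<sigma> T ((copies (h[y := 3 - h ! y]) 1 \<sigma>)(9 := tp gg (Suc (Suc i))))"
proof -
  let ?L = "length h"
  let ?W = "?L * ?L * (4 * ?L + 16) + 1"
  note hD = shapeD[OF h]
  note S = runs_search[OF h \<sigma>(1-3) order_refl]
  {
    assume nb: "\<nexists>t. bad_at n h t"
    define tt where "tt = n * n * (n + 1)"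
    have 1: "runs search \<sigma> ?W (at_triple n h \<sigma> tt)" using S nb unfolding tt_def by simp
    have d: "tt div (n + 1) = n * n" "tt mod (n + 1) = 0"
      unfolding tt_def by (metis Suc_eq_plus1 nat.simps(3) nonzero_mult_div_cancel_right, simp only: mod_mult_self2_is_0)
    have "va n tt = n" "vb n tt = 0" "vc n tt = 0"
      by (simp_all only: va_def vb_def vc_def d, simp_all)
    then have c: "cell1 n tt = ?L" "cell2 n tt = ?L" "cell3 n tt = 0"
      using hD(1) by (simp_all add: cell1_def cell2_def cell3_def)
    have 2: "runs (put 14 1) (at_triple n h \<sigma> tt) 1 ((at_triple n h \<sigma> tt)(14 := reg 1))" (is "runs _ _ _ ?\<sigma>1")
      by (rule runs_put) (use \<sigma> in \<open>auto simp: at_triple_def\<close>)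
    have 3: "runs (Cond (\<lambda>r. bad3 (r 5) (r 6) (r 7)) (Cond can_flip (flip ;; sync) (put 14 2)) (put 14 1))
      (at_triple n h \<sigma> tt) 2 ?\<sigma>1"
      by (rule runs_CondF[OF _ 2]) (auto simp: at_triple_def c bad3_def)
    have 4: "runs rewind3 ?\<sigma>1 (6 * Suc ?L + 11) (copies h 1 ?\<sigma>1)"
      by (rule runs_rewind3) (use hD c in \<open>auto simp: at_triple_def\<close>)
    have 5: "(copies h 1 ?\<sigma>1) = \<sigma>(14 := reg 1)"
      using \<sigma> by (auto simp: at_triple_def)
    show "runs round \<sigma> T (\<sigma>(14 := reg 1))"
      unfolding round_def by (rule runs_Seq[OF 1 runs_Seq[OF 3 4[unfolded 5] order_refl]]) (use T in simp)
  }
  assume b: "\<exists>t. bad_at n h t"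
  let ?\<sigma> = "at_triple n h \<sigma> t"
  have 1: "runs search \<sigma> ?W ?\<sigma>" using S b by (simp add: t_def)
  have bt: "bad_at n h t" unfolding t_def using b by (rule LeastI_ex)
  then have tl: "t < n * n * (n + 1)" by (simp add: bad_at_def)
  note c = cell_lt[OF tl, folded hD(1)]
  have bad: "bad3 (rd ?\<sigma> 5) (rd ?\<sigma> 6) (rd ?\<sigma> 7)"
    using bt c by (simp add: at_triple_def bad_at_def)
  let ?x = "rd ?\<sigma> 9"
  have x: "?x = (if i < length gg then gg ! i else 0)" using \<sigma> by (simp add: at_triple_def)
  have gi: "gg ! i \<in> {1, 2, 3}" if "i < length gg" using gg that nth_mem by blast
  have rx: "rd ?\<sigma> (guess_tape ?x) = h ! y" if "i < length gg"
    using x c that by (auto simp: guess_tape_def at_triple_def y_def cell_def simp del: rd_simp) (auto simp: c)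
  have cf: "can_flip (rd ?\<sigma>) \<longleftrightarrow> i < length gg \<and> h ! y \<in> {1, 2}"
    using rx x gi unfolding can_flip_def by (auto simp del: rd_simp)
  {
    assume nf: "i = length gg \<or> h ! y \<notin> {1, 2}"
    have 2: "runs (put 14 2) ?\<sigma> 1 (?\<sigma>(14 := reg 2))" (is "runs _ _ _ ?\<sigma>1")
      by (rule runs_put) (use \<sigma> in \<open>auto simp: at_triple_def\<close>)
    have "runs (Cond can_flip (flip ;; sync) (put 14 2)) ?\<sigma> 2 ?\<sigma>1"
      by (rule runs_CondF[OF _ 2]) (use nf cf in auto)
    then have 3: "runs (Cond (\<lambda>r. bad3 (r 5) (r 6) (r 7)) (Cond can_flip (flip ;; sync) (put 14 2)) (put 14 1))
      ?\<sigma> 3 ?\<sigma>1"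
      by (rule runs_CondT[rotated]) (use bad in auto)
    have 4: "runs rewind3 ?\<sigma>1 (6 * Suc ?L + 11) (copies h 1 ?\<sigma>1)"
      by (rule runs_rewind3[where P = "Suc ?L" and ?p5.0 = "Suc (cell1 n t)" and ?p6.0 = "Suc (cell2 n t)" and ?p7.0 = "Suc (cell3 n t)"])
        (use hD c in \<open>auto simp: at_triple_def\<close>)
    have 5: "(copies h 1 ?\<sigma>1) = \<sigma>(14 := reg 2)"
      using \<sigma> by (auto simp: at_triple_def)
    show "runs round \<sigma> T (\<sigma>(14 := reg 2))"
      unfolding round_def by (rule runs_Seq[OF 1 runs_Seq[OF 3 4[unfolded 5] order_refl]]) (use T in simp)
  }
  assume il: "i < length gg" and hy: "h ! y \<in> {1, 2}"
  define h' where "h' = h[y := 3 - h ! y]"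
  have yl: "y < length h" using c(4) by (simp add: y_def)
  have sh': "shape n h'" unfolding h'_def by (rule shape_flip[OF h hy yl])
  have l': "length h' = ?L" by (simp add: h'_def)
  define g where "g = guess_tape (gg ! i)"
  have g: "g \<in> {5, 6, 7}" by (simp add: g_def guess_tape_def)
  define \<sigma>1 where "\<sigma>1 = ?\<sigma>(9 := tp gg (Suc (Suc i)), g := tp h' (Suc y))"
  have g\<sigma>: "?\<sigma> g = tp h (Suc y)"
    using gi[OF il] by (auto simp: g_def guess_tape_def at_triple_def y_def cell_def)
  have 2: "runs flip ?\<sigma> 1 \<sigma>1"
    unfolding flip_def
  proof (rule runs_Act)
    have "rd ?\<sigma> 9 = gg ! i" using x il by simp
    then show "\<sigma>1 = act_store [(guess_tape (rd ?\<sigma> 9), Some (3 - rd ?\<sigma> (guess_tape (rd ?\<sigma> 9))), Stay), (9, None, MoveR)] ?\<sigma>"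
      using g\<sigma> yl \<sigma>(4) g by (auto simp: \<sigma>1_def g_def[symmetric] h'_def wrt_tp_update simp del: rd_simp)
        (auto simp: at_triple_def wrt_tp_update fun_eq_iff)
  qed simp
  define pos where "pos j = (if j = 5 then Suc (cell1 n t) else if j = 6 then Suc (cell2 n t) else Suc (cell3 n t))" for j :: nat
  have gy: "Suc y = pos g" using gi[OF il] by (auto simp: g_def guess_tape_def pos_def y_def cell_def)
  have s1: "\<sigma>1 j = tp (if g = j then h' else h) (pos j)" "pos j \<le> Suc ?L" if "j \<in> {5, 6, 7}" for j
    using that c(1-3) by (auto simp: \<sigma>1_def at_triple_def gy) (auto simp: pos_def)
  have 3: "runs sync \<sigma>1 (6 * Suc ?L + 2 * ?L + 13) (copies h' (Suc ?L) \<sigma>1)"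
    (is "runs _ _ _ ?\<sigma>2")
    unfolding h'_def
    by (rule runs_sync[where i = g and P = "Suc ?L"]) (use s1 g yl hy hD in \<open>auto simp: h'_def\<close>)
  have 4: "runs (Cond (\<lambda>r. bad3 (r 5) (r 6) (r 7)) (Cond can_flip (flip ;; sync) (put 14 2)) (put 14 1))
      ?\<sigma> (8 * ?L + 23) ?\<sigma>2"
    by (rule runs_CondT[OF _ runs_CondT[OF _ runs_Seq[OF 2 3 order_refl] order_refl]])
      (use bad cf il hy in auto)
  have 5: "runs rewind3 ?\<sigma>2 (6 * Suc ?L + 11) (copies h' 1 ?\<sigma>2)"
    by (rule runs_rewind3) (use shapeD[OF sh'] l' in auto)
  have 6: "(copies h' 1 ?\<sigma>2) =
      (copies h' 1 \<sigma>)(9 := tp gg (Suc (Suc i)))"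
    using g by (auto simp: \<sigma>1_def at_triple_def fun_eq_iff)
  show "runs round \<sigma> T ((copies (h[y := 3 - h ! y]) 1 \<sigma>)(9 := tp gg (Suc (Suc i))))"
    unfolding round_def h'_def[symmetric]
    by (rule runs_Seq[OF 1 runs_Seq[OF 4 5[unfolded 6] order_refl]]) (use T in simp)
qed

text \<open>Induction on the unread part of the guess string: a round either consumes one letter or
  settles the verdict. Only the shape of the final copies matters, as they are reloaded before the
  next string.\<close>

lemma runs_checks:
  assumes "shape n h" "\<sigma> 5 = tp h 1" "\<sigma> 6 = tp h 1" "\<sigma> 7 = tp h 1" "\<sigma> 9 = tp gg (Suc i)" "\<sigma> 14 = reg 0"
    and "i \<le> length gg" "set gg \<subseteq> {1, 2, 3}" "drop i gg = g"
    and "W = length h * length h * (4 * length h + 16) + 20 * length h + 61"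
  shows "\<exists>h' i'. shape n h' \<and> i' \<le> length gg \<and>
    runs checks \<sigma> ((length g + 1) * W + 1) ((copies h' 1 \<sigma>)(9 := tp gg (Suc i'), 14 := reg (if chk n g h then 1 else 2)))"
  using assms
proof (induction g arbitrary: h i \<sigma>)
  case Nil
  have i: "i = length gg" using Nil.prems by simp
  let ?\<sigma> = "(copies h 1 \<sigma>)(9 := tp gg (Suc i), 14 := reg (if chk n [] h then 1 else 2))"
  have e: "\<sigma>(14 := reg (if chk n [] h then 1 else 2)) = ?\<sigma>"
    using Nil.prems(2-5) by (auto simp: fun_eq_iff)
  have r: "runs round \<sigma> (W - 1) ?\<sigma>"
    using runs_round(1,2)[OF Nil.prems(1-8), of "W - 1"] Nil.prems(10) i unfolding e[symmetric] by auto
  have "runs checks \<sigma> ((length [] + 1) * W + 1) ?\<sigma>"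
    unfolding checks_def
    by (rule runs_WhileT[OF _ r runs_WhileF[OF _ order_refl]]) (use Nil.prems in auto)
  then show ?case using Nil.prems(1,7) by blast
next
  case (Cons x g)
  have i: "i < length gg" and x: "gg ! i = x" and g: "drop (Suc i) gg = g"
    using Cons.prems(9) by (metis drop_all linorder_not_le list.distinct(1),
        metis Cons_nth_drop_Suc drop_all linorder_not_le list.distinct(1) list.inject,
        metis drop_Suc list.sel(3) tl_drop)
  define t where "t = (LEAST t. bad_at n h t)"
  define y where "y = cell n x t"
  have W: "length h * length h * (4 * length h + 16) + 20 * length h + 60 \<le> W - 1" "W > 0" using Cons.prems(10) by auto
  note R = runs_round[OF Cons.prems(1-8) W(1), folded t_def, unfolded x, folded y_def]
  have T: "W \<le> (length (x # g) + 1) * W" by simp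
  show ?case
  proof (cases "(\<exists>t. bad_at n h t) \<and> h ! y \<in> {1, 2}")
    case True
    let ?h = "h[y := 3 - h ! y]"
    let ?\<sigma> = "(copies ?h 1 \<sigma>)(9 := tp gg (Suc (Suc i)))"
    have "bad_at n h t" unfolding t_def using True by (blast intro: LeastI_ex)
    then have y: "y < length h"
      using cell_lt(4)[of t n x] shapeD(1)[OF Cons.prems(1)] by (simp add: bad_at_def y_def)
    have "\<exists>h' i'. shape n h' \<and> i' \<le> length gg \<and>
      runs checks ?\<sigma> ((length g + 1) * W + 1) ((copies h' 1 ?\<sigma>)(9 := tp gg (Suc i'), 14 := reg (if chk n g ?h then 1 else 2)))"
      by (rule Cons.IH) (use Cons.prems shape_flip[OF Cons.prems(1) _ y] True i g in auto)
    then obtain h' i' where *: "shape n h'" "i' \<le> length gg"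
      "runs checks ?\<sigma> ((length g + 1) * W + 1) ((copies h' 1 ?\<sigma>)(9 := tp gg (Suc i'), 14 := reg (if chk n g ?h then 1 else 2)))" by blast
    have c: "chk n (x # g) h = chk n g ?h"
      using True by (auto simp: Let_def t_def[symmetric] y_def[symmetric])
    have e: "(copies h' 1 ?\<sigma>)(9 := tp gg (Suc i'), 14 := reg (if chk n g ?h then 1 else 2)) = (copies h' 1 \<sigma>)(9 := tp gg (Suc i'), 14 := reg (if chk n (x # g) h then 1 else 2))"
      unfolding c by (auto simp: fun_eq_iff)
    have "runs checks \<sigma> ((length (x # g) + 1) * W + 1) ((copies h' 1 \<sigma>)(9 := tp gg (Suc i'), 14 := reg (if chk n (x # g) h then 1 else 2)))"
      unfolding checks_def
      by (rule runs_WhileT[OF _ R(3) *(3)[unfolded checks_def e]]) (use Cons.prems True i W in auto)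
    then show ?thesis using * by blast
  next
    case False
    then have c: "chk n (x # g) h \<longleftrightarrow> (\<nexists>t. bad_at n h t)"
      by (auto simp: Let_def t_def[symmetric] y_def[symmetric])
    let ?\<sigma> = "(copies h 1 \<sigma>)(9 := tp gg (Suc i), 14 := reg (if chk n (x # g) h then 1 else 2))"
    have e: "\<sigma>(14 := reg (if chk n (x # g) h then 1 else 2)) = ?\<sigma>"
      using Cons.prems(2-5) by (auto simp: fun_eq_iff)
    have r: "runs round \<sigma> (W - 1) ?\<sigma>"
      using R(1,2) False unfolding e[symmetric] unfolding c by (cases "\<exists>t. bad_at n h t") auto
    have "runs checks \<sigma> ((length (x # g) + 1) * W + 1) ?\<sigma>"
      unfolding checks_def
      by (rule runs_WhileT[OF _ r runs_WhileF[OF _ order_refl]]) (use Cons.prems(6) T W in auto)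
    then show ?thesis using Cons.prems(1,7) by blast
  qed
qed

section \<open>Base 3 odometers\<close>

definition digits :: "nat \<Rightarrow> nat list \<Rightarrow> bool" where
  "digits b g \<longleftrightarrow> length g = b \<and> set g \<subseteq> {1, 2, 3}"

definition dval :: "nat list \<Rightarrow> nat" where
  "dval = foldl (\<lambda>v d. 3 * v + (d - 1)) 0"

lemma dval_simps [simp]: "dval [] = 0" "dval (g @ [x]) = 3 * dval g + (x - 1)"
  by (simp_all add: dval_def)

lemma dval_ones: "dval (g @ replicate k 1) = dval g * 3 ^ k"
proof (induction k)
  case (Suc k)
  then show ?case
    using dval_simps(2)[of "g @ replicate k 1" 1] by (simp add: replicate_append_same)
qed simp

lemma dval_threes: "Suc (dval (g @ replicate k 3)) = Suc (dval g) * 3 ^ k"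
proof (induction k)
  case (Suc k)
  have "g @ replicate (Suc k) 3 = (g @ replicate k 3) @ [3]" by (simp add: replicate_append_same)
  then have "Suc (dval (g @ replicate (Suc k) 3)) = 3 * Suc (dval (g @ replicate k 3))"
    by (simp only: dval_simps) simp
  then show ?case using Suc by simp
qed simp

lemma dval_less: "set g \<subseteq> {1, 2, 3} \<Longrightarrow> dval g < 3 ^ length g"
proof (induction g rule: rev_induct)
  case (snoc x g)
  then have "x - 1 \<le> 2" "dval g + 1 \<le> 3 ^ length g" by auto
  then have "3 * dval g + (x - 1) < 3 * 3 ^ length g" by linarith
  then show ?case by simp
qed simp

lemma dval_inj:
  "length g = length g' \<Longrightarrow> set g \<subseteq> {1, 2, 3} \<Longrightarrow> set g' \<subseteq> {1, 2, 3} \<Longrightarrow> dval g = dval g' \<Longrightarrow> g = g'"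
proof (induction g arbitrary: g' rule: rev_induct)
  case (snoc x g)
  obtain y g2 where g': "g' = g2 @ [y]"
    using snoc.prems(1) by (metis append_butlast_last_id length_0_conv length_append_singleton nat.simps(3))
  have "x \<in> {1, 2, 3}" "y \<in> {1, 2, 3}" "3 * dval g + (x - 1) = 3 * dval g2 + (y - 1)"
    using snoc.prems g' by auto
  then have "dval g = dval g2" "x = y" by auto presburger+
  then show ?case using snoc g' by auto
qed simp

text \<open>The trailing threes are the digits through which a carry runs.\<close>

lemma trailing_threes:
  fixes g :: "nat list"
  obtains k where "g = replicate k 3" | pre x k where "g = (pre @ [x]) @ replicate k 3" "x \<noteq> 3"
proof -
  have "(\<exists>k. g = replicate k 3) \<or> (\<exists>pre x k. g = (pre @ [x]) @ replicate k 3 \<and> x \<noteq> 3)"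
  proof (induction g rule: rev_induct)
    case (snoc y g)
    show ?case
    proof (cases "y = 3")
      case True
      then show ?thesis using snoc
        by (metis append.assoc replicate_Suc replicate_append_same)
    qed (metis append.right_neutral replicate_0)
  qed simp
  then show thesis using that by blast
qed

text \<open>If the carry reaches the end marker, all strings have been tried and the verdict becomes
  3; otherwise it is reset to 0, which asks for another attempt.\<close>

definition incr_guess :: cmd where
  "incr_guess = to_end 9 ;; mvL 9 ;; While (\<lambda>r. r 9 = 3) (Act (\<lambda>r. [(9, Some 1, MoveL)])) ;;
     Cond (\<lambda>r. r 9 = 7) (put 14 3)
       (Act (\<lambda>r. [(9, Some (if r 9 = 1 then 2 else 3), Stay), (14, Some 0, Stay)])) ;; rewind 9"

lemma runs_reset_threes:
  assumes "\<sigma> i = tp (pre @ replicate k 3) (length pre + k)" "pre = [] \<or> last pre \<noteq> 3" "2 * k + 1 \<le> T"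
  shows "runs (While (\<lambda>r. r i = 3) (Act (\<lambda>r. [(i, Some 1, MoveL)]))) \<sigma> T
    (\<sigma>(i := tp (pre @ replicate k 1) (length pre)))"
proof (rule runs_While_index[where f = "\<lambda>t. \<sigma>(i := tp (pre @ replicate (k - t) 3 @ replicate t 1) (length pre + k - t))"
      and N = k and C = 1])
  fix t assume t: "t < k"
  have e: "length pre + k - t = Suc (length pre + (k - Suc t))" "k - t = Suc (k - Suc t)" using t by auto
  show "rd (\<sigma>(i := tp (pre @ replicate (k - t) 3 @ replicate t 1) (length pre + k - t))) i = 3"
  proof -
    have "(pre @ replicate (k - t) 3 @ replicate t 1) ! (length pre + (k - Suc t)) = 3"
      unfolding nth_append_length_plus using t by (simp add: nth_append)
    then show ?thesis using t unfolding e(1) by simp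
  qed
  have "wrt 1 (tp (pre @ replicate (k - t) 3 @ replicate t 1) (length pre + k - t)) =
      tp (pre @ replicate (k - Suc t) 3 @ replicate (Suc t) 1) (length pre + k - t)"
    unfolding e(1)
  proof (subst wrt_tp_update)
    have "replicate (k - t) 3 = replicate (k - Suc t) 3 @ [3::nat]"
      unfolding e(2) by (simp add: replicate_append_same)
    then show "tp ((pre @ replicate (k - t) 3 @ replicate t 1)[length pre + (k - Suc t) := 1]) (Suc (length pre + (k - Suc t))) =
        tp (pre @ replicate (k - Suc t) 3 @ replicate (Suc t) 1) (Suc (length pre + (k - Suc t)))"
      by (simp add: list_update_append)
  qed (use t in simp)
  then show "runs (Act (\<lambda>r. [(i, Some 1, MoveL)]))
      (\<sigma>(i := tp (pre @ replicate (k - t) 3 @ replicate t 1) (length pre + k - t))) 1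
      (\<sigma>(i := tp (pre @ replicate (k - Suc t) 3 @ replicate (Suc t) 1) (length pre + k - Suc t)))"
    by (intro runs_Act) (simp_all add: fun_eq_iff)
next
  show "\<not> rd (\<sigma>(i := tp (pre @ replicate (k - k) 3 @ replicate k 1) (length pre + k - k))) i = 3"
  proof (cases pre rule: rev_cases)
    case (snoc ys y)
    then show ?thesis using assms(2) by (simp add: nth_append)
  qed simp
qed (use assms in auto)

lemma runs_incr_guess:
  assumes g: "digits b g" and \<sigma>: "\<sigma> 9 = tp g (Suc i)" "i \<le> b" and T: "6 * b + 20 \<le> T"
  shows "(dval g + 1 = 3 ^ b \<and> (\<exists>g'. digits b g' \<and> runs incr_guess \<sigma> T (\<sigma>(9 := tp g' 1, 14 := wrt 3 (\<sigma> 14))))) \<or>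
    (\<exists>g'. digits b g' \<and> dval g' = dval g + 1 \<and> runs incr_guess \<sigma> T (\<sigma>(9 := tp g' 1, 14 := wrt 0 (\<sigma> 14))))"
proof -
  have l: "length g = b" and s: "set g \<subseteq> {1, 2, 3}" using g by (auto simp: digits_def)
  have 1: "runs (to_end 9) \<sigma> (2 * b + 1) (\<sigma>(9 := tp g (Suc b)))"
  proof -
    have "0 \<notin> set g" using s by auto
    then show ?thesis using runs_to_end[of \<sigma> 9 g i "2 * b + 1"] \<sigma> l by auto
  qed
  have 2: "runs (mvL 9) (\<sigma>(9 := tp g (Suc b))) 1 (\<sigma>(9 := tp g b))"
    by (rule runs_mvL) auto
  consider (a) "g = replicate b 3" | (b) pre x k where "g = (pre @ [x]) @ replicate k 3" "x \<noteq> 3"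
    using trailing_threes[of g] l by (metis length_replicate)
  then show ?thesis
  proof cases
    case a
    have 3: "runs (While (\<lambda>r. r 9 = 3) (Act (\<lambda>r. [(9, Some 1, MoveL)]))) (\<sigma>(9 := tp g b)) (2 * b + 1)
       (\<sigma>(9 := tp (replicate b 1) 0))"
      using runs_reset_threes[of "\<sigma>(9 := tp g b)" 9 "[]" b "2 * b + 1"] a by simp
    have 4: "runs (put 14 3) (\<sigma>(9 := tp (replicate b 1) 0)) 1 (\<sigma>(9 := tp (replicate b 1) 0, 14 := wrt 3 (\<sigma> 14)))" (is "runs _ _ _ ?\<sigma>1")
      by (rule runs_put) auto
    have 5: "runs (Cond (\<lambda>r. r 9 = 7) (put 14 3)
       (Act (\<lambda>r. [(9, Some (if r 9 = 1 then 2 else 3), Stay), (14, Some 0, Stay)]))) (\<sigma>(9 := tp (replicate b 1) 0)) 2 ?\<sigma>1"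
      by (rule runs_CondT[OF _ 4]) auto
    have 6: "runs (rewind 9) ?\<sigma>1 3 (?\<sigma>1(9 := tp (replicate b 1) 1))"
      by (rule runs_rewind[where p = 0]) auto
    have 7: "?\<sigma>1(9 := tp (replicate b 1) 1) = \<sigma>(9 := tp (replicate b 1) 1, 14 := wrt 3 (\<sigma> 14))"
      by (auto simp: fun_eq_iff)
    have "runs incr_guess \<sigma> T (\<sigma>(9 := tp (replicate b 1) 1, 14 := wrt 3 (\<sigma> 14)))"
      unfolding incr_guess_def
      by (rule runs_Seq[OF 1 runs_Seq[OF 2 runs_Seq[OF 3 runs_Seq[OF 5 6[unfolded 7] order_refl] order_refl] order_refl]])
        (use T in simp)
    moreover have "digits b (replicate b 1)" by (auto simp: digits_def)
    moreover have "dval g + 1 = 3 ^ b" using dval_threes[of "[]" b] a by simp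
    ultimately show ?thesis by blast
  next
    case (b pre x k)
    let ?p = "length pre"
    let ?g' = "(pre @ [x + 1]) @ replicate k 1"
    have x: "x \<in> {1, 2}" using b s by auto
    have pk: "b = ?p + 1 + k" using b l by simp
    have g': "digits b ?g'" using g b x by (auto simp: digits_def)
    have 3: "runs (While (\<lambda>r. r 9 = 3) (Act (\<lambda>r. [(9, Some 1, MoveL)]))) (\<sigma>(9 := tp g b)) (2 * b + 1)
       (\<sigma>(9 := tp ((pre @ [x]) @ replicate k 1) (Suc ?p)))"
      using runs_reset_threes[of "\<sigma>(9 := tp g b)" 9 "pre @ [x]" k "2 * b + 1"] b pk by simp
    have 4: "runs (Act (\<lambda>r. [(9, Some (if r 9 = 1 then 2 else 3), Stay), (14, Some 0, Stay)]))
       (\<sigma>(9 := tp ((pre @ [x]) @ replicate k 1) (Suc ?p))) 1 (\<sigma>(9 := tp ?g' (Suc ?p), 14 := wrt 0 (\<sigma> 14)))" (is "runs _ _ _ ?\<sigma>1")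
      by (rule runs_Act) (use x in \<open>auto simp: nth_append wrt_tp_update list_update_append fun_eq_iff simp flip: numeral_2_eq_2\<close>)
    have 5: "runs (Cond (\<lambda>r. r 9 = 7) (put 14 3)
       (Act (\<lambda>r. [(9, Some (if r 9 = 1 then 2 else 3), Stay), (14, Some 0, Stay)])))
       (\<sigma>(9 := tp ((pre @ [x]) @ replicate k 1) (Suc ?p))) 2 ?\<sigma>1"
      by (rule runs_CondF[OF _ 4]) (use x in \<open>auto simp: nth_append\<close>)
    have 6: "runs (rewind 9) ?\<sigma>1 (2 * b + 3) (?\<sigma>1(9 := tp ?g' 1))"
      by (rule runs_rewind[where p = "Suc ?p"]) (use g' pk in \<open>auto simp: digits_def\<close>)
    have 7: "?\<sigma>1(9 := tp ?g' 1) = \<sigma>(9 := tp ?g' 1, 14 := wrt 0 (\<sigma> 14))"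
      by (auto simp: fun_eq_iff)
    have "runs incr_guess \<sigma> T (\<sigma>(9 := tp ?g' 1, 14 := wrt 0 (\<sigma> 14)))"
      unfolding incr_guess_def
      by (rule runs_Seq[OF 1 runs_Seq[OF 2 runs_Seq[OF 3 runs_Seq[OF 5 6[unfolded 7] order_refl] order_refl] order_refl]])
        (use T in simp)
    moreover have "dval ?g' = dval g + 1"
    proof -
      have "dval g + 1 = Suc (dval (pre @ [x])) * 3 ^ k" using dval_threes[of "pre @ [x]" k] b by simp
      also have "Suc (dval (pre @ [x])) = dval (pre @ [x + 1])" using x by auto
      finally show ?thesis by (simp only: dval_ones)
    qed
    ultimately show ?thesis using g' by blast
  qed
qed

section \<open>Loading a partial assignment\<close>

text \<open>The letters of an assignment are 1 (pair left alone), 2 (pair added) and 3 (pair deleted); a blank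
  means undecided.  Decided cells are frozen: they carry 5 or 6 instead of 1 or 2.\<close>

definition comb :: "nat \<Rightarrow> nat \<Rightarrow> nat" where
  "comb m p = (if m = 1 \<or> m = 2 then (if p = 0 then m else if p = 1 then m + 4 else if p = 2 then 6 else 5) else m)"

definition loaded :: "nat list \<Rightarrow> nat list \<Rightarrow> nat list" where
  "loaded M P = map (\<lambda>j. comb (M ! j) (if j < length P then P ! j else 0)) [0..<length M]"

definition matrix :: "nat \<Rightarrow> nat list \<Rightarrow> bool" where
  "matrix n M \<longleftrightarrow> shape n M \<and> set M \<subseteq> {1, 2, 3, 4}"

lemma shape_loaded:
  assumes "matrix n M"
  shows "shape n (loaded M P)"
proof -
  have M: "M ! j \<in> {1, 2, 3, 4}" if "j < length M" for j
    using assms that nth_mem unfolding matrix_def by blast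
  have 1: "loaded M P ! j \<in> {1, 2, 3, 4, 5, 6} \<and> (loaded M P ! j = 3 \<longleftrightarrow> M ! j = 3)" if "j < length M" for j
    using M[OF that] that by (auto simp: loaded_def comb_def)
  have l: "length (loaded M P) = length M" by (simp add: loaded_def)
  have "set (loaded M P) \<subseteq> {1, 2, 3, 4, 5, 6}"
    using 1 l by (metis in_set_conv_nth subsetI)
  then show ?thesis using assms 1 l unfolding shape_def matrix_def by simp
qed

text \<open>Each guess string starts from a freshly loaded matrix, because the flips of the
  preceding one have spoiled the copies. The head on tape 4 waits at the first blank, so that all
  later cells count as undecided.\<close>

definition load :: cmd where
  "load = While (\<lambda>r. r 3 \<noteq> 0) (Act (\<lambda>r. let h = comb (r 3) (r 4) in
     (3, None, MoveR) # (5, Some h, MoveR) # (6, Some h, MoveR) # (7, Some h, MoveR) #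
     (if r 4 = 0 then [] else [(4, None, MoveR)]))) ;; rewind 3 ;; rewind 4 ;; rewind3"

lemma runs_load:
  assumes M: "matrix n M" and P: "length P \<le> length M" "set P \<subseteq> {1, 2, 3}"
    and \<sigma>: "\<sigma> 3 = tp M 1" "\<sigma> 4 = tp P 1" "\<sigma> 5 = tp ho 1" "\<sigma> 6 = tp ho 1" "\<sigma> 7 = tp ho 1"
    and ho: "length ho \<le> length M" and T: "12 * length M + 40 \<le> T"
  shows "runs load \<sigma> T (copies (loaded M P) 1 \<sigma>)"
proof -
  let ?L = "length M"
  let ?h = "loaded M P"
  have h: "shape n ?h" "length ?h = ?L" using shape_loaded[OF M] by (simp_all add: loaded_def)
  note hD = shapeD[OF h(1)] and MD = shapeD[of n M]
  have sM: "shape n M" using M by (simp add: matrix_def)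
  define f where "f j = \<sigma>(3 := tp M (Suc j), 4 := tp P (Suc (min j (length P))),
      5 := tp (take j ?h @ drop j ho) (Suc j), 6 := tp (take j ?h @ drop j ho) (Suc j), 7 := tp (take j ?h @ drop j ho) (Suc j))" for j
  let ?A = "(\<lambda>r. let h = comb (r 3) (r 4) in
     (3, None, MoveR) # (5, Some h, MoveR) # (6, Some h, MoveR) # (7, Some h, MoveR) #
     (if r 4 = 0 then [] else [(4, None, MoveR)]))"
  have 1: "runs (While (\<lambda>r. r 3 \<noteq> 0) (Act ?A)) \<sigma> (2 * ?L + 1) (f ?L)"
  proof (rule runs_While_index[where f = f and N = ?L and C = 1])
    fix j assume j: "j < ?L"
    have r: "rd (f j) 3 = M ! j" "rd (f j) 4 = (if j < length P then P ! j else 0)"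
      using j by (auto simp: f_def min_def)
    have P0: "P ! j \<noteq> 0" if "j < length P" using subsetD[OF P(2) nth_mem[OF that]] by auto
    show "rd (f j) 3 \<noteq> 0" unfolding r using shapeD(6)[OF sM] j by simp
    have hj: "comb (M ! j) (if j < length P then P ! j else 0) = ?h ! j" using j by (simp add: loaded_def)
    have w: "wrt (?h ! j) (tp (take j ?h @ drop j ho) (Suc j)) = tp (take (Suc j) ?h @ drop (Suc j) ho) (Suc j)"
      by (rule wrt_tp_overwrite) (use j h hD(6) in auto)
    show "runs (Act ?A) (f j) 1 (f (Suc j))"
      by (rule runs_Act) (unfold r hj Let_def, cases "j < length P",
        use P0 j in \<open>simp_all add: f_def w fun_eq_iff\<close>)
  next
    show "\<sigma> = f 0" using \<sigma> by (auto simp: f_def fun_eq_iff)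
    show "\<not> rd (f ?L) 3 \<noteq> 0" by (simp add: f_def)
  qed simp_all
  have f: "f ?L = \<sigma>(3 := tp M (Suc ?L), 4 := tp P (Suc (length P)), 5 := tp ?h (Suc ?L), 6 := tp ?h (Suc ?L), 7 := tp ?h (Suc ?L))"
    using h ho P by (simp add: f_def min_def)
  have 2: "runs (rewind 3) (f ?L) (2 * ?L + 5) ((f ?L)(3 := tp M 1))"
    by (rule runs_rewind[where p = "Suc ?L"]) (use shapeD(2)[OF sM] in \<open>auto simp: f\<close>)
  have 3: "runs (rewind 4) ((f ?L)(3 := tp M 1)) (2 * ?L + 5) ((f ?L)(3 := tp M 1, 4 := tp P 1))"
    by (rule runs_rewind[where p = "Suc (length P)"]) (use P in \<open>auto simp: f\<close>)
  have 4: "runs rewind3 ((f ?L)(3 := tp M 1, 4 := tp P 1)) (6 * Suc ?L + 11)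
     ((f ?L)(3 := tp M 1, 4 := tp P 1, 5 := tp ?h 1, 6 := tp ?h 1, 7 := tp ?h 1))"
    by (rule runs_rewind3[where P = "Suc ?L" and ?p5.0 = "Suc ?L" and ?p6.0 = "Suc ?L" and ?p7.0 = "Suc ?L"])
      (use hD in \<open>auto simp: f\<close>)
  have 5: "(f ?L)(3 := tp M 1, 4 := tp P 1, 5 := tp ?h 1, 6 := tp ?h 1, 7 := tp ?h 1) =
     (copies ?h 1 \<sigma>)"
    using \<sigma> by (auto simp: f fun_eq_iff)
  show ?thesis
    unfolding load_def
    by (rule runs_Seq[OF 1 runs_Seq[OF 2 runs_Seq[OF 3 4[unfolded 5] order_refl] order_refl]]) (use T in simp)
qed

section \<open>Preparing the guess string\<close>

text \<open>Head 8 moves along the \<open>s\<close> ones and spends one of them for each operation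
  of the prefix; then every undecided pair takes one of the remaining ones and appends a letter to
  the guess string. An operation that is off the pairs or beyond the budget is rejected. Ones that
  are left over at the end mean that there are too few undecided pairs. If all is well, the guess
  string has the length of the remaining budget.\<close>

definition prep_acts :: "(nat \<Rightarrow> nat) \<Rightarrow> action list" where
  "prep_acts r = (3, None, MoveR) #
     (if r 4 = 0 then if (r 3 = 1 \<or> r 3 = 2) \<and> r 8 \<noteq> 0 then [(8, None, MoveR), (9, Some 1, MoveR)] else []
      else (4, None, MoveR) # (if r 4 = 1 then []
        else if r 3 \<notin> {1, 2} \<or> r 8 = 0 then [(14, Some 3, Stay)] else [(8, None, MoveR)]))"

definition prep :: cmd where
  "prep = put 14 0 ;; While (\<lambda>r. r 3 \<noteq> 0) (Act prep_acts) ;;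
     Cond (\<lambda>r. r 8 \<noteq> 0) (put 14 3) skip ;; rewind 3 ;; rewind 4 ;; rewind 8 ;; rewind 9"

text \<open>The components are the number of ones spent on tape 8, the length of the guess string
  and the verdict.\<close>

primrec prep_state :: "nat list \<Rightarrow> nat list \<Rightarrow> nat \<Rightarrow> nat \<Rightarrow> nat \<times> nat \<times> nat" where
  "prep_state M P s 0 = (0, 0, 0)"
| "prep_state M P s (Suc j) = (case prep_state M P s j of (a, g, f) \<Rightarrow>
     if j \<ge> length P then if M ! j \<in> {1, 2} \<and> a < s then (a + 1, g + 1, f) else (a, g, f)
     else if P ! j = 1 then (a, g, f)
     else if M ! j \<notin> {1, 2} \<or> a \<ge> s then (a, g, 3) else (a + 1, g, f))"

lemma prep_state_bounds:
  "prep_state M P s j = (a, g, f) \<Longrightarrow> a \<le> s \<and> g \<le> a \<and> (f = 0 \<or> f = 3)"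
  by (induction j arbitrary: a g f) (auto split: prod.splits if_splits)

lemma runs_prep:
  assumes M: "matrix n M" and P: "length P \<le> length M" "set P \<subseteq> {1, 2, 3}"
    and \<sigma>: "\<sigma> 3 = tp M 1" "\<sigma> 4 = tp P 1" "\<sigma> 8 = tp (replicate s 1) 1" "\<sigma> 9 = tp [] 1" "\<sigma> 14 = reg v"
    and st: "prep_state M P s (length M) = (a, g, f)"
    and T: "6 * length M + 4 * s + 60 \<le> T"
  shows "runs prep \<sigma> T (\<sigma>(9 := tp (replicate g 1) 1, 14 := reg (if a < s then 3 else f)))"
proof -
  let ?L = "length M"
  have sM: "shape n M" using M by (simp add: matrix_def)
  define st where "st = prep_state M P s"
  define F where "F j = \<sigma>(3 := tp M (Suc j), 4 := tp P (Suc (min j (length P))),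
      8 := tp (replicate s 1) (Suc (fst (st j))), 9 := tp (replicate (fst (snd (st j))) 1) (Suc (fst (snd (st j)))),
      14 := reg (snd (snd (st j))))" for j
  have 0: "runs (put 14 0) \<sigma> 1 (F 0)"
    by (rule runs_put) (use \<sigma> in \<open>auto simp: F_def st_def fun_eq_iff\<close>)
  have 1: "runs (While (\<lambda>r. r 3 \<noteq> 0) (Act prep_acts)) (F 0) (2 * ?L + 1) (F ?L)"
  proof (rule runs_While_index[where f = F and N = ?L and C = 1])
    fix j assume j: "j < ?L"
    obtain a' g' f' where s: "st j = (a', g', f')" by (cases "st j")
    then have a': "a' \<le> s" using prep_state_bounds[of M P s j] by (simp add: st_def)
    have r: "rd (F j) 3 = M ! j" "rd (F j) 4 = (if j < length P then P ! j else 0)" "rd (F j) 8 = (if a' < s then 1 else 0)"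
      using j by (auto simp: F_def min_def s)
    have P0: "P ! j \<noteq> 0" if "j < length P" using subsetD[OF P(2) nth_mem[OF that]] by auto
    show "rd (F j) 3 \<noteq> 0" unfolding r using shapeD(6)[OF sM] j by simp
    have s': "st (Suc j) = (if j \<ge> length P then if M ! j \<in> {1, 2} \<and> a' < s then (a' + 1, g' + 1, f') else (a', g', f')
     else if P ! j = 1 then (a', g', f')
     else if M ! j \<notin> {1, 2} \<or> a' \<ge> s then (a', g', 3) else (a' + 1, g', f'))"
      using s by (simp add: st_def)
    show "runs (Act prep_acts) (F j) 1 (F (Suc j))"
    proof (rule runs_Act)
      show "F (Suc j) = act_store (prep_acts (rd (F j))) (F j)"
        unfolding prep_acts_def r using P0 a'
        by (cases "j < length P")
          (auto simp: F_def s s' min_def fun_eq_iff wrt_tp_append replicate_append_same)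
    qed simp
  qed (simp_all add: F_def)
  have st': "st ?L = (a, g, f)" using st by (simp add: st_def)
  have b: "a \<le> s" "g \<le> a" using prep_state_bounds[OF st] by auto
  have F: "F ?L = \<sigma>(3 := tp M (Suc ?L), 4 := tp P (Suc (length P)), 8 := tp (replicate s 1) (Suc a),
     9 := tp (replicate g 1) (Suc g), 14 := reg f)"
    using P by (simp add: F_def st' min_def)
  let ?f = "if a < s then 3 else f"
  have 2: "runs (Cond (\<lambda>r. r 8 \<noteq> 0) (put 14 3) skip) (F ?L) 2 ((F ?L)(14 := reg ?f))"
  proof (cases "a < s")
    case True
    have "runs (put 14 3) (F ?L) 1 ((F ?L)(14 := reg ?f))" by (rule runs_put) (auto simp: F True)
    then show ?thesis by (rule runs_CondT[rotated]) (auto simp: F True)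
  next
    case False
    have e: "(F ?L)(14 := reg ?f) = F ?L" using False by (auto simp: F)
    show ?thesis unfolding e by (rule runs_CondF[OF _ runs_skip[OF order_refl]]) (use False in \<open>auto simp: F\<close>)
  qed
  let ?\<sigma>1 = "(F ?L)(14 := reg ?f)"
  have 3: "runs (rewind 3) ?\<sigma>1 (2 * ?L + 5) (?\<sigma>1(3 := tp M 1))"
    by (rule runs_rewind[where p = "Suc ?L"]) (use shapeD(2)[OF sM] in \<open>auto simp: F\<close>)
  have 4: "runs (rewind 4) (?\<sigma>1(3 := tp M 1)) (2 * ?L + 5) (?\<sigma>1(3 := tp M 1, 4 := tp P 1))"
    by (rule runs_rewind[where p = "Suc (length P)"]) (use P in \<open>auto simp: F\<close>)
  have 5: "runs (rewind 8) (?\<sigma>1(3 := tp M 1, 4 := tp P 1)) (2 * s + 5) (?\<sigma>1(3 := tp M 1, 4 := tp P 1, 8 := tp (replicate s 1) 1))"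
    by (rule runs_rewind[where p = "Suc a"]) (use b in \<open>auto simp: F\<close>)
  have 6: "runs (rewind 9) (?\<sigma>1(3 := tp M 1, 4 := tp P 1, 8 := tp (replicate s 1) 1)) (2 * s + 5)
     (?\<sigma>1(3 := tp M 1, 4 := tp P 1, 8 := tp (replicate s 1) 1, 9 := tp (replicate g 1) 1))"
    by (rule runs_rewind[where p = "Suc g"]) (use b in \<open>auto simp: F\<close>)
  have 7: "?\<sigma>1(3 := tp M 1, 4 := tp P 1, 8 := tp (replicate s 1) 1, 9 := tp (replicate g 1) 1) =
     \<sigma>(9 := tp (replicate g 1) 1, 14 := reg ?f)"
    using \<sigma> by (auto simp: F fun_eq_iff)
  show ?thesis
    unfolding prep_def
    by (rule runs_Seq[OF 0 runs_Seq[OF 1 runs_Seq[OF 2 runs_Seq[OF 3 runs_Seq[OF 4 runs_Seq[OF 5 6[unfolded 7] order_refl]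
      order_refl] order_refl] order_refl] order_refl]]) (use T in simp)
qed

section \<open>The feasibility test\<close>

definition weight :: "nat list \<Rightarrow> nat" where
  "weight P = card {j. j < length P \<and> P ! j \<noteq> 1}"

text \<open>Cells that do not stand for a pair, namely separators and cells on or below the
  diagonal, are forced to carry the letter 1.\<close>

definition forced :: "nat list \<Rightarrow> nat list \<Rightarrow> bool" where
  "forced M P \<longleftrightarrow> (\<forall>j<length P. P ! j \<noteq> 1 \<longrightarrow> M ! j \<in> {1, 2})"

definition free_cells :: "nat list \<Rightarrow> nat \<Rightarrow> nat set" where
  "free_cells M i = {j. i \<le> j \<and> j < length M \<and> M ! j \<in> {1, 2}}"

definition feasible :: "nat \<Rightarrow> nat list \<Rightarrow> nat list \<Rightarrow> nat \<Rightarrow> bool" where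
  "feasible n M P s \<longleftrightarrow> forced M P \<and> weight P \<le> s \<and> s \<le> weight P + card (free_cells M (length P)) \<and>
     (\<exists>g. digits (s - weight P) g \<and> chk n g (loaded M P))"

lemma weight_take_Suc:
  assumes "j < length P"
  shows "weight (take (Suc j) P) = weight (take j P) + (if P ! j = 1 then 0 else 1)"
proof -
  have "{i. i < length (take (Suc j) P) \<and> take (Suc j) P ! i \<noteq> 1} =
     (if P ! j = 1 then {} else {j}) \<union> {i. i < length (take j P) \<and> take j P ! i \<noteq> 1}"
    using assms by (auto simp: less_Suc_eq)
  then show ?thesis by (simp add: weight_def)
qed

lemma forced_take_Suc:
  assumes "j < length P"
  shows "forced M (take (Suc j) P) \<longleftrightarrow> forced M (take j P) \<and> (P ! j \<noteq> 1 \<longrightarrow> M ! j \<in> {1, 2})"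
  using assms by (auto simp: forced_def less_Suc_eq)

lemma prep_state_decided:
  assumes "j \<le> length P" "prep_state M P s j = (a, g, f)"
  shows "g = 0 \<and> (f = 0 \<longleftrightarrow> forced M (take j P) \<and> weight (take j P) \<le> s) \<and> (f = 0 \<longrightarrow> a = weight (take j P))"
  using assms
proof (induction j arbitrary: a g f)
  case 0
  then show ?case by (simp add: forced_def weight_def)
next
  case (Suc j)
  obtain a' g' f' where s: "prep_state M P s j = (a', g', f')" by (cases "prep_state M P s j")
  note IH = Suc.IH[OF _ s]
  show ?case
    using Suc.prems IH s weight_take_Suc[of j P] forced_take_Suc[of j P M]
    by (auto split: if_splits)
qed

text \<open>The minimum reflects that head 8 stops at the end of its \<open>s\<close> ones. Thus
  \<open>a = s\<close> holds at the end iff the undecided pairs can absorb the whole remaining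
  budget.\<close>

lemma prep_state_free:
  assumes "length P \<le> j" "prep_state M P s (length P) = (a0, 0, f0)" "prep_state M P s j = (a, g, f)" "j \<le> length M"
  shows "f = f0 \<and> a = min s (a0 + card {i. length P \<le> i \<and> i < j \<and> M ! i \<in> {1, 2}}) \<and> g = a - a0"
  using assms
proof (induction j arbitrary: a g f rule: dec_induct)
  case base
  have e: "{i. length P \<le> i \<and> i < length P \<and> M ! i \<in> {1, 2}} = {}" by auto
  show ?case unfolding e using base prep_state_bounds[of M P s "length P"] by auto
next
  case (step j)
  obtain a' g' f' where s: "prep_state M P s j = (a', g', f')" by (cases "prep_state M P s j")
  have IH: "f' = f0 \<and> a' = min s (a0 + card {i. length P \<le> i \<and> i < j \<and> M ! i \<in> {1, 2}}) \<and> g' = a' - a0"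
    by (rule step.IH) (use step.prems s in auto)
  have "a0 \<le> s" using prep_state_bounds[OF step.prems(1)] by simp
  moreover have "{i. length P \<le> i \<and> i < Suc j \<and> M ! i \<in> {1, 2}} =
     (if M ! j \<in> {1, 2} then {j} else {}) \<union> {i. length P \<le> i \<and> i < j \<and> M ! i \<in> {1, 2}}"
    using step.hyps by (auto simp: less_Suc_eq)
  then have "card {i. length P \<le> i \<and> i < Suc j \<and> M ! i \<in> {1, 2}} =
     (if M ! j \<in> {1, 2} then 1 else 0) + card {i. length P \<le> i \<and> i < j \<and> M ! i \<in> {1, 2}}"
    by simp
  ultimately show ?case
    using step.prems(2) s IH step.hyps by (auto split: if_splits)
qed

lemma prep_state_result:
  assumes P: "length P \<le> length M" and st: "prep_state M P s (length M) = (a, g, f)"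
  shows "(if a < s then 3 else f) = (if forced M P \<and> weight P \<le> s \<and> s \<le> weight P + card (free_cells M (length P)) then 0 else 3)"
    "forced M P \<and> weight P \<le> s \<and> s \<le> weight P + card (free_cells M (length P)) \<Longrightarrow> g = s - weight P"
    "g \<le> s"
proof -
  obtain a0 g0 f0 where s0: "prep_state M P s (length P) = (a0, g0, f0)" by (cases "prep_state M P s (length P)")
  have d: "g0 = 0" "f0 = 0 \<longleftrightarrow> forced M P \<and> weight P \<le> s" "f0 = 0 \<longrightarrow> a0 = weight P"
    using prep_state_decided[OF order_refl s0] by auto
  have b: "f0 = 0 \<or> f0 = 3" using prep_state_bounds[OF s0] by simp
  have "f = f0 \<and> a = min s (a0 + card (free_cells M (length P))) \<and> g = a - a0"
    using prep_state_free[OF P s0[unfolded d(1)] st] by (simp add: free_cells_def)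
  then show "(if a < s then 3 else f) = (if forced M P \<and> weight P \<le> s \<and> s \<le> weight P + card (free_cells M (length P)) then 0 else 3)"
    "forced M P \<and> weight P \<le> s \<and> s \<le> weight P + card (free_cells M (length P)) \<Longrightarrow> g = s - weight P"
    using d b by auto
  show "g \<le> s" using prep_state_bounds[OF st] by simp
qed

definition feas_loop :: cmd where
  "feas_loop = While (\<lambda>r. r 14 = 0) (load ;; checks ;; Cond (\<lambda>r. r 14 = 2) incr_guess skip)"

definition feas :: cmd where
  "feas = prep ;; feas_loop ;; clear 9"

definition check_time :: "nat \<Rightarrow> nat" where
  "check_time l = l * l * (4 * l + 16) + 20 * l + 61"

definition guess_time :: "nat \<Rightarrow> nat \<Rightarrow> nat" where
  "guess_time l b = (b + 1) * check_time l + 12 * l + 6 * b + 80"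

text \<open>Induction on the number of guess strings from \<open>g\<close> on. Their values in base
  3 enumerate all strings of length \<open>b\<close>, so starting from value 0 decides whether any
  string succeeds.\<close>

lemma runs_feas_loop:
  assumes M: "matrix n M" and P: "length P \<le> length M" "set P \<subseteq> {1, 2, 3}" and g: "digits b g"
    and \<sigma>: "\<sigma> 3 = tp M 1" "\<sigma> 4 = tp P 1" "\<sigma> 5 = tp ho 1" "\<sigma> 6 = tp ho 1" "\<sigma> 7 = tp ho 1"
      "\<sigma> 9 = tp g 1" "\<sigma> 14 = reg 0" and ho: "length ho \<le> length M"
  shows "\<exists>ho' g' i'. length ho' \<le> length M \<and> digits b g' \<and> i' \<le> b \<and>
     runs feas_loop \<sigma> ((3 ^ b - dval g) * guess_time (length M) b + 1)
      ((copies ho' 1 \<sigma>)(9 := tp g' (Suc i'),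
        14 := reg (if \<exists>g''. digits b g'' \<and> dval g \<le> dval g'' \<and> chk n g'' (loaded M P) then 1 else 3)))"
  using g \<sigma> ho
proof (induction "3 ^ b - dval g" arbitrary: g \<sigma> ho rule: less_induct)
  case less
  let ?h = "loaded M P" and ?L = "length M" and ?C = "guess_time (length M) b"
  have lg: "length g = b" and sg: "set g \<subseteq> {1, 2, 3}" using less.prems(1) by (auto simp: digits_def)
  have gl: "dval g < 3 ^ b" using dval_less[OF sg] lg by simp
  have "1 \<le> 3 ^ b - dval g" using gl by (simp add: Suc_le_eq)
  then have gC: "?C \<le> (3 ^ b - dval g) * ?C" using mult_le_mono1[of 1 _ ?C] by simp
  have lh: "length ?h = ?L" by (simp add: loaded_def)
  let ?\<sigma>1 = "(copies ?h 1 \<sigma>)"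
  have 1: "runs load \<sigma> (12 * ?L + 40) ?\<sigma>1"
    by (rule runs_load[OF M P]) (use less.prems in auto)
  have "\<exists>h' i'. shape n h' \<and> i' \<le> length g \<and>
    runs checks ?\<sigma>1 ((length g + 1) * check_time ?L + 1) ((copies h' 1 ?\<sigma>1)(9 := tp g (Suc i'), 14 := reg (if chk n g ?h then 1 else 2)))"
    by (rule runs_checks[where i = 0]) (use less.prems shape_loaded[OF M] sg lh in \<open>auto simp: check_time_def\<close>)
  then obtain h' i' where h': "shape n h'" "i' \<le> b" and
    2: "runs checks ?\<sigma>1 ((b + 1) * check_time ?L + 1) ((copies h' 1 ?\<sigma>1)(9 := tp g (Suc i'), 14 := reg (if chk n g ?h then 1 else 2)))" (is "runs _ _ _ ?\<sigma>2")
    using lg by blast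
  have l': "length h' = ?L" using shapeD(1)[OF h'(1)] M by (simp add: matrix_def shape_def)
  show ?case
  proof (cases "chk n g ?h")
    case True
    have 3: "runs (Cond (\<lambda>r. r 14 = 2) incr_guess skip) ?\<sigma>2 2 ?\<sigma>2"
      by (rule runs_CondF[OF _ runs_skip[OF order_refl]]) (auto simp: True)
    let ?T = "12 * ?L + 40 + ((b + 1) * check_time ?L + 1 + 2 + 1) + 1"
    have 4: "runs feas_loop \<sigma> (?T + 1 + 1) ?\<sigma>2"
      unfolding feas_loop_def
      by (rule runs_WhileT[OF _ runs_Seq[OF 1 runs_Seq[OF 2 3 order_refl] order_refl] runs_WhileF[OF _ order_refl]])
        (use less.prems True in auto)
    have "?T + 1 + 1 \<le> ?C" by (simp add: guess_time_def)
    also note gC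
    finally have 5: "?T + 1 + 1 \<le> (3 ^ b - dval g) * ?C + 1" by simp
    have e: "?\<sigma>2 = (copies h' 1 \<sigma>)(9 := tp g (Suc i'),
        14 := reg (if \<exists>g''. digits b g'' \<and> dval g \<le> dval g'' \<and> chk n g'' ?h then 1 else 3))"
      using True less.prems(1) by (auto simp: fun_eq_iff)
    show ?thesis
      using runs_mono[OF 4 5] unfolding e using h' l' less.prems(1)
      by (intro exI[of _ h'] exI[of _ g] exI[of _ i']) auto
  next
    case False
    have \<sigma>2: "?\<sigma>2 9 = tp g (Suc i')" "i' \<le> b" using h' by auto
    note inc = runs_incr_guess[of b g ?\<sigma>2 i' "6 * b + 20", OF less.prems(1) \<sigma>2 order_refl]
    let ?T = "12 * ?L + 40 + ((b + 1) * check_time ?L + 1 + (6 * b + 20 + 1) + 1) + 1"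
    have TC: "?T + 1 + 1 \<le> ?C" by (simp add: guess_time_def)
    from inc show ?thesis
    proof (elim disjE conjE exE)
      fix g' assume full: "dval g + 1 = 3 ^ b" and g': "digits b g'"
        and 3: "runs incr_guess ?\<sigma>2 (6 * b + 20) (?\<sigma>2(9 := tp g' 1, 14 := wrt 3 (?\<sigma>2 14)))" (is "runs _ _ _ ?\<sigma>3")
      have 4: "runs (Cond (\<lambda>r. r 14 = 2) incr_guess skip) ?\<sigma>2 (6 * b + 20 + 1) ?\<sigma>3"
        by (rule runs_CondT[OF _ 3]) (auto simp: False)
      have 5: "runs feas_loop \<sigma> (?T + 1 + 1) ?\<sigma>3"
        unfolding feas_loop_def
        by (rule runs_WhileT[OF _ runs_Seq[OF 1 runs_Seq[OF 2 4 order_refl] order_refl] runs_WhileF[OF _ order_refl]])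
          (use less.prems in auto)
      \<comment> \<open>\<open>g\<close> is the last string, so no other one has a value at least as
        large.\<close>
      have no: "\<not> (\<exists>g''. digits b g'' \<and> dval g \<le> dval g'' \<and> chk n g'' ?h)"
      proof
        assume "\<exists>g''. digits b g'' \<and> dval g \<le> dval g'' \<and> chk n g'' ?h"
        then obtain g'' where g'': "digits b g''" "dval g \<le> dval g''" "chk n g'' ?h" by blast
        then have "dval g'' = dval g" using dval_less[of g''] full by (auto simp: digits_def)
        then have "g'' = g" using dval_inj[of g'' g] g''(1) lg sg by (auto simp: digits_def)
        then show False using g''(3) False by simp
      qed
      have e: "?\<sigma>3 = (copies h' 1 \<sigma>)(9 := tp g' (Suc 0),
        14 := reg (if \<exists>g''. digits b g'' \<and> dval g \<le> dval g'' \<and> chk n g'' ?h then 1 else 3))"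
        using no by (auto simp: fun_eq_iff)
      have 6: "?T + 1 + 1 \<le> (3 ^ b - dval g) * ?C + 1" using TC gC by linarith
      show ?thesis
        using runs_mono[OF 5 6] unfolding e using l' g'
        by (intro exI[of _ h'] exI[of _ g'] exI[of _ 0]) auto
    next
      fix g' assume g': "digits b g'" "dval g' = dval g + 1"
        and 3: "runs incr_guess ?\<sigma>2 (6 * b + 20) (?\<sigma>2(9 := tp g' 1, 14 := wrt 0 (?\<sigma>2 14)))" (is "runs _ _ _ ?\<sigma>3")
      have 4: "runs (Cond (\<lambda>r. r 14 = 2) incr_guess skip) ?\<sigma>2 (6 * b + 20 + 1) ?\<sigma>3"
        by (rule runs_CondT[OF _ 3]) (auto simp: False)
      have "\<exists>ho' g'' i'. length ho' \<le> length M \<and> digits b g'' \<and> i' \<le> b \<and>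
        runs feas_loop ?\<sigma>3 ((3 ^ b - dval g') * ?C + 1)
        ((copies ho' 1 ?\<sigma>3)(9 := tp g'' (Suc i'),
        14 := reg (if \<exists>g''. digits b g'' \<and> dval g' \<le> dval g'' \<and> chk n g'' (loaded M P) then 1 else 3)))"
        by (rule less.hyps[where ho = h']) (use g' gl less.prems l' in auto)
      then obtain ho' g2 i2 where r: "length ho' \<le> length M" "digits b g2" "i2 \<le> b"
        and 5: "runs feas_loop ?\<sigma>3 ((3 ^ b - dval g') * ?C + 1)
        ((copies ho' 1 ?\<sigma>3)(9 := tp g2 (Suc i2),
        14 := reg (if \<exists>g''. digits b g'' \<and> dval g' \<le> dval g'' \<and> chk n g'' (loaded M P) then 1 else 3)))"
        by blast
      \<comment> \<open>As \<open>g\<close> itself has failed, searching from its successor loses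
        nothing.\<close>
      have eq: "(\<exists>g''. digits b g'' \<and> dval g' \<le> dval g'' \<and> chk n g'' ?h) \<longleftrightarrow>
          (\<exists>g''. digits b g'' \<and> dval g \<le> dval g'' \<and> chk n g'' ?h)"
      proof -
        have "dval g'' \<noteq> dval g" if "digits b g''" "chk n g'' ?h" for g''
          using dval_inj[of g'' g] that lg sg False by (auto simp: digits_def)
        then show ?thesis using g'(2) by (metis Suc_eq_plus1 Suc_leI le_SucI le_trans lessI nat_less_le order_refl)
      qed
      have e: "(copies ho' 1 ?\<sigma>3)(9 := tp g2 (Suc i2),
        14 := reg (if \<exists>g''. digits b g'' \<and> dval g' \<le> dval g'' \<and> chk n g'' (loaded M P) then 1 else 3)) =
        (copies ho' 1 \<sigma>)(9 := tp g2 (Suc i2),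
        14 := reg (if \<exists>g''. digits b g'' \<and> dval g \<le> dval g'' \<and> chk n g'' (loaded M P) then 1 else 3))"
        unfolding eq by (auto simp: fun_eq_iff)
      have "3 ^ b - dval g = Suc (3 ^ b - dval g')" using g' gl by simp
      then have 6: "?T + ((3 ^ b - dval g') * ?C + 1) + 1 \<le> (3 ^ b - dval g) * ?C + 1"
        using TC by simp
      have "runs feas_loop \<sigma> ((3 ^ b - dval g) * ?C + 1) ((copies ho' 1 ?\<sigma>3)(9 := tp g2 (Suc i2),
        14 := reg (if \<exists>g''. digits b g'' \<and> dval g' \<le> dval g'' \<and> chk n g'' (loaded M P) then 1 else 3)))"
        unfolding feas_loop_def
        by (rule runs_WhileT[OF _ runs_Seq[OF 1 runs_Seq[OF 2 4 order_refl] order_refl] 5[unfolded feas_loop_def] 6])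
          (use less.prems in auto)
      then show ?thesis unfolding e using r by blast
    qed
  qed
qed

definition feas_time :: "nat \<Rightarrow> nat \<Rightarrow> nat" where
  "feas_time l s = 3 ^ s * guess_time l s + 6 * l + 8 * s + 80"

lemma guess_time_mono: "b \<le> s \<Longrightarrow> guess_time l b \<le> guess_time l s"
  unfolding guess_time_def by (intro add_mono mult_le_mono) auto

lemma runs_feas:
  assumes M: "matrix n M" and P: "length P \<le> length M" "set P \<subseteq> {1, 2, 3}"
    and \<sigma>: "\<sigma> 3 = tp M 1" "\<sigma> 4 = tp P 1" "\<sigma> 5 = tp ho 1" "\<sigma> 6 = tp ho 1" "\<sigma> 7 = tp ho 1"
      "\<sigma> 8 = tp (replicate s 1) 1" "\<sigma> 9 = tp [] 1" "\<sigma> 14 = reg v" and ho: "length ho \<le> length M"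
  shows "\<exists>ho'. length ho' \<le> length M \<and>
     runs feas \<sigma> (feas_time (length M) s)
      ((copies ho' 1 \<sigma>)(14 := reg (if feasible n M P s then 1 else 3)))"
proof -
  obtain a g f where st: "prep_state M P s (length M) = (a, g, f)" by (cases "prep_state M P s (length M)")
  note res = prep_state_result[OF P(1) st]
  let ?ok = "forced M P \<and> weight P \<le> s \<and> s \<le> weight P + card (free_cells M (length P))"
  let ?\<sigma>1 = "\<sigma>(9 := tp (replicate g 1) 1, 14 := reg (if ?ok then 0 else 3))"
  have 1: "runs prep \<sigma> (6 * length M + 4 * s + 60) ?\<sigma>1"
    using runs_prep[OF M P, of \<sigma> s v a g f] \<sigma> st unfolding res(1) by simp
  have dg: "digits g (replicate g 1)" by (auto simp: digits_def)
  have d0: "dval (replicate g 1) = 0" using dval_ones[of "[]" g] by simp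
  have tb: "(3 ^ g - dval (replicate g 1)) * guess_time (length M) g + 1 \<le> 3 ^ s * guess_time (length M) s + 1"
    using res(3) guess_time_mono[OF res(3)] d0 by (auto intro!: mult_le_mono power_increasing)
  have "\<exists>ho' g' i'. length ho' \<le> length M \<and> digits g g' \<and> i' \<le> g \<and>
     runs feas_loop ?\<sigma>1 (3 ^ s * guess_time (length M) s + 1)
      ((copies ho' 1 \<sigma>)(9 := tp g' (Suc i'),
        14 := reg (if feasible n M P s then 1 else 3)))"
  proof (cases ?ok)
    case True
    have "\<exists>ho' g' i'. length ho' \<le> length M \<and> digits g g' \<and> i' \<le> g \<and>
     runs feas_loop ?\<sigma>1 ((3 ^ g - dval (replicate g 1)) * guess_time (length M) g + 1)
      ((copies ho' 1 ?\<sigma>1)(9 := tp g' (Suc i'),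
        14 := reg (if \<exists>g''. digits g g'' \<and> dval (replicate g 1) \<le> dval g'' \<and> chk n g'' (loaded M P) then 1 else 3)))"
      by (rule runs_feas_loop[OF M P dg, of _ ho]) (use \<sigma> ho True in auto)
    then obtain ho' g' i' where r: "length ho' \<le> length M" "digits g g'" "i' \<le> g" and
      2: "runs feas_loop ?\<sigma>1 ((3 ^ g - dval (replicate g 1)) * guess_time (length M) g + 1)
      ((copies ho' 1 ?\<sigma>1)(9 := tp g' (Suc i'),
        14 := reg (if \<exists>g''. digits g g'' \<and> dval (replicate g 1) \<le> dval g'' \<and> chk n g'' (loaded M P) then 1 else 3)))"
      by blast
    have "(\<exists>g''. digits g g'' \<and> dval (replicate g 1) \<le> dval g'' \<and> chk n g'' (loaded M P)) \<longleftrightarrow> feasible n M P s"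
      using True res(2)[OF True] d0 by (auto simp: feasible_def)
    then have e: "(copies ho' 1 ?\<sigma>1)(9 := tp g' (Suc i'),
        14 := reg (if \<exists>g''. digits g g'' \<and> dval (replicate g 1) \<le> dval g'' \<and> chk n g'' (loaded M P) then 1 else 3)) =
      (copies ho' 1 \<sigma>)(9 := tp g' (Suc i'),
        14 := reg (if feasible n M P s then 1 else 3))"
      by (auto simp: fun_eq_iff)
    show ?thesis using runs_mono[OF 2 tb] r unfolding e by blast
  next
    case False
    have nf: "\<not> feasible n M P s" using False by (auto simp: feasible_def)
    have "runs feas_loop ?\<sigma>1 (3 ^ s * guess_time (length M) s + 1) ?\<sigma>1"
      unfolding feas_loop_def by (rule runs_WhileF) (use False in auto)
    moreover have "?\<sigma>1 = (copies ho 1 \<sigma>)(9 := tp (replicate g 1) (Suc 0),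
        14 := reg (if feasible n M P s then 1 else 3))"
      using False nf \<sigma> by (auto simp: fun_eq_iff)
    ultimately show ?thesis using ho dg by (metis le0)
  qed
  then obtain ho' g' i' where r: "length ho' \<le> length M" "digits g g'" "i' \<le> g" and
    2: "runs feas_loop ?\<sigma>1 (3 ^ s * guess_time (length M) s + 1)
      ((copies ho' 1 \<sigma>)(9 := tp g' (Suc i'),
        14 := reg (if feasible n M P s then 1 else 3)))" (is "runs _ _ _ ?\<sigma>2") by blast
  have 3: "runs (clear 9) ?\<sigma>2 (4 * s + 7) (?\<sigma>2(9 := tp [] 1))"
    by (rule runs_clear[where p = i' and h = g']) (use r res(3) in \<open>auto simp: digits_def\<close>)
  have e: "?\<sigma>2(9 := tp [] 1) = (copies ho' 1 \<sigma>)(14 := reg (if feasible n M P s then 1 else 3))"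
    using \<sigma> by (auto simp: fun_eq_iff)
  have "runs feas \<sigma> (feas_time (length M) s) (?\<sigma>2(9 := tp [] 1))"
    unfolding feas_def by (rule runs_Seq[OF 1 runs_Seq[OF 2 3 order_refl]]) (simp add: feas_time_def)
  then show ?thesis unfolding e using r by blast
qed

section \<open>Feasibility means extendability\<close>

definition unfreeze :: "nat \<Rightarrow> nat" where
  "unfreeze x = (if x = 5 then 1 else if x = 6 then 2 else x)"

lemma bad3_unfreeze: "bad3 (unfreeze x) (unfreeze y) (unfreeze z) = bad3 x y z"
  unfolding bad3_def unfreeze_def by auto

lemma bad_at_unfreeze:
  assumes "length h = n * (n + 1)" "length h' = n * (n + 1)" "\<And>j. j < n * (n + 1) \<Longrightarrow> unfreeze (h ! j) = unfreeze (h' ! j)"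
  shows "bad_at n h t = bad_at n h' t"
proof (cases "t < n * n * (n + 1)")
  case True
  have "bad3 (h ! cell1 n t) (h ! cell2 n t) (h ! cell3 n t) = bad3 (h' ! cell1 n t) (h' ! cell2 n t) (h' ! cell3 n t)"
    using assms(3)[OF cell_lt(1)[OF True]] assms(3)[OF cell_lt(2)[OF True]] assms(3)[OF cell_lt(3)[OF True]]
    by (metis bad3_unfreeze)
  then show ?thesis by (simp add: bad_at_def)
qed (simp add: bad_at_def)

text \<open>\<open>h'\<close> is a target without bad triples that differs from \<open>h\<close>
  only in unfrozen pairs. The first bad triple of \<open>h\<close> is not bad in \<open>h'\<close>,
  so it contains a cell where the two differ. Guessing this cell and flipping it brings
  \<open>h\<close> one step closer to the target.\<close>

lemma chk_complete:
  assumes "length h = n * (n + 1)" "length h' = n * (n + 1)" "\<nexists>t. bad_at n h' t"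
    and "\<And>j. j < n * (n + 1) \<Longrightarrow> unfreeze (h ! j) \<noteq> unfreeze (h' ! j) \<Longrightarrow> h ! j \<in> {1, 2} \<and> unfreeze (h' ! j) = 3 - h ! j"
    and "card {j. j < n * (n + 1) \<and> unfreeze (h ! j) \<noteq> unfreeze (h' ! j)} \<le> b"
  shows "\<exists>g. digits b g \<and> chk n g h"
  using assms(1,4,5)
proof (induction b arbitrary: h)
  case 0
  then have "unfreeze (h ! j) = unfreeze (h' ! j)" if "j < n * (n + 1)" for j using that by auto
  then have "bad_at n h t = bad_at n h' t" for t using bad_at_unfreeze 0(1) assms(2) by blast
  then show ?case using assms(3) by (intro exI[of _ "[]"]) (simp add: digits_def)
next
  case (Suc b)
  let ?D = "\<lambda>h. {j. j < n * (n + 1) \<and> unfreeze (h ! j) \<noteq> unfreeze (h' ! j)}"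
  show ?case
  proof (cases "\<exists>t. bad_at n h t")
    case False
    \<comment> \<open>Without a bad triple \<open>chk\<close> accepts at once, so any string of the
      right length serves.\<close>
    then show ?thesis by (intro exI[of _ "1 # replicate b 1"]) (auto simp: digits_def)
  next
    case True
    define t where "t = (LEAST t. bad_at n h t)"
    have bt: "bad_at n h t" unfolding t_def using True by (rule LeastI_ex)
    then have tl: "t < n * n * (n + 1)" by (simp add: bad_at_def)
    have "bad3 (h ! cell1 n t) (h ! cell2 n t) (h ! cell3 n t) \<noteq> bad3 (h' ! cell1 n t) (h' ! cell2 n t) (h' ! cell3 n t)"
      using bt assms(3) tl by (auto simp: bad_at_def)
    then have "cell1 n t \<in> ?D h \<or> cell2 n t \<in> ?D h \<or> cell3 n t \<in> ?D h"
      using cell_lt(1-3)[OF tl] by (smt (verit, best) bad3_unfreeze mem_Collect_eq)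
    then have "\<exists>x\<in>{1, 2, 3}. cell n x t \<in> ?D h" by (auto simp: cell_def)
    then obtain x where x: "x \<in> {1, 2, 3}" "cell n x t \<in> ?D h" by blast
    define y where "y = cell n x t"
    have y: "y \<in> ?D h" "y < length h" using x(2) Suc.prems(1) by (auto simp: y_def)
    have hy: "h ! y \<in> {1, 2}" "unfreeze (h' ! y) = 3 - h ! y" using Suc.prems(2)[of y] y by auto
    let ?h = "h[y := 3 - h ! y]"
    have u: "unfreeze (3 - h ! y) = unfreeze (h' ! y)" using hy by (auto simp: unfreeze_def)
    have D: "?D ?h = ?D h - {y}"
      using y u by (auto simp: nth_list_update)
    have "card (?D ?h) \<le> b"
      unfolding D using Suc.prems(3) y(1) by (simp add: card_Diff_singleton)
    moreover have "?h ! j \<in> {1, 2} \<and> unfreeze (h' ! j) = 3 - ?h ! j"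
      if "j < n * (n + 1)" "unfreeze (?h ! j) \<noteq> unfreeze (h' ! j)" for j
    proof -
      have "j \<in> ?D ?h" using that by simp
      then have "j \<noteq> y" "j \<in> ?D h" unfolding D by auto
      then show ?thesis using Suc.prems(2)[of j] by simp
    qed
    ultimately obtain g where g: "digits b g" "chk n g ?h"
      using Suc.IH[of ?h] Suc.prems(1) by auto
    then have "digits (Suc b) (x # g) \<and> chk n (x # g) h"
      using x(1) hy(1) by (auto simp: digits_def Let_def t_def[symmetric] y_def[symmetric])
    then show ?thesis by blast
  qed
qed

definition flip_set :: "nat set \<Rightarrow> nat list \<Rightarrow> nat list" where
  "flip_set D h = map (\<lambda>j. if j \<in> D then 3 - h ! j else h ! j) [0..<length h]"

lemma flip_set_empty: "flip_set {} h = h"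
  by (simp add: flip_set_def map_nth)

text \<open>Conversely, the flips made along an accepted string amount to a set of unfrozen cells
  with no more elements than the string has letters.\<close>

lemma chk_sound:
  assumes "length h = n * (n + 1)" "chk n g h"
  shows "\<exists>D. D \<subseteq> {j. j < length h \<and> h ! j \<in> {1, 2}} \<and> card D \<le> length g \<and> (\<nexists>t. bad_at n (flip_set D h) t)"
  using assms
proof (induction g arbitrary: h)
  case Nil
  then show ?case by (intro exI[of _ "{}"]) (simp add: flip_set_empty)
next
  case (Cons x g)
  define t where "t = (LEAST t. bad_at n h t)"
  define y where "y = cell n x t"
  show ?case
  proof (cases "\<exists>t. bad_at n h t")
    case False
    then show ?thesis by (intro exI[of _ "{}"]) (simp add: flip_set_empty)
  next
    case True
    have "bad_at n h t" unfolding t_def using True by (rule LeastI_ex)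
    then have y: "y < length h" using cell_lt(4)[of t n x] Cons.prems(1) by (simp add: y_def bad_at_def)
    let ?h = "h[y := 3 - h ! y]"
    have hy: "h ! y \<in> {1, 2}" and c: "chk n g ?h"
      using Cons.prems(2) True by (auto simp: Let_def t_def[symmetric] y_def[symmetric])
    obtain D where D: "D \<subseteq> {j. j < length ?h \<and> ?h ! j \<in> {1, 2}}" "card D \<le> length g" "\<nexists>t. bad_at n (flip_set D ?h) t"
      using Cons.IH[of ?h] Cons.prems(1) c by auto
    \<comment> \<open>A second flip of the same cell cancels the first one, hence the symmetric
      difference with the cell \<open>y\<close>.\<close>
    define D' where "D' = (if y \<in> D then D - {y} else insert y D)"
    have fin: "finite D" using D(1) by (rule finite_subset) simp
    have "card D' \<le> Suc (card D)" using fin by (auto simp: D'_def card_insert_if card_Diff_singleton)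
    moreover have "D' \<subseteq> {j. j < length h \<and> h ! j \<in> {1, 2}}"
    proof
      fix j assume "j \<in> D'"
      then have "j = y \<or> j \<in> D \<and> j \<noteq> y" by (auto simp: D'_def split: if_splits)
      then show "j \<in> {j. j < length h \<and> h ! j \<in> {1, 2}}" using D(1) y hy by auto
    qed
    moreover have "flip_set D' h = flip_set D ?h"
      unfolding flip_set_def D'_def using hy y by (auto simp: nth_list_update)
    ultimately show ?thesis using D(2,3) by (intro exI[of _ D']) simp
  qed
qed

definition solves :: "nat \<Rightarrow> nat list \<Rightarrow> nat \<Rightarrow> nat list \<Rightarrow> bool" where
  "solves n M s Q \<longleftrightarrow> digits (length M) Q \<and> forced M Q \<and> weight Q = s \<and> (\<nexists>t. bad_at n (loaded M Q) t)"

text \<open>An accepted guess string yields a set \<open>D\<close> of undecided pairs to flip. It is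
  enlarged to a set \<open>B\<close> whose size is exactly the remaining budget; on the difference
  the operations repeat the current state of the pair.\<close>

lemma feasible_imp_extends:
  assumes M: "matrix n M" and P: "length P \<le> length M" "set P \<subseteq> {1, 2, 3}" and f: "feasible n M P s"
  shows "\<exists>Q. solves n M s Q \<and> take (length P) Q = P"
proof -
  let ?h = "loaded M P" and ?U = "free_cells M (length P)"
  have lM: "length M = n * (n + 1)" using M by (simp add: matrix_def shape_def)
  have lh: "length ?h = length M" by (simp add: loaded_def)
  have fo: "forced M P" "weight P \<le> s" "s \<le> weight P + card ?U" using f by (auto simp: feasible_def)
  obtain g where g: "digits (s - weight P) g" "chk n g ?h" using f by (auto simp: feasible_def)
  obtain D where D: "D \<subseteq> {j. j < length ?h \<and> ?h ! j \<in> {1, 2}}" "card D \<le> s - weight P" "\<nexists>t. bad_at n (flip_set D ?h) t"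
    using chk_sound[of ?h n g] g lM lh by (auto simp: digits_def)
  have P3: "P ! j \<in> {1, 2, 3}" if "j < length P" for j using P(2) nth_mem[OF that] by blast
  have DU: "D \<subseteq> ?U"
  proof
    fix j assume "j \<in> D"
    then have j: "j < length M" "?h ! j \<in> {1, 2}" using D(1) lh by auto
    then have "\<not> j < length P" using P3[of j] by (auto simp: loaded_def comb_def split: if_splits)
    then show "j \<in> ?U" using j by (auto simp: free_cells_def loaded_def comb_def split: if_splits)
  qed
  have fU: "finite ?U" by (simp add: free_cells_def)
  have "s - weight P \<le> card ?U" using fo(3) by simp
  \<comment> \<open>Such a \<open>B\<close> exists because \<open>D\<close> is not larger than the
    budget, and the budget is not larger than the number of undecided pairs.\<close>
  then obtain B where B: "D \<subseteq> B" "B \<subseteq> ?U" "card B = s - weight P"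
    using exists_subset_between[OF D(2) _ DU fU] by blast
  \<comment> \<open>On \<open>B\<close> the letter 2 (addition) is right in two cases: a missing
    edge is to be flipped, or a present edge is to be kept. In the other two cases it is the
    deletion 3.\<close>
  define Q where "Q = map (\<lambda>j. if j < length P then P ! j else if j \<notin> B then 1 else if (j \<in> D) = (M ! j = 1) then 2 else 3) [0..<length M]"
  have Ql: "length Q = length M" by (simp add: Q_def)
  have Qn: "Q ! j = (if j < length P then P ! j else if j \<notin> B then 1 else if (j \<in> D) = (M ! j = 1) then 2 else 3)"
    if "j < length M" for j using that by (simp add: Q_def)
  have B': "j \<ge> length P" "j < length M" "M ! j \<in> {1, 2}" if "j \<in> B" for j
    using B(2) that by (auto simp: free_cells_def)
  have "digits (length M) Q"
  proof -
    have "Q ! j \<in> {1, 2, 3}" if "j < length M" for j using Qn[OF that] P3[of j] by auto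
    then show ?thesis unfolding digits_def using Ql by (metis in_set_conv_nth subsetI)
  qed
  moreover have "take (length P) Q = P"
    by (rule nth_equalityI) (use P(1) Ql Qn in auto)
  moreover have "forced M Q"
    unfolding forced_def Ql using Qn fo(1) B'(3) by (auto simp: forced_def split: if_splits)
  moreover have "weight Q = s"
  proof -
    have "{j. j < length Q \<and> Q ! j \<noteq> 1} = {j. j < length P \<and> P ! j \<noteq> 1} \<union> B"
    proof (intro set_eqI iffI)
      fix j assume "j \<in> {j. j < length Q \<and> Q ! j \<noteq> 1}"
      then show "j \<in> {j. j < length P \<and> P ! j \<noteq> 1} \<union> B" using Qn[of j] Ql by (auto split: if_splits)
    next
      fix j assume "j \<in> {j. j < length P \<and> P ! j \<noteq> 1} \<union> B"
      then consider "j < length P" "P ! j \<noteq> 1" | "j \<in> B" by blast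
      then show "j \<in> {j. j < length Q \<and> Q ! j \<noteq> 1}"
      proof cases
        case 1
        then show ?thesis using Qn[of j] Ql P(1) by simp
      next
        case 2
        then show ?thesis using Qn[of j] Ql B'(1,2)[of j] by simp
      qed
    qed
    moreover have "card ({j. j < length P \<and> P ! j \<noteq> 1} \<union> B) = weight P + card B"
      unfolding weight_def
    proof (rule card_Un_disjoint)
      show "{j. j < length P \<and> P ! j \<noteq> 1} \<inter> B = {}" using B'(1) by (metis (no_types, lifting) disjoint_iff leD mem_Collect_eq)
    qed (use finite_subset[OF B(2) fU] in auto)
    ultimately show ?thesis using B(3) fo(2) by (simp add: weight_def)
  qed
  moreover have "\<nexists>t. bad_at n (loaded M Q) t"
  proof -
    have "unfreeze (loaded M Q ! j) = unfreeze (flip_set D ?h ! j)" if j: "j < n * (n + 1)" for j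
    proof -
      have j': "j < length M" using j lM by simp
      have q: "loaded M Q ! j = comb (M ! j) (Q ! j)" "?h ! j = comb (M ! j) (if j < length P then P ! j else 0)"
         "flip_set D ?h ! j = (if j \<in> D then 3 - ?h ! j else ?h ! j)"
        using j' Ql lh by (simp_all add: loaded_def flip_set_def)
      consider "j < length P" | "j \<ge> length P" "j \<in> B" "j \<in> D" | "j \<ge> length P" "j \<in> B" "j \<notin> D" | "j \<ge> length P" "j \<notin> B" by linarith
      then show ?thesis
      proof cases
        case 1
        then have "j \<notin> D" using DU by (auto simp: free_cells_def)
        then show ?thesis using 1 Qn[OF j'] unfolding q by simp
      next
        case 2
        then show ?thesis using B'(3)[of j] Qn[OF j'] unfolding q by (auto simp: comb_def unfreeze_def)
      next
        case 3
        then show ?thesis using B'(3)[of j] Qn[OF j'] unfolding q by (auto simp: comb_def unfreeze_def)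
      next
        case 4
        then have "j \<notin> D" using B(1) by blast
        then show ?thesis using 4 Qn[OF j'] unfolding q by (auto simp: comb_def unfreeze_def)
      qed
    qed
    then have "bad_at n (loaded M Q) t = bad_at n (flip_set D ?h) t" for t
      using bad_at_unfreeze[of "loaded M Q" n "flip_set D ?h"] lM by (simp add: loaded_def flip_set_def)
    then show ?thesis using D(3) by simp
  qed
  ultimately show ?thesis unfolding solves_def by blast
qed

text \<open>Loading \<open>Q\<close> instead of \<open>P\<close> changes the graph only at pairs on
  which \<open>Q\<close> puts an operation beyond \<open>P\<close>. There are exactly as many of
  these as the remaining budget, so \<open>chk_complete\<close> applies with the matrix of
  \<open>Q\<close> as target.\<close>

lemma extends_imp_feasible:
  assumes M: "matrix n M" and P: "length P \<le> length M" and Q: "solves n M s Q" "take (length P) Q = P"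
  shows "feasible n M P s"
proof -
  let ?h = "loaded M P" and ?U = "free_cells M (length P)"
  have lM: "length M = n * (n + 1)" using M by (simp add: matrix_def shape_def)
  have Ql: "length Q = length M" and fQ: "forced M Q" and wQ: "weight Q = s" and nb: "\<nexists>t. bad_at n (loaded M Q) t"
    and Q3: "set Q \<subseteq> {1, 2, 3}"
    using Q(1) by (auto simp: solves_def digits_def)
  have PQ: "P ! j = Q ! j" if "j < length P" for j using Q(2) that by (metis nth_take)
  let ?R = "{j. length P \<le> j \<and> j < length M \<and> Q ! j \<noteq> 1}"
  have RU: "?R \<subseteq> ?U" using fQ Ql by (auto simp: forced_def free_cells_def)
  have fU: "finite ?U" by (simp add: free_cells_def)
  have "{j. j < length Q \<and> Q ! j \<noteq> 1} = {j. j < length P \<and> P ! j \<noteq> 1} \<union> ?R"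
    using PQ P Ql by auto
  moreover have "card ({j. j < length P \<and> P ! j \<noteq> 1} \<union> ?R) = weight P + card ?R"
    unfolding weight_def by (intro card_Un_disjoint) auto
  ultimately have s: "s = weight P + card ?R" using wQ by (simp add: weight_def)
  have fP: "forced M P" using fQ PQ P Ql by (auto simp: forced_def)
  have "card ?R \<le> card ?U" using RU fU by (rule card_mono[rotated])
  have q: "loaded M Q ! j = comb (M ! j) (Q ! j)" "?h ! j = comb (M ! j) (if j < length P then P ! j else 0)"
    if "j < length M" for j using that Ql by (simp_all add: loaded_def)
  have Q3': "Q ! j \<in> {1, 2, 3}" if "j < length M" for j using subsetD[OF Q3 nth_mem[of j Q]] that Ql by simp
  have diff: "j \<in> ?R \<and> ?h ! j \<in> {1, 2} \<and> unfreeze (loaded M Q ! j) = 3 - ?h ! j"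
    if "j < n * (n + 1)" "unfreeze (?h ! j) \<noteq> unfreeze (loaded M Q ! j)" for j
  proof -
    have j: "j < length M" using that lM by simp
    have "\<not> j < length P" using that(2) PQ q[OF j] by auto
    then show ?thesis using that(2) Q3'[OF j] unfolding q[OF j] by (auto simp: comb_def unfreeze_def j split: if_splits)
  qed
  have "card {j. j < n * (n + 1) \<and> unfreeze (?h ! j) \<noteq> unfreeze (loaded M Q ! j)} \<le> card ?R"
    by (rule card_mono) (use diff in auto)
  then have "\<exists>g. digits (s - weight P) g \<and> chk n g ?h"
    by (intro chk_complete[of ?h n "loaded M Q"]) (use nb diff lM s in \<open>auto simp: loaded_def\<close>)
  then show ?thesis using fP s \<open>card ?R \<le> card ?U\<close> by (auto simp: feasible_def)
qed

section \<open>The search for the next solution\<close>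

lemma dval_append: "dval (xs @ ys) = dval xs * 3 ^ length ys + dval ys"
proof (induction ys rule: rev_induct)
  case (snoc y ys)
  have "dval (xs @ ys @ [y]) = 3 * dval (xs @ ys) + (y - 1)"
    using dval_simps(2)[of "xs @ ys" y] by simp
  then show ?case using snoc by (simp add: algebra_simps)
qed simp

text \<open>This is the next node in depth first order outside the subtree of \<open>P\<close>:
  trailing threes have no right sibling and are dropped, and the last other letter is increased.
  \<open>None\<close> means that the whole tree of the current size is done.\<close>

definition next_prefix :: "nat list \<Rightarrow> nat list option" where
  "next_prefix P = (case dropWhile (\<lambda>x. x = 3) (rev P) of [] \<Rightarrow> None | x # xs \<Rightarrow> Some (rev xs @ [x + 1]))"

lemma next_prefix_simps:
  "next_prefix (replicate k 3) = None"
  "x \<noteq> 3 \<Longrightarrow> next_prefix ((pre @ [x]) @ replicate k 3) = Some (pre @ [x + 1])"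
proof -
  have *: "dropWhile (\<lambda>x. x = 3) (replicate k 3 @ ys) = dropWhile (\<lambda>x. x = 3) ys" for ys :: "nat list"
    by (induction k) auto
  show "next_prefix (replicate k 3) = None" using *[of "[]"] by (simp add: next_prefix_def)
  show "x \<noteq> 3 \<Longrightarrow> next_prefix ((pre @ [x]) @ replicate k 3) = Some (pre @ [x + 1])"
    by (simp add: next_prefix_def *)
qed

definition next_size :: cmd where
  "next_size = Cond (\<lambda>r. r 2 = 7) (put 15 2) (mvL 2 ;; to_end 8 ;; put 8 1 ;; rewind 8)"

definition incr_prefix :: cmd where
  "incr_prefix = mvL 4 ;; While (\<lambda>r. r 4 = 3) (Act (\<lambda>r. [(4, Some 0, MoveL)])) ;;
     Cond (\<lambda>r. r 4 = 7) next_size (Act (\<lambda>r. [(4, Some (if r 4 = 1 then 2 else 3), Stay)]))"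

lemma runs_erase_threes:
  assumes "\<sigma> i = tp (pre @ replicate k 3) (length pre + k)" "pre = [] \<or> last pre \<noteq> 3" "2 * k + 1 \<le> T"
  shows "runs (While (\<lambda>r. r i = 3) (Act (\<lambda>r. [(i, Some 0, MoveL)]))) \<sigma> T (\<sigma>(i := tp pre (length pre)))"
proof (rule runs_While_index[where f = "\<lambda>t. \<sigma>(i := tp (pre @ replicate (k - t) 3) (length pre + k - t))"
      and N = k and C = 1])
  fix t assume t: "t < k"
  have e: "length pre + k - t = Suc (length pre + (k - Suc t))" using t by auto
  have e2: "pre @ replicate (k - t) 3 = (pre @ replicate (k - Suc t) 3) @ [3::nat]"
    using t by (metis Suc_diff_Suc append.assoc replicate_Suc replicate_append_same)
  show "rd (\<sigma>(i := tp (pre @ replicate (k - t) 3) (length pre + k - t))) i = 3"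
    unfolding e e2 by (simp add: nth_append)
  have w: "wrt 0 (tp (pre @ replicate (k - t) 3) (length pre + k - t)) = tp (pre @ replicate (k - Suc t) 3) (length pre + k - t)"
    unfolding e e2 by (rule wrt_tp_erase) simp
  show "runs (Act (\<lambda>r. [(i, Some 0, MoveL)])) (\<sigma>(i := tp (pre @ replicate (k - t) 3) (length pre + k - t))) 1
      (\<sigma>(i := tp (pre @ replicate (k - Suc t) 3) (length pre + k - Suc t)))"
    by (intro runs_Act) (simp_all add: fun_eq_iff w)
next
  show "\<not> rd (\<sigma>(i := tp (pre @ replicate (k - k) 3) (length pre + k - k))) i = 3"
  proof (cases pre rule: rev_cases)
    case (snoc ys y)
    then show ?thesis using assms(2) by (simp add: nth_append)
  qed simp
qed (use assms in auto)

lemma runs_incr_prefix: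
  assumes \<sigma>: "\<sigma> 2 = tp (replicate k 1) (k - s)" "\<sigma> 4 = tp P (Suc (length P))" "\<sigma> 8 = tp (replicate s 1) 1" "\<sigma> 15 = reg v"
    and s: "s \<le> k" and P: "set P \<subseteq> {1, 2, 3}" and T: "2 * length P + 4 * k + 30 \<le> T"
  shows "runs incr_prefix \<sigma> T (case next_prefix P of Some P' \<Rightarrow> \<sigma>(4 := tp P' (length P'))
    | None \<Rightarrow> if s = k then \<sigma>(4 := tp [] 0, 15 := reg 2)
        else \<sigma>(2 := tp (replicate k 1) (k - Suc s), 4 := tp [] 0, 8 := tp (replicate (Suc s) 1) 1))"
proof -
  have 1: "runs (mvL 4) \<sigma> 1 (\<sigma>(4 := tp P (length P)))" (is "runs _ _ _ ?\<sigma>1")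
    by (rule runs_mvL) (use \<sigma> in auto)
  consider (a) j where "P = replicate j 3" | (b) pre x j where "P = (pre @ [x]) @ replicate j 3" "x \<noteq> 3"
    using trailing_threes by metis
  then show ?thesis
  proof cases
    case a
    have 2: "runs (While (\<lambda>r. r 4 = 3) (Act (\<lambda>r. [(4, Some 0, MoveL)]))) ?\<sigma>1 (2 * length P + 1) (\<sigma>(4 := tp [] 0))"
      using runs_erase_threes[of ?\<sigma>1 4 "[]" j "2 * length P + 1"] a by simp
    let ?\<sigma>2 = "\<sigma>(4 := tp [] 0)"
    show ?thesis
    proof (cases "s = k")
      case True
      have 3: "runs (put 15 2) ?\<sigma>2 1 (\<sigma>(4 := tp [] 0, 15 := reg 2))"
        by (rule runs_put) (use \<sigma> in auto)
      have 4: "runs next_size ?\<sigma>2 2 (\<sigma>(4 := tp [] 0, 15 := reg 2))"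
        unfolding next_size_def by (rule runs_CondT[OF _ 3]) (use \<sigma> True in auto)
      have 5: "runs (Cond (\<lambda>r. r 4 = 7) next_size (Act (\<lambda>r. [(4, Some (if r 4 = 1 then 2 else 3), Stay)]))) ?\<sigma>2 3
        (\<sigma>(4 := tp [] 0, 15 := reg 2))"
        by (rule runs_CondT[OF _ 4]) auto
      have "runs incr_prefix \<sigma> T (\<sigma>(4 := tp [] 0, 15 := reg 2))"
        unfolding incr_prefix_def by (rule runs_Seq[OF 1 runs_Seq[OF 2 5 order_refl]]) (use T in simp)
      then show ?thesis using True a by (simp add: next_prefix_simps)
    next
      case False
      then have sk: "k - s = Suc (k - Suc s)" "s < k" using s by auto
      have 3: "runs (mvL 2) ?\<sigma>2 1 (?\<sigma>2(2 := tp (replicate k 1) (k - Suc s)))" (is "runs _ _ _ ?\<sigma>3")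
        by (rule runs_mvL) (use \<sigma> sk in auto)
      have 4: "runs (to_end 8) ?\<sigma>3 (2 * s + 1) (?\<sigma>3(8 := tp (replicate s 1) (Suc s)))" (is "runs _ _ _ ?\<sigma>4")
        using runs_to_end[of ?\<sigma>3 8 "replicate s 1" 0 "2 * s + 1"] \<sigma> by simp
      have 5: "runs (put 8 1) ?\<sigma>4 1 (?\<sigma>4(8 := tp (replicate (Suc s) 1) (Suc s)))" (is "runs _ _ _ ?\<sigma>5")
        by (rule runs_put) (auto simp: wrt_tp_append replicate_append_same)
      have 6: "runs (rewind 8) ?\<sigma>5 (2 * k + 5) (?\<sigma>5(8 := tp (replicate (Suc s) 1) 1))"
        by (rule runs_rewind[where p = "Suc s"]) (use s in auto)
      have e: "?\<sigma>5(8 := tp (replicate (Suc s) 1) 1) =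
          \<sigma>(2 := tp (replicate k 1) (k - Suc s), 4 := tp [] 0, 8 := tp (replicate (Suc s) 1) 1)" (is "_ = ?\<sigma>6")
        by (auto simp: fun_eq_iff)
      have 7: "runs next_size ?\<sigma>2 (4 * k + 20) ?\<sigma>6"
        unfolding next_size_def
        by (rule runs_CondF[OF _ runs_Seq[OF 3 runs_Seq[OF 4 runs_Seq[OF 5 6[unfolded e] order_refl] order_refl] order_refl]])
          (use \<sigma> sk in auto)
      have 8: "runs (Cond (\<lambda>r. r 4 = 7) next_size (Act (\<lambda>r. [(4, Some (if r 4 = 1 then 2 else 3), Stay)]))) ?\<sigma>2 (4 * k + 21) ?\<sigma>6"
        by (rule runs_CondT[OF _ 7]) auto
      have "runs incr_prefix \<sigma> T ?\<sigma>6"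
        unfolding incr_prefix_def by (rule runs_Seq[OF 1 runs_Seq[OF 2 8 order_refl]]) (use T in simp)
      then show ?thesis using False a by (simp add: next_prefix_simps)
    qed
  next
    case b
    let ?P = "pre @ [x + 1]"
    have x: "x \<in> {1, 2}" using b P by auto
    have 2: "runs (While (\<lambda>r. r 4 = 3) (Act (\<lambda>r. [(4, Some 0, MoveL)]))) ?\<sigma>1 (2 * length P + 1)
       (\<sigma>(4 := tp (pre @ [x]) (Suc (length pre))))" (is "runs _ _ _ ?\<sigma>2")
      using runs_erase_threes[of ?\<sigma>1 4 "pre @ [x]" j "2 * length P + 1"] b by simp
    have 3: "runs (Act (\<lambda>r. [(4, Some (if r 4 = 1 then 2 else 3), Stay)])) ?\<sigma>2 1 (\<sigma>(4 := tp ?P (length ?P)))"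
      by (rule runs_Act) (use x in \<open>auto simp: nth_append wrt_tp_update list_update_append fun_eq_iff simp flip: numeral_2_eq_2\<close>)
    have 4: "runs (Cond (\<lambda>r. r 4 = 7) next_size (Act (\<lambda>r. [(4, Some (if r 4 = 1 then 2 else 3), Stay)]))) ?\<sigma>2 2
       (\<sigma>(4 := tp ?P (length ?P)))"
      by (rule runs_CondF[OF _ 3]) (use x in \<open>auto simp: nth_append\<close>)
    have "runs incr_prefix \<sigma> T (\<sigma>(4 := tp ?P (length ?P)))"
      unfolding incr_prefix_def by (rule runs_Seq[OF 1 runs_Seq[OF 2 4 order_refl]]) (use T in simp)
    then show ?thesis using b by (simp only: next_prefix_simps(2)[OF b(2)] option.case)
  qed
qed

text \<open>A prefix receives the code of its extension by ones, the smallest code below it. The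
  codes of its extensions to length \<open>l\<close> fill the interval of length
  \<open>3 ^ (l - length P)\<close> that starts there.\<close>

definition code :: "nat \<Rightarrow> nat \<Rightarrow> nat list \<Rightarrow> nat" where
  "code l s P = s * 3 ^ l + dval P * 3 ^ (l - length P)"

text \<open>The next prefix starts exactly where the interval of \<open>P\<close> ends, so skipping
  a subtree leaves no gap. The sum of the \<open>4 - x\<close> decreases because dropped letters had
  positive weight; it measures the progress through a part of the tree without solutions.\<close>

lemma next_prefix_Some:
  assumes "next_prefix P = Some P'" "set P \<subseteq> {1, 2, 3}"
  shows "length P' \<le> length P" "P' \<noteq> []" "set P' \<subseteq> {1, 2, 3}"
    "length P \<le> l \<Longrightarrow> code l s P' = code l s P + 3 ^ (l - length P)"
    "(\<Sum>x\<leftarrow>P'. 4 - x) < (\<Sum>x\<leftarrow>P. 4 - x)"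
proof -
  obtain pre x j where b: "P = (pre @ [x]) @ replicate j 3" "x \<noteq> 3"
    using assms(1) by (cases P rule: trailing_threes) (auto simp: next_prefix_simps(1))
  have P': "P' = pre @ [x + 1]" using assms(1) next_prefix_simps(2)[OF b(2), of pre j] b(1) by simp
  have x: "x \<in> {1, 2}" using b assms(2) by auto
  show "length P' \<le> length P" "P' \<noteq> []" "set P' \<subseteq> {1, 2, 3}" "(\<Sum>x\<leftarrow>P'. 4 - x) < (\<Sum>x\<leftarrow>P. 4 - x)"
    using b P' x assms(2) by auto
  assume l: "length P \<le> l"
  have e: "l - length P' = (l - length P) + j" using b P' l by simp
  have "dval P' * 3 ^ j = dval P + 1"
    using dval_threes[of "pre @ [x]" j] b P' x by auto
  then have "dval P' * 3 ^ (l - length P') = (dval P + 1) * 3 ^ (l - length P)"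
    unfolding e power_add by (metis mult.assoc mult.commute)
  then show "code l s P' = code l s P + 3 ^ (l - length P)" by (simp add: code_def)
qed

text \<open>A prefix of threes covers the last interval of its size, and the codes of the next size
  begin right behind it.\<close>

lemma next_prefix_None:
  assumes "next_prefix P = None" "length P \<le> l"
  shows "code l (Suc s) [] = code l s P + 3 ^ (l - length P)"
proof -
  obtain j where "P = replicate j 3"
    using assms(1) by (cases P rule: trailing_threes) (auto simp: next_prefix_simps simp del: append_assoc)
  then have "dval P + 1 = 3 ^ length P" using dval_threes[of "[]" j] by simp
  then have "(dval P + 1) * 3 ^ (l - length P) = 3 ^ l" using assms(2) by (simp flip: power_add)
  then show ?thesis by (simp add: code_def)
qed

definition sol_codes :: "nat \<Rightarrow> nat list \<Rightarrow> nat \<Rightarrow> nat set" where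
  "sol_codes n M k = {code (length M) s Q | s Q. s \<le> k \<and> solves n M s Q}"

lemma code_full: "length Q = l \<Longrightarrow> code l s Q = s * 3 ^ l + dval Q"
  by (simp add: code_def)

lemma code_inj:
  assumes "digits l Q" "digits l Q'" "code l s Q = code l s' Q'"
  shows "s = s'" "Q = Q'"
proof -
  have d: "dval Q < 3 ^ l" "dval Q' < 3 ^ l"
    using assms(1,2) dval_less[of Q] dval_less[of Q'] by (auto simp: digits_def)
  have e: "s * 3 ^ l + dval Q = s' * 3 ^ l + dval Q'"
    using assms by (simp add: code_full digits_def)
  have "(s * 3 ^ l + dval Q) div 3 ^ l = s" "(s' * 3 ^ l + dval Q') div 3 ^ l = s'"
    using d by simp_all
  then show "s = s'" unfolding e by simp
  then show "Q = Q'" using e assms dval_inj[of Q Q'] by (simp add: digits_def)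
qed

text \<open>Dividing a code by \<open>3 ^ (l - length P)\<close> removes the digits behind the
  prefix. All codes in the interval of \<open>P\<close> share this quotient, which determines the
  size and the leading digits.\<close>

lemma code_interval:
  assumes Q: "digits l Q" and P: "length P \<le> l" "set P \<subseteq> {1, 2, 3}"
    and c: "code l s P \<le> code l s' Q" "code l s' Q < code l s P + 3 ^ (l - length P)"
  shows "s' = s \<and> take (length P) Q = P"
proof -
  let ?d = "l - length P" and ?Q = "take (length P) Q" and ?R = "drop (length P) Q"
  have l: "length Q = l" "length ?R = ?d" "set Q \<subseteq> {1, 2, 3}" using Q by (auto simp: digits_def)
  have dQ: "dval Q = dval ?Q * 3 ^ ?d + dval ?R" using dval_append[of ?Q ?R] l by simp
  have R: "dval ?R < 3 ^ ?d" using dval_less[of ?R] l by (auto dest: in_set_dropD)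
  have Pl: "dval P < 3 ^ length P" and Ql: "dval ?Q < 3 ^ length P"
    using dval_less[of P] dval_less[of ?Q] P l by (auto dest: in_set_takeD)
  have p: "3 ^ l = 3 ^ length P * (3::nat) ^ ?d" using P(1) by (simp flip: power_add)
  have "s * 3 ^ length P + dval P = s' * 3 ^ length P + dval ?Q"
  proof -
    have 1: "code l s P = (s * 3 ^ length P + dval P) * 3 ^ ?d" by (simp add: code_def p algebra_simps)
    have 2: "code l s' Q = (s' * 3 ^ length P + dval ?Q) * 3 ^ ?d + dval ?R"
      by (simp add: code_full[OF l(1)] dQ p algebra_simps)
    have "code l s' Q div 3 ^ ?d = s' * 3 ^ length P + dval ?Q" unfolding 2 using R by simp
    moreover have "code l s' Q div 3 ^ ?d = s * 3 ^ length P + dval P"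
      using c unfolding 1 by (intro div_nat_eqI) (simp_all add: algebra_simps)
    ultimately show ?thesis by simp
  qed
  then have e: "s * 3 ^ length P + dval P = s' * 3 ^ length P + dval ?Q" .
  have "(s * 3 ^ length P + dval P) div 3 ^ length P = s" "(s' * 3 ^ length P + dval ?Q) div 3 ^ length P = s'"
    using Pl Ql by simp_all
  then have s: "s = s'" unfolding e by simp
  then have "dval P = dval ?Q" using e by simp
  then have "P = ?Q" using dval_inj[of P ?Q] P l by (auto dest: in_set_takeD)
  then show ?thesis using s by simp
qed

definition walk :: cmd where
  "walk = While (\<lambda>r. r 4 \<noteq> 0) (Act (\<lambda>r. [(3, None, MoveR), (4, None, MoveR)]))"

text \<open>The matrix tape is walked in parallel with the prefix, so a blank on it shows that the
  prefix is a complete assignment. A feasible incomplete prefix is extended by 1; an infeasible one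
  is abandoned together with its subtree.\<close>

definition body :: cmd where
  "body = feas ;; walk ;; Cond (\<lambda>r. r 14 = 1)
     (Cond (\<lambda>r. r 3 = 0) (put 15 1) (put 4 1) ;; rewind 3 ;; rewind 4)
     (incr_prefix ;; rewind 3 ;; rewind 4)"

definition find :: cmd where "find = While (\<lambda>r. r 15 = 0) body"

definition leave :: cmd where "leave = put 15 0 ;; walk ;; incr_prefix ;; rewind 3 ;; rewind 4"

lemma runs_walk:
  assumes "\<sigma> 3 = tp M 1" "\<sigma> 4 = tp P 1" "set P \<subseteq> {1, 2, 3}" "2 * length P + 1 \<le> T"
  shows "runs walk \<sigma> T (\<sigma>(3 := tp M (Suc (length P)), 4 := tp P (Suc (length P))))"
  unfolding walk_def
proof (rule runs_While_index[where f = "\<lambda>j. \<sigma>(3 := tp M (Suc j), 4 := tp P (Suc j))" and N = "length P" and C = 1])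
  fix j assume j: "j < length P"
  then show "rd (\<sigma>(3 := tp M (Suc j), 4 := tp P (Suc j))) 4 \<noteq> 0"
    using subsetD[OF assms(3) nth_mem[OF j]] by auto
qed (use assms in \<open>auto simp: fun_eq_iff intro!: runs_Act\<close>)

text \<open>\<open>w\<close> is the word on the output tape, \<open>q\<close> the status: 0 searching, 1 found, 2 finished.\<close>

definition main_inv :: "nat list \<Rightarrow> nat \<Rightarrow> nat \<Rightarrow> nat list \<Rightarrow> nat \<Rightarrow> nat list \<Rightarrow> store \<Rightarrow> bool" where
  "main_inv M k s P q w \<sigma> \<longleftrightarrow> s \<le> k \<and> length P \<le> length M \<and> set P \<subseteq> {1, 2, 3} \<and>
     \<sigma> 2 = tp (replicate k 1) (k - s) \<and> \<sigma> 3 = tp M 1 \<and> \<sigma> 4 = tp P 1 \<and>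
     (\<exists>ho. length ho \<le> length M \<and> \<sigma> 5 = tp ho 1 \<and> \<sigma> 6 = tp ho 1 \<and> \<sigma> 7 = tp ho 1) \<and>
     \<sigma> 8 = tp (replicate s 1) 1 \<and> \<sigma> 9 = tp [] 1 \<and> \<sigma> 10 = tp [] 1 \<and> \<sigma> 11 = tp [] 1 \<and>
     \<sigma> 12 = tp [] (length w) \<and> (\<exists>v. \<sigma> 14 = reg v) \<and> \<sigma> 15 = reg q \<and> \<sigma> 16 = tq w (length w)"

lemma runs_incr_rewind:
  assumes inv: "main_inv M k s P 0 w \<sigma>" and M: "matrix n M"
    and T: "2 * length M + 4 * k + 30 + (2 * length M + 5 + (2 * length M + 5) + 1) + 1 \<le> T"
  shows "\<exists>\<sigma>' s' P' q'. main_inv M k s' P' q' w \<sigma>' \<and>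
    runs (incr_prefix ;; rewind 3 ;; rewind 4) (\<sigma>(3 := tp M (Suc (length P)), 4 := tp P (Suc (length P)))) T \<sigma>' \<and>
    (case next_prefix P of Some P2 \<Rightarrow> s' = s \<and> P' = P2 \<and> q' = 0
     | None \<Rightarrow> P' = [] \<and> (if s = k then q' = 2 else s' = Suc s \<and> q' = 0))"
proof -
  let ?\<sigma>0 = "\<sigma>(3 := tp M (Suc (length P)), 4 := tp P (Suc (length P)))"
  have P: "length P \<le> length M" "set P \<subseteq> {1, 2, 3}" "s \<le> k" using inv by (auto simp: main_inv_def)
  have M7: "7 \<notin> set M" using M by (auto simp: matrix_def)
  let ?\<sigma>1 = "case next_prefix P of Some P' \<Rightarrow> ?\<sigma>0(4 := tp P' (length P'))
    | None \<Rightarrow> if s = k then ?\<sigma>0(4 := tp [] 0, 15 := reg 2)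
        else ?\<sigma>0(2 := tp (replicate k 1) (k - Suc s), 4 := tp [] 0, 8 := tp (replicate (Suc s) 1) 1)"
  have 1: "runs incr_prefix ?\<sigma>0 (2 * length M + 4 * k + 30) ?\<sigma>1"
    by (rule runs_incr_prefix[where v = 0]) (use inv P in \<open>auto simp: main_inv_def\<close>)
  define P1 where "P1 = (case next_prefix P of Some P' \<Rightarrow> P' | None \<Rightarrow> [])"
  have P1: "length P1 \<le> length M \<and> set P1 \<subseteq> {1, 2, 3}"
  proof (cases "next_prefix P")
    case (Some P2)
    then show ?thesis using next_prefix_Some(1,3)[OF Some P(2)] P(1) by (simp add: P1_def)
  qed (simp add: P1_def)
  have \<sigma>1: "?\<sigma>1 3 = tp M (Suc (length P))" "?\<sigma>1 4 = tp P1 (length P1)"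
    by (auto simp: P1_def split: option.split)
  have 2: "runs (rewind 3) ?\<sigma>1 (2 * length M + 5) (?\<sigma>1(3 := tp M 1))"
    by (rule runs_rewind[of ?\<sigma>1 3 M "Suc (length P)", OF \<sigma>1(1) M7]) (use P in simp)
  have 3: "runs (rewind 4) (?\<sigma>1(3 := tp M 1)) (2 * length M + 5) (?\<sigma>1(3 := tp M 1, 4 := tp P1 1))"
    by (rule runs_rewind[where p = "length P1" and h = P1]) (use P1 in \<open>auto simp: \<sigma>1(2)\<close>)
  define \<sigma>' where "\<sigma>' = ?\<sigma>1(3 := tp M 1, 4 := tp P1 1)"
  have r: "runs (incr_prefix ;; rewind 3 ;; rewind 4) ?\<sigma>0 T \<sigma>'"
    unfolding \<sigma>'_def by (rule runs_Seq[OF 1 runs_Seq[OF 2 3 order_refl] T])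
  show ?thesis
  proof (cases "next_prefix P")
    case (Some P2)
    have "main_inv M k s P1 0 w \<sigma>'"
      using inv P1 Some unfolding main_inv_def \<sigma>'_def by auto
    then show ?thesis using r Some P1_def by fastforce
  next
    case None
    show ?thesis
    proof (cases "s = k")
      case True
      have "main_inv M k s [] 2 w \<sigma>'"
        using inv P1 None True unfolding main_inv_def \<sigma>'_def P1_def by auto
      then show ?thesis using r None True by fastforce
    next
      case False
      have "main_inv M k (Suc s) [] 0 w \<sigma>'"
        using inv P1 None False P(3) unfolding main_inv_def \<sigma>'_def P1_def by auto
      then show ?thesis using r None False by fastforce
    qed
  qed
qed

section \<open>Bounding the number of prefixes between two outputs\<close>

definition good :: "nat \<Rightarrow> nat list \<Rightarrow> nat \<Rightarrow> nat list \<Rightarrow> bool" where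
  "good n M s P \<longleftrightarrow> P = [] \<and> feasible n M [] s \<or>
     (\<exists>p x y. P = p @ [x] \<and> x \<le> y \<and> y \<le> 3 \<and> feasible n M (p @ [y]) s)"

text \<open>A prefix is good if the subtree below its parent still holds a solution that has not been
  passed; from there the search only descends.\<close>

definition potential :: "nat \<Rightarrow> nat list \<Rightarrow> nat \<Rightarrow> nat \<Rightarrow> nat list \<Rightarrow> nat" where
  "potential n M k s P = (if good n M s P then 3 * (length M - length P) + (if P = [] then 3 else 3 - last P)
     else 3 * length M + 5 + (\<Sum>x\<leftarrow>P. 4 - x) + (k - s) * (6 * length M + 10))"

lemma sum_list_digits: "set P \<subseteq> {1, 2, 3} \<Longrightarrow> (\<Sum>x\<leftarrow>P. 4 - x) \<le> 3 * length P"
  by (induction P) auto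

text \<open>At a good prefix the potential is at most \<open>3 * length M + 3\<close>, which the
  summand \<open>3 * length M + 5\<close> exceeds. The sum over the letters is at most
  \<open>3 * length M\<close>, so \<open>6 * length M + 10\<close> suffices for each size.\<close>

lemma potential_le:
  assumes "length P \<le> length M" "set P \<subseteq> {1, 2, 3}"
  shows "potential n M k s P \<le> (k + 1) * (6 * length M + 10)"
proof -
  have "(\<Sum>x\<leftarrow>P. 4 - x) \<le> 3 * length M" using sum_list_digits[OF assms(2)] assms(1) by simp
  moreover have "(k - s) * (6 * length M + 10) \<le> k * (6 * length M + 10)" by (rule mult_le_mono1) simp
  ultimately have "3 * length M + 5 + (\<Sum>x\<leftarrow>P. 4 - x) + (k - s) * (6 * length M + 10) \<le> (k + 1) * (6 * length M + 10)"
    unfolding add_mult_distrib mult_1 by linarith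
  then show ?thesis unfolding potential_def by (auto intro: order_trans)
qed

lemma potential_good: "good n M s P \<Longrightarrow> length P \<le> length M \<Longrightarrow> potential n M k s P \<le> 3 * length M + 3"
  by (auto simp: potential_def)

lemma feasible_imp_good:
  assumes "feasible n M P s" "set P \<subseteq> {1, 2, 3}"
  shows "good n M s P"
proof (cases P rule: rev_cases)
  case (snoc p x)
  then have "x \<le> 3" using assms(2) by auto
  then show ?thesis using snoc assms(1) unfolding good_def by blast
qed (use assms in \<open>auto simp: good_def\<close>)

text \<open>A solution extending \<open>P\<close> has some next letter, and this letter makes
  \<open>P @ [1]\<close> good. One level is worth 3, while the new last letter contributes only
  2.\<close>

lemma potential_push:
  assumes M: "matrix n M" and f: "feasible n M P s" and P: "length P < length M" "set P \<subseteq> {1, 2, 3}"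
  shows "potential n M k s (P @ [1]) < potential n M k s P"
proof -
  obtain Q where Q: "solves n M s Q" "take (length P) Q = P"
    using feasible_imp_extends[OF M _ P(2) f] P(1) by auto
  have l: "length Q = length M" "set Q \<subseteq> {1, 2, 3}" using Q(1) by (auto simp: solves_def digits_def)
  let ?y = "Q ! length P"
  have y: "?y \<in> {1, 2, 3}" using l P(1) nth_mem[of "length P" Q] by (auto simp del: nth_mem)
  have "take (Suc (length P)) Q = P @ [?y]" using Q(2) l P(1) by (simp add: take_Suc_conv_app_nth)
  then have "feasible n M (P @ [?y]) s"
    using extends_imp_feasible[OF M, of "P @ [?y]" s Q] Q(1) P(1) by simp
  then have "good n M s (P @ [1])" unfolding good_def using y by (intro disjI2 exI[of _ P] exI[of _ 1] exI[of _ ?y]) auto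
  moreover have "good n M s P" by (rule feasible_imp_good[OF f P(2)])
  ultimately show ?thesis using P(1) by (simp add: potential_def)
qed

text \<open>If \<open>P\<close> is good but infeasible, a feasible sibling lies strictly to its
  right, so the search moves to the next sibling and the last letter grows. Otherwise the new prefix
  is either good, which is worth less than any bad one, or bad with a smaller sum over its
  letters.\<close>

lemma potential_next:
  assumes nf: "\<not> feasible n M P s" and P: "length P \<le> length M" "set P \<subseteq> {1, 2, 3}" and P': "next_prefix P = Some P'"
  shows "potential n M k s P' < potential n M k s P"
proof (cases "good n M s P")
  case True
  then obtain p x y where x: "P = p @ [x]" "x \<le> y" "y \<le> 3" "feasible n M (p @ [y]) s"
    using nf by (auto simp: good_def)
  then have "x < y" using nf by (metis le_neq_implies_less)
  then have "P' = p @ [x + 1]" using P' next_prefix_simps(2)[of x p 0] x by simp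
  moreover from this have "good n M s P'" unfolding good_def using x \<open>x < y\<close>
    by (intro disjI2 exI[of _ p] exI[of _ "x + 1"] exI[of _ y]) auto
  ultimately show ?thesis using True x \<open>x < y\<close> by (simp add: potential_def)
next
  case False
  note nP = next_prefix_Some[OF P' P(2)]
  show ?thesis
  proof (cases "good n M s P'")
    case True
    then have "potential n M k s P' \<le> 3 * length M + 3" using nP(1) P(1) by (intro potential_good) auto
    then show ?thesis using False by (simp add: potential_def)
  next
    case False
    then show ?thesis using \<open>\<not> good n M s P\<close> nP(5) by (simp add: potential_def)
  qed
qed

lemma potential_next_size:
  assumes nf: "\<not> feasible n M P s" and P: "set P \<subseteq> {1, 2, 3}" "next_prefix P = None" and s: "s < k"
  shows "potential n M k (Suc s) [] < potential n M k s P"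
proof -
  \<comment> \<open>A good infeasible prefix would end with a letter below 3 and therefore have a
    next prefix.\<close>
  have ng: "\<not> good n M s P"
  proof
    assume "good n M s P"
    then obtain p x y where x: "P = p @ [x]" "x \<le> y" "y \<le> 3" "feasible n M (p @ [y]) s"
      using nf by (auto simp: good_def)
    then have "x < y" using nf by (metis le_neq_implies_less)
    then show False using P(2) next_prefix_simps(2)[of x p 0] x by simp
  qed
  have e: "k - s = Suc (k - Suc s)" using s by simp
  show ?thesis
  proof (cases "good n M (Suc s) []")
    case True
    then show ?thesis using potential_good[OF True, of k] ng by (simp add: potential_def)
  next
    case False
    then show ?thesis using ng unfolding potential_def e by simp
  qed
qed

definition body_time :: "nat \<Rightarrow> nat \<Rightarrow> nat" where
  "body_time l k = feas_time l k + 8 * l + 4 * k + 60"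

lemma feas_time_mono: "s \<le> k \<Longrightarrow> feas_time l s \<le> feas_time l k"
  unfolding feas_time_def by (intro add_mono mult_le_mono guess_time_mono power_increasing) auto

text \<open>A solution code in the interval of an infeasible prefix would belong to a solution
  extending it. Hence the whole interval may be skipped.\<close>

lemma infeasible_skips:
  assumes M: "matrix n M" and nf: "\<not> feasible n M P s" and P: "length P \<le> length M" "set P \<subseteq> {1, 2, 3}"
    and c: "c \<in> sol_codes n M k" "code (length M) s P \<le> c"
  shows "code (length M) s P + 3 ^ (length M - length P) \<le> c"
proof (rule ccontr)
  assume "\<not> ?thesis"
  moreover obtain s' Q where Q: "c = code (length M) s' Q" "solves n M s' Q" using c(1) by (auto simp: sol_codes_def)
  ultimately have "s' = s \<and> take (length P) Q = P"
    using c(2) P by (intro code_interval) (auto simp: solves_def)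
  then show False using extends_imp_feasible[OF M P(1), of s Q] Q(2) nf by auto
qed

lemma runs_body:
  assumes M: "matrix n M" and inv: "main_inv M k s P 0 w \<sigma>"
  shows "\<exists>\<sigma>' s' P' q'. main_inv M k s' P' q' w \<sigma>' \<and> runs body \<sigma> (body_time (length M) k) \<sigma>' \<and>
    (if feasible n M P s then s' = s \<and> (if length P = length M then P' = P \<and> q' = 1 else P' = P @ [1] \<and> q' = 0)
     else case next_prefix P of Some P2 \<Rightarrow> s' = s \<and> P' = P2 \<and> q' = 0
     | None \<Rightarrow> P' = [] \<and> (if s = k then q' = 2 else s' = Suc s \<and> q' = 0))"
proof -
  let ?L = "length M"
  have P: "length P \<le> ?L" "set P \<subseteq> {1, 2, 3}" "s \<le> k" using inv by (auto simp: main_inv_def)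
  obtain ho v where ho: "length ho \<le> ?L" "\<sigma> 5 = tp ho 1" "\<sigma> 6 = tp ho 1" "\<sigma> 7 = tp ho 1" "\<sigma> 14 = reg v"
    using inv by (auto simp: main_inv_def)
  obtain ho' where ho': "length ho' \<le> ?L" and "runs feas \<sigma> (feas_time ?L s)
      ((copies ho' 1 \<sigma>)(14 := reg (if feasible n M P s then 1 else 3)))"
    using runs_feas[OF M P(1,2), of \<sigma> ho s v] inv ho by (auto simp: main_inv_def)
  then have 1: "runs feas \<sigma> (feas_time ?L k)
      ((copies ho' 1 \<sigma>)(14 := reg (if feasible n M P s then 1 else 3)))"
    (is "runs _ _ _ ?\<sigma>1") using runs_mono feas_time_mono[OF P(3)] by blast
  have inv1: "main_inv M k s P 0 w ?\<sigma>1" using inv ho' unfolding main_inv_def by auto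
  let ?\<sigma>2 = "?\<sigma>1(3 := tp M (Suc (length P)), 4 := tp P (Suc (length P)))"
  have 2: "runs walk ?\<sigma>1 (2 * ?L + 1) ?\<sigma>2"
    by (rule runs_walk) (use inv P in \<open>auto simp: main_inv_def\<close>)
  have M7: "7 \<notin> set M" and M0: "\<And>j. j < length M \<Longrightarrow> M ! j \<noteq> 0"
    using M shapeD(2)[of n M] shapeD(6)[of n M] by (auto simp: matrix_def)
  show ?thesis
  proof (cases "feasible n M P s")
    case True
    define P' where "P' = (if length P = ?L then P else P @ [1])"
    define q' :: nat where "q' = (if length P = ?L then 1 else 0)"
    have P': "length P' \<le> ?L" "set P' \<subseteq> {1, 2, 3}" using P by (auto simp: P'_def)
    have 3: "runs (Cond (\<lambda>r. r 3 = 0) (put 15 1) (put 4 1)) ?\<sigma>2 2 (?\<sigma>2(4 := tp P' (Suc (length P)), 15 := reg q'))"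
      (is "runs _ _ _ ?\<sigma>3")
    proof (cases "length P = ?L")
      case True
      have "runs (put 15 1) ?\<sigma>2 1 (?\<sigma>2(4 := tp P' (Suc (length P)), 15 := reg q'))"
        by (rule runs_put) (use inv True in \<open>auto simp: P'_def q'_def main_inv_def fun_eq_iff\<close>)
      then show ?thesis by (rule runs_CondT[rotated]) (use True in auto)
    next
      case False
      have "runs (put 4 1) ?\<sigma>2 1 (?\<sigma>2(4 := tp P' (Suc (length P)), 15 := reg q'))"
        by (rule runs_put) (use inv False in \<open>auto simp: P'_def q'_def main_inv_def fun_eq_iff wrt_tp_append\<close>)
      then show ?thesis by (rule runs_CondF[rotated]) (use False P M0 in auto)
    qed
    have 4: "runs (rewind 3) ?\<sigma>3 (2 * ?L + 5) (?\<sigma>3(3 := tp M 1))"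
      by (rule runs_rewind[where p = "Suc (length P)"]) (use P M7 in auto)
    have 5: "runs (rewind 4) (?\<sigma>3(3 := tp M 1)) (2 * ?L + 5) (?\<sigma>3(3 := tp M 1, 4 := tp P' 1))"
      by (rule runs_rewind[where p = "Suc (length P)"]) (use P P' in auto)
    define \<sigma>' where "\<sigma>' = ?\<sigma>3(3 := tp M 1, 4 := tp P' 1)"
    have 6: "runs (Cond (\<lambda>r. r 14 = 1) (Cond (\<lambda>r. r 3 = 0) (put 15 1) (put 4 1) ;; rewind 3 ;; rewind 4)
       (incr_prefix ;; rewind 3 ;; rewind 4)) ?\<sigma>2 (4 * ?L + 20) \<sigma>'"
      unfolding \<sigma>'_def
      by (rule runs_CondT[OF _ runs_Seq[OF 3 runs_Seq[OF 4 5 order_refl] order_refl]]) (use True in auto)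
    have "runs body \<sigma> (body_time ?L k) \<sigma>'"
      unfolding body_def by (rule runs_Seq[OF 1 runs_Seq[OF 2 6 order_refl]]) (simp add: body_time_def)
    moreover have "main_inv M k s P' q' w \<sigma>'"
      using inv1 P' unfolding main_inv_def \<sigma>'_def by auto
    ultimately show ?thesis using True P'_def q'_def by fastforce
  next
    case False
    obtain \<sigma>' s' P' q' where r: "main_inv M k s' P' q' w \<sigma>'"
      "runs (incr_prefix ;; rewind 3 ;; rewind 4) ?\<sigma>2 (2 * ?L + 4 * k + 30 + (2 * ?L + 5 + (2 * ?L + 5) + 1) + 1) \<sigma>'"
      "case next_prefix P of Some P2 \<Rightarrow> s' = s \<and> P' = P2 \<and> q' = 0
       | None \<Rightarrow> P' = [] \<and> (if s = k then q' = 2 else s' = Suc s \<and> q' = 0)"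
      using runs_incr_rewind[OF inv1 M order_refl] by blast
    have 6: "runs (Cond (\<lambda>r. r 14 = 1) (Cond (\<lambda>r. r 3 = 0) (put 15 1) (put 4 1) ;; rewind 3 ;; rewind 4)
       (incr_prefix ;; rewind 3 ;; rewind 4)) ?\<sigma>2 (6 * ?L + 4 * k + 44) \<sigma>'"
      by (rule runs_CondF[OF _ r(2)]) (use False in auto)
    have "runs body \<sigma> (body_time ?L k) \<sigma>'"
      unfolding body_def by (rule runs_Seq[OF 1 runs_Seq[OF 2 6 order_refl]]) (simp add: body_time_def)
    then show ?thesis unfolding if_not_P[OF False] using r(1,3) by blast
  qed
qed

text \<open>Codes increase along the search, so no solution is passed over and none is found twice.\<close>

lemma runs_find:
  assumes M: "matrix n M" and inv: "main_inv M k s P 0 w \<sigma>"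
  shows "\<exists>\<sigma>' s' P' q'. main_inv M k s' P' q' w \<sigma>' \<and>
    runs find \<sigma> ((potential n M k s P + 1) * (body_time (length M) k + 1) + 1) \<sigma>' \<and>
    (q' = 1 \<and> solves n M s' P' \<and> code (length M) s P \<le> code (length M) s' P' \<and>
       (\<forall>c\<in>sol_codes n M k. code (length M) s P \<le> c \<longrightarrow> code (length M) s' P' \<le> c) \<or>
     q' = 2 \<and> (\<forall>c\<in>sol_codes n M k. c < code (length M) s P))"
  using inv
proof (induction "potential n M k s P" arbitrary: s P \<sigma> rule: less_induct)
  case less
  let ?L = "length M" and ?B = "body_time (length M) k"
  have P: "length P \<le> ?L" "set P \<subseteq> {1, 2, 3}" "s \<le> k" and q0: "\<sigma> 15 = reg 0" using less.prems by (auto simp: main_inv_def)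
  obtain \<sigma>1 s1 P1 q1 where b: "main_inv M k s1 P1 q1 w \<sigma>1" "runs body \<sigma> ?B \<sigma>1"
    "if feasible n M P s then s1 = s \<and> (if length P = ?L then P1 = P \<and> q1 = 1 else P1 = P @ [1] \<and> q1 = 0)
     else case next_prefix P of Some P2 \<Rightarrow> s1 = s \<and> P1 = P2 \<and> q1 = 0
     | None \<Rightarrow> P1 = [] \<and> (if s = k then q1 = 2 else s1 = Suc s \<and> q1 = 0)"
    using runs_body[OF M less.prems] by blast
  have q1: "\<sigma>1 15 = reg q1" using b(1) by (simp add: main_inv_def)
  have stop: "runs find \<sigma> ((potential n M k s P + 1) * (?B + 1) + 1) \<sigma>1" if "q1 \<noteq> 0"
  proof -
    have "runs find \<sigma> (?B + 1 + 1) \<sigma>1"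
      unfolding find_def by (rule runs_WhileT[OF _ b(2) runs_WhileF[OF _ order_refl]]) (use q0 q1 that in auto)
    then show ?thesis by (rule runs_mono) simp
  qed
  have go: ?case if lt: "potential n M k s1 P1 < potential n M k s P" and z: "q1 = 0" and
      le: "code ?L s P \<le> code ?L s1 P1" and
      skip: "\<And>c. c \<in> sol_codes n M k \<Longrightarrow> code ?L s P \<le> c \<Longrightarrow> code ?L s1 P1 \<le> c"
  proof -
    obtain \<sigma>' s' P' q' where r: "main_inv M k s' P' q' w \<sigma>'"
      "runs find \<sigma>1 ((potential n M k s1 P1 + 1) * (?B + 1) + 1) \<sigma>'"
      "q' = 1 \<and> solves n M s' P' \<and> code ?L s1 P1 \<le> code ?L s' P' \<and>
       (\<forall>c\<in>sol_codes n M k. code ?L s1 P1 \<le> c \<longrightarrow> code ?L s' P' \<le> c) \<or>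
       q' = 2 \<and> (\<forall>c\<in>sol_codes n M k. c < code ?L s1 P1)"
      using less.hyps[OF lt] b(1) z by blast
    have "(potential n M k s1 P1 + 2) * (?B + 1) \<le> (potential n M k s P + 1) * (?B + 1)"
      using lt by (intro mult_le_mono1) simp
    then have t: "?B + ((potential n M k s1 P1 + 1) * (?B + 1) + 1) + 1 \<le> (potential n M k s P + 1) * (?B + 1) + 1"
      by (simp add: algebra_simps)
    have "runs find \<sigma> ((potential n M k s P + 1) * (?B + 1) + 1) \<sigma>'"
      unfolding find_def by (rule runs_WhileT[OF _ b(2) r(2)[unfolded find_def] t]) (use q0 in auto)
    moreover have "q' = 1 \<and> solves n M s' P' \<and> code ?L s P \<le> code ?L s' P' \<and>
       (\<forall>c\<in>sol_codes n M k. code ?L s P \<le> c \<longrightarrow> code ?L s' P' \<le> c) \<or>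
       q' = 2 \<and> (\<forall>c\<in>sol_codes n M k. c < code ?L s P)"
      using r(3) le skip by (meson le_trans not_le)
    ultimately show ?thesis using r(1) by blast
  qed
  show ?case
  proof (cases "feasible n M P s")
    case True
    show ?thesis
    proof (cases "length P = ?L")
      case full: True
      obtain Q where Q: "solves n M s Q" "take (length P) Q = P"
        using feasible_imp_extends[OF M P(1,2) True] by blast
      then have "solves n M s P" using full by (simp add: solves_def digits_def)
      then show ?thesis using b(1,3) stop True full by (intro exI[of _ \<sigma>1] exI[of _ s] exI[of _ P] exI[of _ 1]) auto
    next
      case part: False
      have e: "s1 = s" "P1 = P @ [1]" "q1 = 0" using b(3) True part by auto
      have "?L - length P = Suc (?L - Suc (length P))" using part P(1) by simp
      \<comment> \<open>The letter 1 is the digit 0, so descending does not change the code.\<close>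
      then have "code ?L s P = code ?L s (P @ [1])" by (simp add: code_def)
      then show ?thesis using potential_push[OF M True _ P(2), of k] part P(1) e by (intro go) auto
    qed
  next
    case False
    note skip = infeasible_skips[OF M False P(1,2)]
    show ?thesis
    proof (cases "next_prefix P")
      case (Some P2)
      have e: "s1 = s" "P1 = P2" "q1 = 0" using b(3) False Some by auto
      show ?thesis
        using potential_next[OF False P(1,2) Some, of k] next_prefix_Some(4)[OF Some P(2,1), of s] skip e
        by (intro go) auto
    next
      case None
      note nc = next_prefix_None[OF None P(1), of s]
      show ?thesis
      proof (cases "s = k")
        case True
        have e: "q1 = 2" "P1 = []" using b(3) False None True by auto
        \<comment> \<open>The skipped interval ends where size \<open>k + 1\<close> would begin, and
          every solution code lies below that point.\<close>
        have "c < code ?L s P" if c: "c \<in> sol_codes n M k" for c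
        proof (rule ccontr)
          assume "\<not> c < code ?L s P"
          then have 1: "code ?L (Suc k) [] \<le> c" using skip[OF c] nc True by simp
          obtain s' Q where Q: "c = code ?L s' Q" "s' \<le> k" "solves n M s' Q" using c by (auto simp: sol_codes_def)
          have "c < code ?L (Suc s') []"
            using Q dval_less[of Q] by (simp add: code_def solves_def digits_def)
          also have "\<dots> \<le> code ?L (Suc k) []" using Q(2) by (simp add: code_def)
          finally show False using 1 by simp
        qed
        then show ?thesis using b(1) stop e by auto
      next
        case ns: False
        have e: "s1 = Suc s" "P1 = []" "q1 = 0" using b(3) False None ns by auto
        show ?thesis
          using potential_next_size[OF False P(2) None, of k] nc skip e ns P(3) by (intro go) auto
      qed
    qed
  qed
qed

text \<open>The interval of a complete assignment has length 1, so moving on from it raises the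
  threshold by just one.\<close>

lemma runs_leave:
  assumes M: "matrix n M" and inv: "main_inv M k s P 1 w \<sigma>" and P: "solves n M s P"
  shows "\<exists>\<sigma>' s' P' q'. main_inv M k s' P' q' w \<sigma>' \<and> runs leave \<sigma> (8 * length M + 4 * k + 60) \<sigma>' \<and>
    (q' = 0 \<and> code (length M) s' P' = Suc (code (length M) s P) \<or>
     q' = 2 \<and> (\<forall>c\<in>sol_codes n M k. c \<le> code (length M) s P))"
proof -
  let ?L = "length M"
  have l: "length P = ?L" "set P \<subseteq> {1, 2, 3}" using P by (auto simp: solves_def digits_def)
  have 1: "runs (put 15 0) \<sigma> 1 (\<sigma>(15 := reg 0))" (is "runs _ _ _ ?\<sigma>1")
    by (rule runs_put) (use inv in \<open>auto simp: main_inv_def\<close>)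
  have inv1: "main_inv M k s P 0 w ?\<sigma>1" using inv unfolding main_inv_def by auto
  have 2: "runs walk ?\<sigma>1 (2 * ?L + 1) (?\<sigma>1(3 := tp M (Suc (length P)), 4 := tp P (Suc (length P))))"
    by (rule runs_walk) (use inv1 l in \<open>auto simp: main_inv_def\<close>)
  obtain \<sigma>' s' P' q' where r: "main_inv M k s' P' q' w \<sigma>'"
      "runs (incr_prefix ;; rewind 3 ;; rewind 4) (?\<sigma>1(3 := tp M (Suc (length P)), 4 := tp P (Suc (length P))))
        (2 * ?L + 4 * k + 30 + (2 * ?L + 5 + (2 * ?L + 5) + 1) + 1) \<sigma>'"
      "case next_prefix P of Some P2 \<Rightarrow> s' = s \<and> P' = P2 \<and> q' = 0
       | None \<Rightarrow> P' = [] \<and> (if s = k then q' = 2 else s' = Suc s \<and> q' = 0)"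
    using runs_incr_rewind[OF inv1 M order_refl] by blast
  have 3: "runs leave \<sigma> (8 * ?L + 4 * k + 60) \<sigma>'"
    unfolding leave_def by (rule runs_Seq[OF 1 runs_Seq[OF 2 r(2) order_refl]]) simp
  have "q' = 0 \<and> code ?L s' P' = Suc (code ?L s P) \<or> q' = 2 \<and> (\<forall>c\<in>sol_codes n M k. c \<le> code ?L s P)"
  proof (cases "next_prefix P")
    case (Some P2)
    then show ?thesis using r(3) next_prefix_Some(4)[OF Some l(2), of ?L s] l(1) by simp
  next
    case None
    note nc = next_prefix_None[OF None, of ?L s]
    show ?thesis
    proof (cases "s = k")
      case True
      have "c \<le> code ?L s P" if c: "c \<in> sol_codes n M k" for c
      proof -
        obtain s' Q where Q: "c = code ?L s' Q" "s' \<le> k" "solves n M s' Q" using c by (auto simp: sol_codes_def)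
        have "c < code ?L (Suc s') []"
          using Q dval_less[of Q] by (simp add: code_def solves_def digits_def)
        also have "\<dots> \<le> code ?L (Suc k) []" using Q(2) by (simp add: code_def)
        finally show ?thesis using nc l(1) True by simp
      qed
      then show ?thesis using r(3) None True by simp
    next
      case False
      then show ?thesis using r(3) None nc l(1) by simp
    qed
  qed
  then show ?thesis using r(1) 3 by blast
qed

section \<open>Writing a solution\<close>

text \<open>The output word is read from cell 0 on, which leaves no room for an end marker on tape
  16. The head of tape 12 moves in step with the output head and finds the marker in its
  place.\<close>

definition clear_out :: cmd where
  "clear_out = While (\<lambda>r. r 12 \<noteq> 7) (Act (\<lambda>r. [(16, Some 0, MoveL), (12, None, MoveL)])) ;; put 16 0"

lemma runs_clear_out:
  assumes "\<sigma> 12 = tp [] (length w)" "\<sigma> 16 = tq w (length w)" "2 * length w + 3 \<le> T"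
  shows "runs clear_out \<sigma> T (\<sigma>(12 := tp [] 0, 16 := tq [] 0))"
proof -
  \<comment> \<open>A cell is erased only after the head has moved onto it, so after
    \<open>t\<close> rounds the cell under the head is still intact. The one left at the end, cell
    0, is erased by the final \<open>put\<close>.\<close>
  let ?f = "\<lambda>t. \<sigma>(12 := tp [] (length w - t), 16 := tq (take (Suc (length w - t)) w) (length w - t))"
  have 1: "runs (While (\<lambda>r. r 12 \<noteq> 7) (Act (\<lambda>r. [(16, Some 0, MoveL), (12, None, MoveL)]))) \<sigma> (2 * length w + 1) (?f (length w))"
  proof (rule runs_While_index[where f = ?f and N = "length w" and C = 1])
    fix t assume t: "t < length w"
    show "rd (?f t) 12 \<noteq> 7" using t rdt_tp_ne7[of "[]" "length w - t"] by simp
    have "wrt 0 (tq (take (Suc (length w - t)) w) (length w - t)) = tq (take (length w - t) w) (length w - t)"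
    proof (cases "t = 0")
      case False
      then have "take (Suc (length w - t)) w = take (length w - t) w @ [w ! (length w - t)]"
        using t by (intro take_Suc_conv_app_nth) simp
      then show ?thesis by (simp add: wrt_tq_erase)
    qed (simp add: wrt_tq_blank)
    moreover have "length w - t = Suc (length w - Suc t)" using t by simp
    ultimately show "runs (Act (\<lambda>r. [(16, Some 0, MoveL), (12, None, MoveL)])) (?f t) 1 (?f (Suc t))"
      by (intro runs_Act) (auto simp: fun_eq_iff)
  qed (use assms in \<open>auto simp: fun_eq_iff\<close>)
  have "wrt 0 (tq (take (Suc 0) w) 0) = tq [] 0"
    by (cases w) (use wrt_tq_erase[of "[]" 0] wrt_tq_blank[of "[]" 0] in simp_all)
  then have 2: "runs (put 16 0) (?f (length w)) 1 (\<sigma>(12 := tp [] 0, 16 := tq [] 0))"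
    by (intro runs_put) (auto simp: fun_eq_iff)
  show ?thesis unfolding clear_out_def by (rule runs_Seq[OF 1 2]) (use assms in simp)
qed

text \<open>Binary counters are kept with the least significant digit first.\<close>

fun bin_succ :: "nat list \<Rightarrow> nat list" where
  "bin_succ [] = [2]"
| "bin_succ (x # xs) = (if x = 2 then 1 # bin_succ xs else 2 # xs)"

lemma rev_bin_Suc: "rev (bin (Suc n)) = bin_succ (rev (bin n))"
proof (induction n rule: less_induct)
  case (less n)
  consider "n = 0" | "n = 1" | "n \<ge> 2" "even n" | "n \<ge> 2" "odd n" by linarith
  then show ?case
  proof cases
    case 1
    then show ?thesis by (simp add: bin.simps)
  next
    case 2
    then show ?thesis by (simp add: bin.simps[of "Suc (Suc 0)"] bin.simps[of "Suc 0"])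
  next
    case 3
    then have "n mod 2 = 0" "Suc n mod 2 = 1" "Suc n div 2 = n div 2" by presburger+
    then have "bin n = bin (n div 2) @ [1]" "bin (Suc n) = bin (n div 2) @ [2]"
      using 3(1) by (simp_all add: bin.simps[of n] bin.simps[of "Suc n"])
    then show ?thesis by simp
  next
    case 4
    then have "n mod 2 = 1" "Suc n mod 2 = 0" "Suc n div 2 = Suc (n div 2)" by presburger+
    then have "bin n = bin (n div 2) @ [2]" "bin (Suc n) = bin (Suc (n div 2)) @ [1]"
      using 4(1) by (simp_all add: bin.simps[of n] bin.simps[of "Suc n"])
    then show ?thesis using less[of "n div 2"] 4 by simp
  qed
qed

lemma bin_succ_trailing: "ys = [] \<or> hd ys \<noteq> 2 \<Longrightarrow> bin_succ (replicate k 2 @ ys) = replicate k 1 @ 2 # tl ys"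
  by (induction k) (cases ys; simp)+

lemma length_bin: "length (bin n) \<le> n + 1"
proof (induction n rule: less_induct)
  case (less n)
  show ?case
  proof (cases "n < 2")
    case False
    then have "length (bin n) = length (bin (n div 2)) + 1" by (subst bin.simps) simp
    also have "length (bin (n div 2)) \<le> n div 2 + 1" using less[of "n div 2"] False by simp
    also have "n div 2 + 1 \<le> n" using False by simp
    finally show ?thesis by simp
  qed (subst bin.simps, simp)
qed

definition incr_bin :: "nat \<Rightarrow> cmd" where
  "incr_bin i = While (\<lambda>r. r i = 2) (Act (\<lambda>r. [(i, Some 1, MoveR)])) ;; put i 2 ;; rewind i"

lemma runs_incr_bin:
  assumes "\<sigma> i = tp (rev (bin v)) 1" "4 * v + 20 \<le> T"
  shows "runs (incr_bin i) \<sigma> T (\<sigma>(i := tp (rev (bin (Suc v))) 1))"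
proof -
  let ?x = "rev (bin v)"
  define k where "k = length (takeWhile (\<lambda>x. x = 2) ?x)"
  define ys where "ys = dropWhile (\<lambda>x. x = 2) ?x"
  have "takeWhile (\<lambda>x. x = 2) ?x = replicate k 2"
    unfolding k_def by (metis (mono_tags, lifting) replicate_length_same set_takeWhileD)
  then have x: "?x = replicate k 2 @ ys" unfolding ys_def by (metis takeWhile_dropWhile_id)
  have ys: "ys = [] \<or> hd ys \<noteq> 2" unfolding ys_def by (metis (full_types) hd_dropWhile)
  have kl: "k + length ys \<le> v + 1" using length_bin[of v] x by (metis length_append length_replicate length_rev)
  have s: "rev (bin (Suc v)) = replicate k 1 @ 2 # tl ys" using x ys bin_succ_trailing by (metis rev_bin_Suc)
  let ?f = "\<lambda>t. \<sigma>(i := tp (replicate t 1 @ replicate (k - t) 2 @ ys) (Suc t))"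
  have 1: "runs (While (\<lambda>r. r i = 2) (Act (\<lambda>r. [(i, Some 1, MoveR)]))) \<sigma> (2 * k + 1) (?f k)"
  proof (rule runs_While_index[where f = ?f and N = k and C = 1])
    fix t assume t: "t < k"
    then have e: "k - t = Suc (k - Suc t)" by simp
    show "rd (?f t) i = 2" unfolding e by (simp add: nth_append)
    have "wrt 1 (tp (replicate t 1 @ replicate (k - t) 2 @ ys) (Suc t)) =
        tp (replicate (Suc t) 1 @ replicate (k - Suc t) 2 @ ys) (Suc t)"
      unfolding e by (subst wrt_tp_update) (simp_all add: list_update_append replicate_app_Cons_same)
    then show "runs (Act (\<lambda>r. [(i, Some 1, MoveR)])) (?f t) 1 (?f (Suc t))"
      by (intro runs_Act) (simp_all add: fun_eq_iff)
  next
    show "\<not> rd (?f k) i = 2" using ys by (cases ys) (simp_all add: nth_append)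
  qed (use assms x in auto)
  have "wrt 2 (tp (replicate k 1 @ ys) (Suc k)) = tp (rev (bin (Suc v))) (Suc k)"
    unfolding s by (cases ys) (simp_all add: wrt_tp_append wrt_tp_update list_update_append)
  then have 2: "runs (put i 2) (?f k) 1 (\<sigma>(i := tp (rev (bin (Suc v))) (Suc k)))"
    by (intro runs_put) simp_all
  have b7: "7 \<notin> set (rev (bin (Suc v)))" using set_bin[of "Suc v"] by auto
  have 3: "runs (rewind i) (\<sigma>(i := tp (rev (bin (Suc v))) (Suc k))) (2 * k + 5) (\<sigma>(i := tp (rev (bin (Suc v))) 1))"
    using runs_rewind[of "\<sigma>(i := tp (rev (bin (Suc v))) (Suc k))" i _ "Suc k" "2 * k + 5"] b7 by simp
  show ?thesis unfolding incr_bin_def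
    by (rule runs_Seq[OF 1 runs_Seq[OF 2 3 order_refl]]) (use assms kl in simp)
qed

definition emit_sym :: "nat \<Rightarrow> cmd" where
  "emit_sym x = Act (\<lambda>r. [(16, Some x, MoveR), (12, None, MoveR)])"

definition print_bin :: "nat \<Rightarrow> cmd" where
  "print_bin i = to_end i ;; mvL i ;;
     While (\<lambda>r. r i \<noteq> 7) (Act (\<lambda>r. [(16, Some (r i), MoveR), (12, None, MoveR), (i, None, MoveL)])) ;; mvR i"

definition with_out :: "nat list \<Rightarrow> store \<Rightarrow> store" where
  "with_out w \<sigma> = \<sigma>(12 := tp [] (length w), 16 := tq w (length w))"

lemma runs_emit_sym:
  "x \<noteq> 0 \<Longrightarrow> 1 \<le> T \<Longrightarrow> runs (emit_sym x) (with_out w \<sigma>) T (with_out (w @ [x]) \<sigma>)"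
  unfolding emit_sym_def by (rule runs_Act) (auto simp: with_out_def wrt_tq_append fun_eq_iff)

lemma runs_print_bin:
  assumes i: "i \<noteq> 12" "i \<noteq> 16" and \<sigma>: "\<sigma> i = tp (rev (bin v)) 1" and T: "4 * v + 20 \<le> T"
  shows "runs (print_bin i) (with_out w \<sigma>) T (with_out (w @ bin v) \<sigma>)"
proof -
  let ?x = "rev (bin v)" and ?l = "length (bin v)"
  have b: "7 \<notin> set ?x" "0 \<notin> set ?x" using set_bin[of v] by auto
  let ?\<sigma> = "with_out w \<sigma>"
  have \<sigma>i: "?\<sigma> i = tp ?x 1" using i \<sigma> by (simp add: with_out_def)
  have 1: "runs (to_end i) ?\<sigma> (2 * ?l + 1) (?\<sigma>(i := tp ?x (Suc ?l)))"
    using runs_to_end[of ?\<sigma> i ?x 0 "2 * ?l + 1"] \<sigma>i b by simp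
  have 2: "runs (mvL i) (?\<sigma>(i := tp ?x (Suc ?l))) 1 (?\<sigma>(i := tp ?x ?l))"
    by (rule runs_mvL) auto
  let ?f = "\<lambda>t. (with_out (w @ take t (bin v)) \<sigma>)(i := tp ?x (?l - t))"
  have 3: "runs (While (\<lambda>r. r i \<noteq> 7) (Act (\<lambda>r. [(16, Some (r i), MoveR), (12, None, MoveR), (i, None, MoveL)])))
     (?\<sigma>(i := tp ?x ?l)) (2 * ?l + 1) (?f ?l)"
  proof (rule runs_While_index[where f = ?f and N = ?l and C = 1])
    fix t assume t: "t < ?l"
    then have e: "?l - t = Suc (?l - Suc t)" by simp
    have x: "?x ! (?l - Suc t) = bin v ! t" using t by (simp add: rev_nth)
    have "?l - Suc t < ?l" using t by simp
    then have r: "rd (?f t) i = bin v ! t" using x unfolding e by simp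
    have nz: "bin v ! t \<noteq> 0" "bin v ! t \<noteq> 7" using set_bin[of v] nth_mem[OF t] by auto
    show "rd (?f t) i \<noteq> 7" unfolding r using nz by simp
    have tk: "take (Suc t) (bin v) = take t (bin v) @ [bin v ! t]" using t by (rule take_Suc_conv_app_nth)
    show "runs (Act (\<lambda>r. [(16, Some (r i), MoveR), (12, None, MoveR), (i, None, MoveL)])) (?f t) 1 (?f (Suc t))"
      by (rule runs_Act) (unfold r tk, use i t nz wrt_tq_append[of "bin v ! t" "w @ take t (bin v)"] in
          \<open>auto simp: with_out_def fun_eq_iff\<close>)
  qed auto
  have 4: "runs (mvR i) (?f ?l) 1 (with_out (w @ bin v) \<sigma>)"
    by (rule runs_mvR) (use i \<sigma> in \<open>auto simp: with_out_def fun_eq_iff\<close>)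
  show ?thesis unfolding print_bin_def
    by (rule runs_Seq[OF 1 runs_Seq[OF 2 runs_Seq[OF 3 4 order_refl] order_refl]]) (use T length_bin[of v] in simp)
qed

definition emit_cell :: cmd where
  "emit_cell = Cond (\<lambda>r. r 4 = 1) skip
     (Cond (\<lambda>r. r 4 = 2) (emit_sym 4) (emit_sym 5) ;; print_bin 10 ;; emit_sym 3 ;; print_bin 11 ;; emit_sym 3)"

definition emit_step :: cmd where
  "emit_step = Cond (\<lambda>r. r 3 = 3) (incr_bin 10 ;; clear 11 ;; put 11 1) (emit_cell ;; incr_bin 11) ;;
     Act (\<lambda>r. [(3, None, MoveR), (4, None, MoveR)])"

definition emit :: cmd where
  "emit = put 10 1 ;; put 11 1 ;; While (\<lambda>r. r 3 \<noteq> 0) emit_step ;; clear 10 ;; clear 11 ;; rewind 3 ;; rewind 4"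

definition enc_cell :: "nat \<Rightarrow> nat list \<Rightarrow> nat \<Rightarrow> nat list" where
  "enc_cell n P j = (if P ! j = 1 then [] else
     [if P ! j = 2 then 4 else 5] @ bin (j div (n + 1)) @ [3] @ bin (j mod (n + 1)) @ [3])"

definition enc_sol :: "nat \<Rightarrow> nat list \<Rightarrow> nat list" where
  "enc_sol n P = concat (map (enc_cell n P) [0..<length P])"

lemma runs_emit_cell:
  assumes \<sigma>: "\<sigma> 4 = tp P (Suc j)" "\<sigma> 10 = tp (rev (bin u)) 1" "\<sigma> 11 = tp (rev (bin v)) 1"
    and j: "j < length P" "u = j div (n + 1)" "v = j mod (n + 1)" and T: "4 * u + 4 * v + 60 \<le> T"
  shows "runs emit_cell (with_out w \<sigma>) T (with_out (w @ enc_cell n P j) \<sigma>)"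
proof -
  have r: "rd (with_out w \<sigma>) 4 = P ! j" using \<sigma> j by (simp add: with_out_def)
  show ?thesis
  proof (cases "P ! j = 1")
    case True
    then have "enc_cell n P j = []" by (simp add: enc_cell_def)
    moreover have "runs emit_cell (with_out w \<sigma>) T (with_out w \<sigma>)" unfolding emit_cell_def
      by (rule runs_CondT[OF _ runs_skip[OF order_refl]]) (use r True T in auto)
    ultimately show ?thesis by simp
  next
    case False
    let ?m = "if P ! j = 2 then 4 else 5"
    have 1: "runs (Cond (\<lambda>r. r 4 = 2) (emit_sym 4) (emit_sym 5)) (with_out w \<sigma>) 2 (with_out (w @ [?m]) \<sigma>)"
    proof (cases "P ! j = 2")
      case True
      show ?thesis unfolding if_P[OF True]
        by (rule runs_CondT[OF _ runs_emit_sym[OF _ order_refl]]) (use r True in auto)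
    next
      case False
      show ?thesis unfolding if_not_P[OF False]
        by (rule runs_CondF[OF _ runs_emit_sym[OF _ order_refl]]) (use r False in auto)
    qed
    have 2: "runs (print_bin 10) (with_out w \<sigma>) (4 * u + 20) (with_out (w @ bin u) \<sigma>)" for w
      by (rule runs_print_bin) (use \<sigma> in auto)
    have 3: "runs (print_bin 11) (with_out w \<sigma>) (4 * v + 20) (with_out (w @ bin v) \<sigma>)" for w
      by (rule runs_print_bin) (use \<sigma> in auto)
    have 4: "runs (emit_sym 3) (with_out w \<sigma>) 1 (with_out (w @ [3]) \<sigma>)" for w
      by (rule runs_emit_sym) auto
    have "runs emit_cell (with_out w \<sigma>) T (with_out (((((w @ [?m]) @ bin u) @ [3]) @ bin v) @ [3]) \<sigma>)"
      unfolding emit_cell_def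
      by (rule runs_CondF[OF _ runs_Seq[OF 1 runs_Seq[OF 2 runs_Seq[OF 4 runs_Seq[OF 3 4 order_refl] order_refl] order_refl] order_refl]])
        (use r False T in auto)
    moreover have "((((w @ [?m]) @ bin u) @ [3]) @ bin v) @ [3] = w @ enc_cell n P j"
      using False j by (simp add: enc_cell_def)
    ultimately show ?thesis by simp
  qed
qed

definition emit_state :: "nat \<Rightarrow> nat list \<Rightarrow> nat list \<Rightarrow> store \<Rightarrow> nat \<Rightarrow> store" where
  "emit_state n M P \<sigma> j = with_out (concat (map (enc_cell n P) [0..<j]))
     (\<sigma>(3 := tp M (Suc j), 4 := tp P (Suc j), 10 := tp (rev (bin (j div (n + 1)))) 1, 11 := tp (rev (bin (j mod (n + 1)))) 1))"

lemma runs_emit_step: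
  assumes M: "matrix n M" and P: "length P = length M" "forced M P" and j: "j < length M" and T: "12 * length M + 120 \<le> T"
  shows "runs emit_step (emit_state n M P \<sigma> j) T (emit_state n M P \<sigma> (Suc j))"
proof -
  let ?L = "length M" and ?u = "j div (n + 1)" and ?v = "j mod (n + 1)"
  let ?w = "\<lambda>j. concat (map (enc_cell n P) [0..<j])"
  have sh: "shape n M" using M by (simp add: matrix_def)
  have L: "?L = n * (n + 1)" using shapeD(1)[OF sh] .
  have n: "0 < n" using j L by (cases n) auto
  have u: "?u < n" using j L by (simp add: less_mult_imp_div_less)
  have v: "?v \<le> n" by (simp add: less_Suc_eq_le[symmetric])
  have nL: "n \<le> ?L" using L by simp
  have 3: "M ! j = 3 \<longleftrightarrow> ?v = n" using sh j by (simp add: shape_def)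
  let ?\<sigma> = "emit_state n M P \<sigma> j"
  let ?\<sigma>j = "\<sigma>(3 := tp M (Suc j), 4 := tp P (Suc j), 10 := tp (rev (bin ?u)) 1, 11 := tp (rev (bin ?v)) 1)"
  have r: "rd ?\<sigma> 3 = M ! j" using j by (simp add: emit_state_def with_out_def)
  have ws: "?w (Suc j) = ?w j @ enc_cell n P j" by simp
  have mv: "runs (Act (\<lambda>r. [(3, None, MoveR), (4, None, MoveR)])) (with_out (?w (Suc j))
      (\<sigma>(3 := tp M (Suc j), 4 := tp P (Suc j), 10 := tp (rev (bin (Suc j div (n + 1)))) 1, 11 := tp (rev (bin (Suc j mod (n + 1)))) 1))) 1
      (emit_state n M P \<sigma> (Suc j))"
    by (rule runs_Act) (auto simp: emit_state_def with_out_def fun_eq_iff)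
  show ?thesis
  proof (cases "?v = n")
    case True
    have su: "Suc j div (n + 1) = Suc ?u" "Suc j mod (n + 1) = 0" using True by (simp_all add: div_Suc mod_Suc)
    \<comment> \<open>A separator is not a pair, so it carries the letter 1 and contributes nothing
      to the output.\<close>
    have "P ! j = 1" using P j 3 True unfolding forced_def by auto
    then have w: "?w (Suc j) = ?w j" unfolding ws by (simp add: enc_cell_def)
    have 1: "runs (incr_bin 10) ?\<sigma> (4 * ?L + 20) (?\<sigma>(10 := tp (rev (bin (Suc ?u))) 1))" (is "runs _ _ _ ?\<sigma>1")
      by (rule runs_incr_bin) (use u nL in \<open>auto simp: emit_state_def with_out_def\<close>)
    have b: "0 \<notin> set (rev (bin ?v))" "7 \<notin> set (rev (bin ?v))" using set_bin[of ?v] by auto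
    have lb: "length (bin ?v) \<le> ?L + 1" using length_bin[of ?v] v nL by linarith
    have 2: "runs (clear 11) ?\<sigma>1 (4 * ?L + 11) (?\<sigma>1(11 := tp [] 1))"
      by (rule runs_clear[where p = 0 and h = "rev (bin ?v)"])
        (use b lb in \<open>auto simp: emit_state_def with_out_def\<close>)
    have 3: "runs (put 11 1) (?\<sigma>1(11 := tp [] 1)) 1 (?\<sigma>1(11 := tp [1] 1))"
      by (rule runs_put) (auto simp: wrt_tp_append)
    have b0: "rev (bin 0) = [1]" by (simp add: bin.simps)
    have e: "?\<sigma>1(11 := tp [1] 1) = with_out (?w (Suc j))
      (\<sigma>(3 := tp M (Suc j), 4 := tp P (Suc j), 10 := tp (rev (bin (Suc j div (n + 1)))) 1, 11 := tp (rev (bin (Suc j mod (n + 1)))) 1))"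
      unfolding w su b0 by (auto simp: emit_state_def with_out_def fun_eq_iff)
    have "runs (Cond (\<lambda>r. r 3 = 3) (incr_bin 10 ;; clear 11 ;; put 11 1) (emit_cell ;; incr_bin 11)) ?\<sigma> (8 * ?L + 40) (?\<sigma>1(11 := tp [1] 1))"
      by (rule runs_CondT[OF _ runs_Seq[OF 1 runs_Seq[OF 2 3 order_refl] order_refl]])
        (use r \<open>M ! j = 3 \<longleftrightarrow> ?v = n\<close> True in auto)
    from runs_Seq[OF this[unfolded e] mv, of T] show ?thesis unfolding emit_step_def using T by simp
  next
    case False
    then have su: "Suc j div (n + 1) = ?u" "Suc j mod (n + 1) = Suc ?v" using v by (simp_all add: div_Suc mod_Suc)
    have uv: "4 * ?u + 4 * ?v + 60 \<le> 4 * ?L + 4 * ?L + 60" using u v nL by linarith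
    have 1: "runs emit_cell ?\<sigma> (4 * ?L + 4 * ?L + 60) (with_out (?w (Suc j)) ?\<sigma>j)"
      unfolding ws emit_state_def
      by (rule runs_emit_cell[where u = ?u and v = ?v]) (use j P uv in auto)
    have 2: "runs (incr_bin 11) (with_out (?w (Suc j)) ?\<sigma>j) (4 * n + 20) ((with_out (?w (Suc j)) ?\<sigma>j)(11 := tp (rev (bin (Suc ?v))) 1))"
      by (rule runs_incr_bin) (use v in \<open>auto simp: with_out_def\<close>)
    have e: "(with_out (?w (Suc j)) ?\<sigma>j)(11 := tp (rev (bin (Suc ?v))) 1) = with_out (?w (Suc j))
      (\<sigma>(3 := tp M (Suc j), 4 := tp P (Suc j), 10 := tp (rev (bin (Suc j div (n + 1)))) 1, 11 := tp (rev (bin (Suc j mod (n + 1)))) 1))"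
      unfolding su by (auto simp: with_out_def fun_eq_iff)
    have "runs (Cond (\<lambda>r. r 3 = 3) (incr_bin 10 ;; clear 11 ;; put 11 1) (emit_cell ;; incr_bin 11)) ?\<sigma> (8 * ?L + 4 * n + 90)
       ((with_out (?w (Suc j)) ?\<sigma>j)(11 := tp (rev (bin (Suc ?v))) 1))"
      by (rule runs_CondF[OF _ runs_Seq[OF 1 2 order_refl]]) (use r 3 False in auto)
    from runs_Seq[OF this[unfolded e] mv, of T] show ?thesis unfolding emit_step_def using T nL by simp
  qed
qed

definition emit_time :: "nat \<Rightarrow> nat" where
  "emit_time l = l * (12 * l + 121) + 14 * l + 60"

lemma runs_emit:
  assumes M: "matrix n M" and inv: "main_inv M k s P q [] \<sigma>" and P: "length P = length M" "forced M P"
  shows "\<exists>\<sigma>'. runs emit \<sigma> (emit_time (length M)) \<sigma>' \<and> main_inv M k s P q (enc_sol n P) \<sigma>'"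
proof -
  let ?L = "length M"
  have sh: "shape n M" using M by (simp add: matrix_def)
  have L: "?L = n * (n + 1)" using shapeD(1)[OF sh] .
  have P3: "set P \<subseteq> {1, 2, 3}" using inv by (simp add: main_inv_def)
  have b0: "rev (bin 0) = [1]" by (simp add: bin.simps)
  have 1: "runs (put 10 1) \<sigma> 1 (\<sigma>(10 := tp [1] 1))"
    by (rule runs_put) (use inv in \<open>auto simp: main_inv_def wrt_tp_append\<close>)
  have 2: "runs (put 11 1) (\<sigma>(10 := tp [1] 1)) 1 (emit_state n M P \<sigma> 0)"
    by (rule runs_put) (use inv b0 in \<open>auto simp: main_inv_def wrt_tp_append emit_state_def with_out_def fun_eq_iff\<close>)
  have 3: "runs (While (\<lambda>r. r 3 \<noteq> 0) emit_step) (emit_state n M P \<sigma> 0) (?L * (12 * ?L + 121) + 1) (emit_state n M P \<sigma> ?L)"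
  proof (rule runs_While_index[where f = "emit_state n M P \<sigma>" and N = ?L and C = "12 * ?L + 120"])
    fix j assume j: "j < ?L"
    show "rd (emit_state n M P \<sigma> j) 3 \<noteq> 0" using j shapeD(6)[OF sh j] by (simp add: emit_state_def with_out_def)
    show "runs emit_step (emit_state n M P \<sigma> j) (12 * ?L + 120) (emit_state n M P \<sigma> (Suc j))"
      by (rule runs_emit_step[OF M P j order_refl])
  qed (auto simp: emit_state_def with_out_def)
  let ?\<sigma>1 = "emit_state n M P \<sigma> ?L"
  have d: "?L div (n + 1) = n" "?L mod (n + 1) = 0" unfolding L by (simp_all only: nonzero_mult_div_cancel_right mod_mult_self2_is_0)
  have nL: "n \<le> ?L" using L by simp
  have b: "0 \<notin> set (rev (bin v))" "7 \<notin> set (rev (bin v))" for v using set_bin[of v] by auto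
  have \<sigma>1: "?\<sigma>1 10 = tp (rev (bin n)) 1" "?\<sigma>1 11 = tp [1] 1" "?\<sigma>1 3 = tp M (Suc ?L)" "?\<sigma>1 4 = tp P (Suc ?L)"
    unfolding emit_state_def d b0 by (simp_all add: with_out_def)
  have 4: "runs (clear 10) ?\<sigma>1 (4 * ?L + 11) (?\<sigma>1(10 := tp [] 1))"
    by (rule runs_clear[where p = 0 and h = "rev (bin n)"]) (use \<sigma>1 b length_bin[of n] nL in auto)
  have 5: "runs (clear 11) (?\<sigma>1(10 := tp [] 1)) 11 (?\<sigma>1(10 := tp [] 1, 11 := tp [] 1))"
    by (rule runs_clear[where p = 0 and h = "[1]"]) (use \<sigma>1 in auto)
  have 6: "runs (rewind 3) (?\<sigma>1(10 := tp [] 1, 11 := tp [] 1)) (2 * ?L + 5) (?\<sigma>1(10 := tp [] 1, 11 := tp [] 1, 3 := tp M 1))"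
    by (rule runs_rewind[where p = "Suc ?L"]) (use \<sigma>1 shapeD(2)[OF sh] in auto)
  have 7: "runs (rewind 4) (?\<sigma>1(10 := tp [] 1, 11 := tp [] 1, 3 := tp M 1)) (2 * ?L + 5)
     (?\<sigma>1(10 := tp [] 1, 11 := tp [] 1, 3 := tp M 1, 4 := tp P 1))"
    by (rule runs_rewind[where p = "Suc ?L"]) (use \<sigma>1 P3 in auto)
  define \<sigma>' where "\<sigma>' = ?\<sigma>1(10 := tp [] 1, 11 := tp [] 1, 3 := tp M 1, 4 := tp P 1)"
  have "runs emit \<sigma> (emit_time ?L) \<sigma>'"
    unfolding emit_def \<sigma>'_def
    by (rule runs_Seq[OF 1 runs_Seq[OF 2 runs_Seq[OF 3 runs_Seq[OF 4 runs_Seq[OF 5 runs_Seq[OF 6 7 order_refl]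
      order_refl] order_refl] order_refl] order_refl]]) (simp add: emit_time_def)
  moreover have "main_inv M k s P q (enc_sol n P) \<sigma>'"
    using inv unfolding main_inv_def \<sigma>'_def emit_state_def with_out_def enc_sol_def P(1) by auto
  ultimately show ?thesis by blast
qed

definition next_sol :: cmd where
  "next_sol = clear_out ;; leave ;; find ;; Cond (\<lambda>r. r 15 = 1) emit skip"

definition find_time :: "nat \<Rightarrow> nat \<Rightarrow> nat" where
  "find_time l k = ((k + 1) * (6 * l + 10) + 1) * (body_time l k + 1) + 1"

text \<open>\<open>c\<close> is the threshold: the search has stopped at the smallest solution code
  that is at least \<open>c\<close>, with its encoding on the output tape, or it has ended because
  there is none.\<close>

definition found_from :: "nat \<Rightarrow> nat list \<Rightarrow> nat \<Rightarrow> nat \<Rightarrow> store \<Rightarrow> bool" where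
  "found_from n M k c \<sigma> \<longleftrightarrow>
     (\<exists>s P. main_inv M k s P 1 (enc_sol n P) \<sigma> \<and> solves n M s P \<and> c \<le> code (length M) s P \<and>
        (\<forall>c'\<in>sol_codes n M k. c \<le> c' \<longrightarrow> code (length M) s P \<le> c')) \<or>
     \<sigma> 15 = reg 2 \<and> (\<forall>c'\<in>sol_codes n M k. c' < c)"

lemma runs_find_emit:
  assumes M: "matrix n M" and inv: "main_inv M k s P 0 [] \<sigma>"
    and T: "find_time (length M) k + emit_time (length M) + 2 \<le> T"
  shows "\<exists>\<sigma>'. runs (find ;; Cond (\<lambda>r. r 15 = 1) emit skip) \<sigma> T \<sigma>' \<and> found_from n M k (code (length M) s P) \<sigma>'"
proof -
  let ?L = "length M"
  obtain \<sigma>1 s1 P1 q1 where f: "main_inv M k s1 P1 q1 [] \<sigma>1"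
    "runs find \<sigma> ((potential n M k s P + 1) * (body_time ?L k + 1) + 1) \<sigma>1"
    "q1 = 1 \<and> solves n M s1 P1 \<and> code ?L s P \<le> code ?L s1 P1 \<and>
       (\<forall>c\<in>sol_codes n M k. code ?L s P \<le> c \<longrightarrow> code ?L s1 P1 \<le> c) \<or>
     q1 = 2 \<and> (\<forall>c\<in>sol_codes n M k. c < code ?L s P)"
    using runs_find[OF M inv] by blast
  have "potential n M k s P \<le> (k + 1) * (6 * ?L + 10)"
    using inv by (intro potential_le) (auto simp: main_inv_def)
  then have "(potential n M k s P + 1) * (body_time ?L k + 1) + 1 \<le> find_time ?L k"
    unfolding find_time_def by (intro add_mono mult_le_mono1) auto
  then have 1: "runs find \<sigma> (find_time ?L k) \<sigma>1" using f(2) runs_mono by blast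
  have q: "\<sigma>1 15 = reg q1" using f(1) by (simp add: main_inv_def)
  show ?thesis
  proof (cases "q1 = 1")
    case True
    then have s: "length P1 = ?L" "forced M P1" using f(3) by (auto simp: solves_def digits_def)
    obtain \<sigma>2 where 2: "runs emit \<sigma>1 (emit_time ?L) \<sigma>2" "main_inv M k s1 P1 1 (enc_sol n P1) \<sigma>2"
      using runs_emit[OF M f(1)[unfolded True] s] by blast
    have 3: "runs (Cond (\<lambda>r. r 15 = 1) emit skip) \<sigma>1 (emit_time ?L + 1) \<sigma>2"
      by (rule runs_CondT[OF _ 2(1)]) (use q True in auto)
    have "runs (find ;; Cond (\<lambda>r. r 15 = 1) emit skip) \<sigma> T \<sigma>2"
      by (rule runs_Seq[OF 1 3]) (use T in simp)
    then show ?thesis using 2(2) f(3) True unfolding found_from_def by fastforce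
  next
    case False
    have 3: "runs (Cond (\<lambda>r. r 15 = 1) emit skip) \<sigma>1 2 \<sigma>1"
      by (rule runs_CondF[OF _ runs_skip[OF order_refl]]) (use q False in auto)
    have "runs (find ;; Cond (\<lambda>r. r 15 = 1) emit skip) \<sigma> T \<sigma>1"
      by (rule runs_Seq[OF 1 3]) (use T in \<open>simp add: emit_time_def\<close>)
    then show ?thesis using q f(3) False unfolding found_from_def by fastforce
  qed
qed

lemma length_enc_sol:
  assumes "matrix n M" "length P = length M"
  shows "length (enc_sol n P) \<le> length M * (2 * length M + 5)"
proof -
  have L: "length M = n * (n + 1)" using assms(1) by (simp add: matrix_def shape_def)
  have "length (enc_cell n P j) \<le> 2 * length M + 5" if j: "j < length M" for j
  proof -
    have n: "0 < n" using j L by (cases n) auto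
    have "j div (n + 1) < n" using j L by (simp add: less_mult_imp_div_less)
    moreover have "j mod (n + 1) \<le> n" by (simp add: less_Suc_eq_le[symmetric])
    moreover have "n \<le> length M" using L by simp
    ultimately have "length (bin (j div (n + 1))) + length (bin (j mod (n + 1))) \<le> 2 * length M + 2"
      using length_bin[of "j div (n + 1)"] length_bin[of "j mod (n + 1)"] by linarith
    then show ?thesis unfolding enc_cell_def by auto
  qed
  then have "sum_list (map (\<lambda>j. length (enc_cell n P j)) [0..<length M]) \<le> sum_list (map (\<lambda>j. 2 * length M + 5) [0..<length M])"
    by (intro sum_list_mono) simp
  then show ?thesis using assms(2) by (simp add: enc_sol_def length_concat comp_def sum_list_triv)
qed

definition next_time :: "nat \<Rightarrow> nat \<Rightarrow> nat" where
  "next_time l k = find_time l k + emit_time l + 2 * (l * (2 * l + 5)) + 8 * l + 4 * k + 70"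

lemma runs_next_sol:
  assumes M: "matrix n M" and inv: "main_inv M k s P 1 (enc_sol n P) \<sigma>" and P: "solves n M s P"
  shows "\<exists>\<sigma>'. runs next_sol \<sigma> (next_time (length M) k) \<sigma>' \<and> found_from n M k (Suc (code (length M) s P)) \<sigma>'"
proof -
  let ?L = "length M" and ?w = "enc_sol n P"
  have l: "length P = ?L" using P by (simp add: solves_def digits_def)
  note le = length_enc_sol[OF M l]
  have 1: "runs clear_out \<sigma> (2 * (?L * (2 * ?L + 5)) + 3) (\<sigma>(12 := tp [] 0, 16 := tq [] 0))" (is "runs _ _ _ ?\<sigma>1")
    by (rule runs_clear_out[where w = ?w]) (use inv le in \<open>auto simp: main_inv_def\<close>)
  have inv1: "main_inv M k s P 1 [] ?\<sigma>1" using inv unfolding main_inv_def by auto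
  obtain \<sigma>2 s2 P2 q2 where 2: "main_inv M k s2 P2 q2 [] \<sigma>2" "runs leave ?\<sigma>1 (8 * ?L + 4 * k + 60) \<sigma>2"
    "q2 = 0 \<and> code ?L s2 P2 = Suc (code ?L s P) \<or> q2 = 2 \<and> (\<forall>c\<in>sol_codes n M k. c \<le> code ?L s P)"
    using runs_leave[OF M inv1 P] by blast
  have "\<exists>\<sigma>3. runs (find ;; Cond (\<lambda>r. r 15 = 1) emit skip) \<sigma>2 (find_time ?L k + emit_time ?L + 2) \<sigma>3 \<and>
     found_from n M k (Suc (code ?L s P)) \<sigma>3"
  proof (cases "q2 = 0")
    case True
    then show ?thesis using runs_find_emit[OF M 2(1)[unfolded True] order_refl] 2(3) by simp
  next
    case False
    then have q: "\<sigma>2 15 = reg 2" using 2(1,3) by (auto simp: main_inv_def)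
    \<comment> \<open>If the last assignment has been left, the status is already 2 and the loop of
      \<open>find\<close> is not entered.\<close>
    have 3: "runs find \<sigma>2 1 \<sigma>2" unfolding find_def by (rule runs_WhileF) (use q in auto)
    have 4: "runs (Cond (\<lambda>r. r 15 = 1) emit skip) \<sigma>2 2 \<sigma>2"
      by (rule runs_CondF[OF _ runs_skip[OF order_refl]]) (use q in auto)
    have "runs (find ;; Cond (\<lambda>r. r 15 = 1) emit skip) \<sigma>2 (find_time ?L k + emit_time ?L + 2) \<sigma>2"
      by (rule runs_Seq[OF 3 4]) (simp add: emit_time_def)
    then show ?thesis using q 2(3) False unfolding found_from_def by (auto simp: less_Suc_eq_le)
  qed
  then obtain \<sigma>3 where 3: "runs (find ;; Cond (\<lambda>r. r 15 = 1) emit skip) \<sigma>2 (find_time ?L k + emit_time ?L + 2) \<sigma>3"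
     "found_from n M k (Suc (code ?L s P)) \<sigma>3" by blast
  have "runs next_sol \<sigma> (next_time ?L k) \<sigma>3"
    unfolding next_sol_def
    by (rule runs_Seq[OF 1 runs_Seq[OF 2(2) 3(1) order_refl]]) (simp add: next_time_def)
  then show ?thesis using 3(2) by blast
qed

section \<open>Reading the input\<close>

text \<open>The head of tape 12 stays on its marker, since it has to mirror the position of the
  output head, which starts in cell 0.\<close>

definition mark :: cmd where
  "mark = Act (\<lambda>r. [(1, Some 7, MoveR), (2, Some 7, MoveR), (3, Some 7, MoveR), (4, Some 7, MoveR),
     (5, Some 7, MoveR), (6, Some 7, MoveR), (7, Some 7, MoveR), (8, Some 7, MoveR), (9, Some 7, MoveR),
     (10, Some 7, MoveR), (11, Some 7, MoveR), (12, Some 7, Stay), (13, Some 7, MoveR)])"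

lemma blank_eq: "blank = tq [] 0" "blank = reg 0"
  by (simp_all add: blank_def tq_def reg_def)

lemma wrt_7_blank: "wrt 7 blank = tp [] 0"
  using wrt_tq_append[of 7 "[]"] by (simp add: blank_eq(1) tp_def)

lemma init_store_0: "init_store w 0 = tq w 0" and init_store_other: "i \<noteq> 0 \<Longrightarrow> init_store w i = blank"
  by (simp_all add: init_store_def tq_def)

definition marked :: "nat list \<Rightarrow> store" where
  "marked w = (\<lambda>i. if i = 0 then tq w 0 else if i = 12 then tp [] 0 else if i < 14 then tp [] 1 else blank)"

lemma runs_mark: "runs mark (init_store w) 1 (marked w)"
  unfolding mark_def
proof (rule runs_Act)
  have *: "i = 1 \<or> i = 2 \<or> i = 3 \<or> i = 4 \<or> i = 5 \<or> i = 6 \<or> i = 7 \<or> i = 8 \<or> i = 9 \<or> i = 10 \<or> i = 11 \<or> i = 13"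
    if "i < 14" "i \<noteq> 0" "i \<noteq> 12" for i :: nat using that by presburger
  show "marked w = act_store [(1, Some 7, MoveR), (2, Some 7, MoveR), (3, Some 7, MoveR), (4, Some 7, MoveR),
     (5, Some 7, MoveR), (6, Some 7, MoveR), (7, Some 7, MoveR), (8, Some 7, MoveR), (9, Some 7, MoveR),
     (10, Some 7, MoveR), (11, Some 7, MoveR), (12, Some 7, Stay), (13, Some 7, MoveR)] (init_store w)"
    by (rule ext) (auto simp: marked_def init_store_0 init_store_other wrt_7_blank dest: *)
qed simp

definition cell_sym :: "nat \<Rightarrow> nat set set \<Rightarrow> nat \<Rightarrow> nat \<Rightarrow> nat" where
  "cell_sym n E i c = (if c = n then 3 else if c \<le> i then 4 else if {i, c} \<in> E then 2 else 1)"

definition graph_matrix :: "nat \<Rightarrow> nat set set \<Rightarrow> nat list" where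
  "graph_matrix n E = map (\<lambda>p. cell_sym n E (p div (n + 1)) (p mod (n + 1))) [0..<n * (n + 1)]"

lemma matrix_graph: "matrix n (graph_matrix n E)"
proof -
  have "p div (n + 1) < n" if "p < n * (n + 1)" for p using that by (simp add: less_mult_imp_div_less)
  then show ?thesis by (auto simp: matrix_def shape_def graph_matrix_def cell_sym_def)
qed

lemma cell_div_mod: "c < m \<Longrightarrow> (i * m + c) div m = i \<and> (i * m + c) mod m = (c::nat)"
  by auto

lemma concat_rows:
  "concat (map (\<lambda>i. map (f i) [0..<n]) [0..<m]) = map (\<lambda>p. f (p div n) (p mod n)) [0..<m * n]"
proof (induction m)
  case (Suc m)
  have "[0..<Suc m * n] = [0..<m * n] @ map (\<lambda>j. j + m * n) [0..<n]"
    using upt_add_eq_append[of 0 "m * n" n] by (simp add: map_add_upt add.commute)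
  moreover have "map (\<lambda>p. f (p div n) (p mod n)) (map (\<lambda>j. j + m * n) [0..<n]) = map (f m) [0..<n]"
    by (auto simp: comp_def)
  ultimately show ?case using Suc by simp
qed simp

text \<open>In row i tape 13 carries i + 1 ones. A nonblank under its head says that the column is
  at most i, and then the entry is replaced by 4; thus every pair keeps a single cell.\<close>

definition read_cell :: cmd where
  "read_cell = Act (\<lambda>r. (3, Some (if r 13 \<noteq> 0 then 4 else r 0), MoveR) # (0, None, MoveR) # (1, None, MoveR) #
     (if r 13 \<noteq> 0 then [(13, None, MoveR)] else []))"

definition read_row :: cmd where
  "read_row = put 13 1 ;; rewind 13 ;; rewind 1 ;; While (\<lambda>r. r 1 \<noteq> 0) read_cell ;; Act (\<lambda>r. [(3, Some 3, MoveR)])"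

definition read_state :: "nat \<Rightarrow> nat set set \<Rightarrow> nat list \<Rightarrow> nat \<Rightarrow> store \<Rightarrow> nat \<Rightarrow> store" where
  "read_state n E w b \<sigma> i = \<sigma>(0 := tq w (b + i * n), 1 := tp (replicate n 1) (Suc n),
     3 := tp (take (i * (n + 1)) (graph_matrix n E)) (Suc (i * (n + 1))), 13 := tp (replicate i 1) (Suc i))"

lemma runs_read_row:
  assumes i: "i < n" and w: "\<And>i j. i < n \<Longrightarrow> j < n \<Longrightarrow> b + i * n + j < length w \<and> w ! (b + i * n + j) = (if {i, j} \<in> E then 2 else 1)"
    and T: "6 * n + 30 \<le> T"
  shows "runs read_row (read_state n E w b \<sigma> i) T (read_state n E w b \<sigma> (Suc i))"
proof -
  let ?M = "graph_matrix n E" and ?r = "i * (n + 1)"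
  let ?\<sigma> = "read_state n E w b \<sigma> i"
  have 1: "runs (put 13 1) ?\<sigma> 1 (?\<sigma>(13 := tp (replicate (Suc i) 1) (Suc i)))" (is "runs _ _ _ ?\<sigma>1")
    by (rule runs_put) (auto simp: read_state_def wrt_tp_append replicate_append_same)
  have 2: "runs (rewind 13) ?\<sigma>1 (2 * n + 3) (?\<sigma>1(13 := tp (replicate (Suc i) 1) 1))" (is "runs _ _ _ ?\<sigma>2")
    by (rule runs_rewind[where p = "Suc i"]) (use i in auto)
  have 3: "runs (rewind 1) ?\<sigma>2 (2 * n + 5) (?\<sigma>2(1 := tp (replicate n 1) 1))"
    by (rule runs_rewind[where p = "Suc n"]) (auto simp: read_state_def)
  let ?f = "\<lambda>c. \<sigma>(0 := tq w (b + i * n + c), 1 := tp (replicate n 1) (Suc c),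
     3 := tp (take (?r + c) ?M) (Suc (?r + c)), 13 := tp (replicate (Suc i) 1) (Suc (min c (Suc i))))"
  have f0: "?\<sigma>2(1 := tp (replicate n 1) 1) = ?f 0"
    by (auto simp: read_state_def fun_eq_iff)
  have lM: "length ?M = n * (n + 1)" by (simp add: graph_matrix_def)
  have cM: "?r + c < length ?M" "?M ! (?r + c) = cell_sym n E i c" if "c \<le> n" for c
  proof -
    have "(?r + c) div (n + 1) = i" "(?r + c) mod (n + 1) = c"
      using cell_div_mod[of c "n + 1" i] that by simp_all
    then show "?r + c < length ?M" "?M ! (?r + c) = cell_sym n E i c"
      using cell_less[OF i that] by (simp_all only: graph_matrix_def length_map length_upt nth_map nth_upt diff_zero add_0)
  qed
  have wr: "wrt (cell_sym n E i c) (tp (take (?r + c) ?M) (Suc (?r + c))) = tp (take (Suc (?r + c)) ?M) (Suc (?r + c))"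
    if "c \<le> n" for c
  proof -
    have "cell_sym n E i c \<noteq> 0" by (simp add: cell_sym_def)
    then show ?thesis using cM[OF that] by (simp add: wrt_tp_append take_Suc_conv_app_nth)
  qed
  have 4: "runs (While (\<lambda>r. r 1 \<noteq> 0) read_cell) (?f 0) (2 * n + 1) (?f n)"
  proof (rule runs_While_index[where f = ?f and N = n and C = 1])
    fix c assume c: "c < n"
    show "rd (?f c) 1 \<noteq> 0" using c by simp
    have r: "rd (?f c) 13 = (if c \<le> i then 1 else 0)"
      by (auto simp: min_def simp del: replicate_Suc)
    have r0: "rd (?f c) 0 = (if {i, c} \<in> E then 2 else 1)" using w[OF i c] by simp
    have s: "(if rd (?f c) 13 \<noteq> 0 then 4 else rd (?f c) 0) = cell_sym n E i c"
      unfolding r r0 using c by (simp add: cell_sym_def)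
    show "runs read_cell (?f c) 1 (?f (Suc c))"
      unfolding read_cell_def
    proof (rule runs_Act)
      show "?f (Suc c) = act_store ((3, Some (if rd (?f c) 13 \<noteq> 0 then 4 else rd (?f c) 0), MoveR) # (0, None, MoveR) # (1, None, MoveR) #
         (if rd (?f c) 13 \<noteq> 0 then [(13, None, MoveR)] else [])) (?f c)"
        unfolding s unfolding r using wr[of c] c
        by (cases "c \<le> i") (auto simp: fun_eq_iff min_absorb1 min_absorb2 not_less_eq_eq[symmetric])
    qed simp
  qed auto
  have e: "?f n = \<sigma>(0 := tq w (b + Suc i * n), 1 := tp (replicate n 1) (Suc n),
     3 := tp (take (?r + n) ?M) (Suc (?r + n)), 13 := tp (replicate (Suc i) 1) (Suc (Suc i)))" (is "_ = ?\<sigma>3")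
    using i by (simp add: min_absorb2 add.assoc add.commute[of n "i * n"])
  have c3: "cell_sym n E i n = 3" by (simp add: cell_sym_def)
  have 5: "runs (Act (\<lambda>r. [(3, Some 3, MoveR)])) ?\<sigma>3 1 (read_state n E w b \<sigma> (Suc i))"
    by (rule runs_Act) (use wr[of n] c3 in \<open>auto simp: read_state_def fun_eq_iff add.commute add.left_commute\<close>)
  show ?thesis unfolding read_row_def
    by (rule runs_Seq[OF 1 runs_Seq[OF 2 runs_Seq[OF 3[unfolded f0] runs_Seq[OF 4[unfolded e] 5 order_refl] order_refl] order_refl]])
      (use T in simp)
qed

text \<open>Tape 12 first serves as the counter of \<open>to_unary\<close>, which returns its head
  to the marker. The final \<open>mvL 2\<close> puts the head of tape 2 on cell \<open>k\<close>,
  the position that stands for size 0.\<close>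

definition read_input :: cmd where
  "read_input = mark ;; to_unary 0 1 12 ;; mvR 0 ;; to_unary 0 2 12 ;; mvR 0 ;; mvL 2 ;;
     While (\<lambda>r. r 0 \<noteq> 0) read_row ;; rewind 3"

definition read_time :: "nat \<Rightarrow> nat \<Rightarrow> nat" where
  "read_time n k = length (bin n) * (6 * n + 13) + length (bin k) * (6 * k + 13) + n * (6 * n + 31) + 2 * (n * (n + 1)) + 20"

lemma runs_read_input:
  "\<exists>\<sigma>. runs read_input (init_store (enc_ce (n, E, k))) (read_time n k) \<sigma> \<and>
     main_inv (graph_matrix n E) k 0 [] 0 [] \<sigma>"
proof -
  let ?M = "graph_matrix n E"
  define X where "X = concat (map (\<lambda>i. map (\<lambda>j. if {i, j} \<in> E then 2 else 1 :: nat) [0..<n]) [0..<n])"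
  define w where "w = enc_ce (n, E, k)"
  have w: "w = bin n @ [3] @ bin k @ [3] @ X" by (simp add: w_def X_def)
  define b where "b = length (bin n) + 1 + length (bin k) + 1"
  have X: "X = map (\<lambda>p. if {p div n, p mod n} \<in> E then 2 else 1) [0..<n * n]"
    unfolding X_def using concat_rows[where f = "\<lambda>i j. if {i, j} \<in> E then 2 else 1 :: nat"] .
  have wX: "b + p < length w \<longleftrightarrow> p < n * n" "w ! (b + p) = X ! p" for p
  proof -
    define pre where "pre = bin n @ [3] @ bin k @ [3]"
    have "w = pre @ X" "b = length pre" "length X = n * n" by (simp_all add: w b_def pre_def X)
    then show "b + p < length w \<longleftrightarrow> p < n * n" "w ! (b + p) = X ! p"
      by (simp_all add: nth_append_length_plus)
  qed
  have wc: "b + i * n + j < length w \<and> w ! (b + i * n + j) = (if {i, j} \<in> E then 2 else 1)" if "i < n" "j < n" for i j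
  proof -
    have "i * n + j < Suc i * n" using that by simp
    also have "\<dots> \<le> n * n" using that by (intro mult_le_mono1) simp
    finally have l: "i * n + j < n * n" .
    have "(i * n + j) div n = i" "(i * n + j) mod n = j" using that by simp_all
    then have "X ! (i * n + j) = (if {i, j} \<in> E then 2 else 1)" using l by (simp add: X)
    then show ?thesis using wX[of "i * n + j"] l by (simp add: add.assoc)
  qed
  have 1: "runs mark (init_store w) 1 (marked w)" by (rule runs_mark)
  let ?\<sigma>1 = "marked w"
  have u0: "tp [] (Suc 0) = unary_tape 0" by (simp add: unary_tape_def)
  have 2: "runs (to_unary 0 1 12) ?\<sigma>1 (length (bin n) * (6 * n + 13) + 1)
     (?\<sigma>1(0 := tq w (length (bin n)), 1 := unary_tape n))" (is "runs _ _ _ ?\<sigma>2")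
    using runs_to_unary[of ?\<sigma>1 0 "[]" "bin n" "[3] @ bin k @ [3] @ X" 1 0 12 n] set_bin[of n]
    by (simp add: marked_def u0 w bits_val_bin)
  have 3: "runs (mvR 0) ?\<sigma>2 1 (?\<sigma>2(0 := tq w (Suc (length (bin n)))))" (is "runs _ _ _ ?\<sigma>3")
    by (rule runs_mvR) auto
  have 4: "runs (to_unary 0 2 12) ?\<sigma>3 (length (bin k) * (6 * k + 13) + 1)
     (?\<sigma>3(0 := tq w (Suc (length (bin n)) + length (bin k)), 2 := unary_tape k))" (is "runs _ _ _ ?\<sigma>4")
    using runs_to_unary[of ?\<sigma>3 0 "bin n @ [3]" "bin k" "[3] @ X" 2 0 12 k] set_bin[of k]
    by (simp add: marked_def u0 w bits_val_bin)
  have 5: "runs (mvR 0) ?\<sigma>4 1 (?\<sigma>4(0 := tq w b))" (is "runs _ _ _ ?\<sigma>5")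
    by (rule runs_mvR) (auto simp: b_def)
  have 6: "runs (mvL 2) ?\<sigma>5 1 (?\<sigma>5(2 := tp (replicate k 1) k))" (is "runs _ _ _ ?\<sigma>6")
    by (rule runs_mvL) (auto simp: unary_tape_def)
  have r0: "?\<sigma>6 = read_state n E w b ?\<sigma>6 0"
    by (auto simp: read_state_def fun_eq_iff marked_def unary_tape_def)
  have 7: "runs (While (\<lambda>r. r 0 \<noteq> 0) read_row) ?\<sigma>6 (n * (6 * n + 31) + 1) (read_state n E w b ?\<sigma>6 n)" (is "runs _ _ _ ?\<sigma>7")
  proof (rule runs_While_index[where f = "read_state n E w b ?\<sigma>6" and N = n and C = "6 * n + 30"])
    fix i assume i: "i < n"
    show "rd (read_state n E w b ?\<sigma>6 i) 0 \<noteq> 0"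
      using wc[OF i, of 0] i by (simp add: read_state_def split: if_splits)
    show "runs read_row (read_state n E w b ?\<sigma>6 i) (6 * n + 30) (read_state n E w b ?\<sigma>6 (Suc i))"
      by (rule runs_read_row[OF i wc order_refl])
  next
    show "\<not> rd (read_state n E w b ?\<sigma>6 n) 0 \<noteq> 0"
      using wX(1)[of "n * n"] by (simp add: read_state_def)
  qed (use r0 in auto)
  have lM: "length ?M = n * (n + 1)" by (simp add: graph_matrix_def)
  have \<sigma>7: "?\<sigma>7 3 = tp ?M (Suc (n * (n + 1)))" using lM by (simp add: read_state_def)
  have M7: "7 \<notin> set ?M" using matrix_graph[of n E] by (auto simp: matrix_def)
  have 8: "runs (rewind 3) ?\<sigma>7 (2 * (n * (n + 1)) + 5) (?\<sigma>7(3 := tp ?M 1))"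
    by (rule runs_rewind[of ?\<sigma>7 3 ?M "Suc (n * (n + 1))", OF \<sigma>7 M7]) simp
  define \<sigma>8 where "\<sigma>8 = ?\<sigma>7(3 := tp ?M 1)"
  have "runs read_input (init_store w) (read_time n k) \<sigma>8"
    unfolding read_input_def \<sigma>8_def
    by (rule runs_Seq[OF 1 runs_Seq[OF 2 runs_Seq[OF 3 runs_Seq[OF 4 runs_Seq[OF 5 runs_Seq[OF 6 runs_Seq[OF 7 8 order_refl]
      order_refl] order_refl] order_refl] order_refl] order_refl]]) (simp add: read_time_def)
  moreover have "main_inv ?M k 0 [] 0 [] \<sigma>8"
    unfolding main_inv_def \<sigma>8_def read_state_def
    by (auto simp: marked_def blank_eq(2) intro!: exI[of _ "[]"] exI[of _ 0]) (simp add: blank_eq(2)[symmetric] blank_eq(1))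
  ultimately show ?thesis unfolding w_def by blast
qed

definition first_sol :: cmd where
  "first_sol = read_input ;; find ;; Cond (\<lambda>r. r 15 = 1) emit skip"

lemma runs_first_sol:
  "\<exists>\<sigma>. runs first_sol (init_store (enc_ce (n, E, k)))
      (read_time n k + find_time (n * (n + 1)) k + emit_time (n * (n + 1)) + 3) \<sigma> \<and>
     found_from n (graph_matrix n E) k 0 \<sigma>"
proof -
  have l: "length (graph_matrix n E) = n * (n + 1)" by (simp add: graph_matrix_def)
  obtain \<sigma>1 where 1: "runs read_input (init_store (enc_ce (n, E, k))) (read_time n k) \<sigma>1"
    "main_inv (graph_matrix n E) k 0 [] 0 [] \<sigma>1" using runs_read_input by blast
  obtain \<sigma>2 where 2: "runs (find ;; Cond (\<lambda>r. r 15 = 1) emit skip) \<sigma>1 (find_time (n * (n + 1)) k + emit_time (n * (n + 1)) + 2) \<sigma>2"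
    "found_from n (graph_matrix n E) k (code (n * (n + 1)) 0 []) \<sigma>2"
    using runs_find_emit[OF matrix_graph 1(2) order_refl] unfolding l by blast
  have "runs first_sol (init_store (enc_ce (n, E, k))) (read_time n k + find_time (n * (n + 1)) k + emit_time (n * (n + 1)) + 3) \<sigma>2"
    unfolding first_sol_def by (rule runs_Seq[OF 1(1) 2(1)]) simp
  then show ?thesis using 2(2) by (auto simp: code_def)
qed

section \<open>The machines\<close>

lemmas command_defs = first_sol_def next_sol_def read_input_def mark_def to_unary_def double_def mvR_def mvL_def put_def
  skip_def read_row_def read_cell_def rewind_def to_mark_def to_end_def clear_def find_def body_def feas_def prep_def
  prep_acts_def feas_loop_def load_def checks_def incr_guess_def walk_def incr_prefix_def next_size_def
  clear_out_def leave_def emit_def emit_step_def emit_cell_def emit_sym_def print_bin_def incr_bin_def rewind3_def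
  round_def search_def advance_def flip_def guess_tape_def sync_def Let_def

text \<open>The tapes are 0 to 16 and the symbols 0 to 7. The largest symbol 7 is the end marker; 5
  and 6 are frozen letters, and 4 and 5 also occur as markers in the output.\<close>

lemma wf_first_sol: "wf_cmd 17 8 first_sol"
  by (auto simp: command_defs comb_def)

lemma wf_next_sol: "wf_cmd 17 8 next_sol"
  by (auto simp: command_defs comb_def)

text \<open>As 2 encodes the bit 1 and 1 the bit 0, the power with exponent \<open>4 * x\<close> is
  written as a 2 followed by \<open>4 * x\<close> ones. The factor 4 comes from doubling the unary
  number twice.\<close>

definition power_prog :: cmd where
  "power_prog = mark ;; to_unary 0 1 12 ;; double 1 12 ;; double 1 12 ;; rewind 1 ;;
     Act (\<lambda>r. [(16, Some 2, MoveR)]) ;; While (\<lambda>r. r 1 \<noteq> 0) (Act (\<lambda>r. [(16, Some 1, MoveR), (1, None, MoveR)]))"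

lemma wf_power_prog: "wf_cmd 17 8 power_prog"
  by (auto simp: power_prog_def command_defs)

lemma bin_power2: "bin (2 ^ m) = 2 # replicate m 1"
proof (induction m)
  case (Suc m)
  have "bin (2 ^ Suc m) = bin (2 ^ m) @ [1]"
    by (subst bin.simps) simp
  then show ?case using Suc by (simp add: replicate_append_same)
qed (simp add: bin.simps)

lemma out_word_conf:
  assumes "m \<ge> 1" "\<sigma> (m - 1) = tq w p" "0 \<notin> set w"
  shows "out_word (conf m q \<sigma>) = w"
proof -
  have "last (map (\<lambda>i. fst (\<sigma> i)) [0..<m]) = fst (tq w p)"
    using assms by (simp add: last_map)
  then have l: "last (ctapes (conf m q \<sigma>)) = (\<lambda>j. if j < length w then w ! j else 0)"
    by (simp add: conf_def tq_def)
  have w0: "w ! j \<noteq> 0" if "j < length w" for j using assms(3) nth_mem[OF that] by metis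
  have "(LEAST j. (if j < length w then w ! j else 0) = 0) = length w"
  proof (rule Least_equality)
    show "length w \<le> j" if "(if j < length w then w ! j else 0) = 0" for j
      using that w0[of j] by (cases "j < length w") auto
  qed simp
  then show ?thesis unfolding out_word_def l Let_def by (auto intro: nth_equalityI)
qed

lemma runs_power_prog:
  "\<exists>T \<sigma>. runs power_prog (init_store (bin x)) T \<sigma> \<and> \<sigma> 16 = tq (bin (2 ^ (4 * x))) (Suc (4 * x))"
proof -
  let ?w = "bin x"
  have u0: "tp [] (Suc 0) = unary_tape 0" by (simp add: unary_tape_def)
  let ?\<sigma>1 = "(marked ?w)(0 := tq ?w (length ?w))"
  have 2: "runs (to_unary 0 1 12) (marked ?w) (length ?w * (6 * x + 13) + 1) (?\<sigma>1(1 := unary_tape x))"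
    using runs_to_unary[of "marked ?w" 0 "[]" "bin x" "[]" 1 0 12 x] set_bin[of x]
    by (simp add: marked_def u0 bits_val_bin)
  have 3: "runs (double 1 12) (?\<sigma>1(1 := unary_tape x)) (6 * x + 9) (?\<sigma>1(1 := unary_tape (2 * x)))"
    using runs_double[of "?\<sigma>1(1 := unary_tape x)" 1 x 12] by (simp add: marked_def)
  have 4: "runs (double 1 12) (?\<sigma>1(1 := unary_tape (2 * x))) (12 * x + 9) (?\<sigma>1(1 := unary_tape (4 * x)))"
    using runs_double[of "?\<sigma>1(1 := unary_tape (2 * x))" 1 "2 * x" 12] by (simp add: marked_def)
  let ?u = "replicate (4 * x) 1"
  have 5: "runs (rewind 1) (?\<sigma>1(1 := unary_tape (4 * x))) (8 * x + 5) (?\<sigma>1(1 := tp ?u 1))"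
    using runs_rewind[of "?\<sigma>1(1 := unary_tape (4 * x))" 1 ?u "Suc (4 * x)" "8 * x + 5"] by (simp add: unary_tape_def)
  let ?f = "\<lambda>t. ?\<sigma>1(1 := tp ?u (Suc t), 16 := tq (2 # replicate t 1) (Suc t))"
  have "wrt 2 (tq [] 0) = tq [2] 0" using wrt_tq_append[of 2 "[]"] by simp
  then have 6: "runs (Act (\<lambda>r. [(16, Some 2, MoveR)])) (?\<sigma>1(1 := tp ?u 1)) 1 (?f 0)"
    by (intro runs_Act) (auto simp: marked_def blank_eq(1) fun_eq_iff)
  have 7: "runs (While (\<lambda>r. r 1 \<noteq> 0) (Act (\<lambda>r. [(16, Some 1, MoveR), (1, None, MoveR)]))) (?f 0) (8 * x + 1) (?f (4 * x))"
  proof (rule runs_While_index[where f = ?f and N = "4 * x" and C = 1])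
    fix t assume "t < 4 * x"
    have "wrt 1 (tq (2 # replicate t 1) (Suc t)) = tq (2 # replicate (Suc t) 1) (Suc t)"
      using wrt_tq_append[of 1 "2 # replicate t 1"] by (simp add: replicate_append_same)
    then show "runs (Act (\<lambda>r. [(16, Some 1, MoveR), (1, None, MoveR)])) (?f t) 1 (?f (Suc t))"
      by (intro runs_Act) (auto simp: fun_eq_iff)
  qed auto
  have "(?f (4 * x)) 16 = tq (bin (2 ^ (4 * x))) (Suc (4 * x))" by (simp add: bin_power2)
  then show ?thesis
    using runs_Seq[OF runs_mark runs_Seq[OF 2 runs_Seq[OF 3 runs_Seq[OF 4 runs_Seq[OF 5 runs_Seq[OF 6 7 order_refl]
      order_refl] order_refl] order_refl] order_refl] order_refl]
    unfolding power_prog_def by blast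
qed

lemma wf_skip: "wf_cmd m y skip"
  by (simp add: skip_def)

text \<open>With a predicate that always fails, the general machine just executes its first program
  and halts without passing the output state.\<close>

lemma power_computable: "tm_computable (\<lambda>x. 2 ^ (4 * x))"
proof -
  let ?M = "machine 17 8 (\<lambda>_. False) power_prog skip"
  have wf: "wf_tm ?M" by (rule wf_M[OF refl refl refl]) (simp_all add: wf_power_prog wf_skip)
  moreover have "\<exists>T. halts_at ?M (bin x) T \<and> out_word (run ?M (bin x) T) = bin (2 ^ (4 * x))" for x
  proof -
    obtain D \<sigma> where \<sigma>: "runs power_prog (init_store (bin x)) D \<sigma>" "\<sigma> 16 = tq (bin (2 ^ (4 * x))) (Suc (4 * x))"
      using runs_power_prog by blast
    have "\<exists>T. halts_at ?M (bin x) T \<and> run ?M (bin x) T = conf 17 0 \<sigma> \<and>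
       outputs ?M (bin x) T = map (\<lambda>j. out_word (conf 17 1 \<sigma>)) [0..<0] \<and> delay_bounded ?M (bin x) (D + 2)"
      by (rule machine_run[OF refl refl refl, where \<sigma>s = "\<lambda>_. \<sigma>"])
        (use \<sigma> in \<open>simp_all add: wf_power_prog wf_skip runs_def\<close>)
    moreover have "0 \<notin> set (bin (2 ^ (4 * x)))" using set_bin[of "2 ^ (4 * x)"] by auto
    then have "out_word (conf 17 0 \<sigma>) = bin (2 ^ (4 * x))"
      by (intro out_word_conf) (use \<sigma>(2) in auto)
    ultimately show ?thesis by metis
  qed
  ultimately show ?thesis unfolding tm_computable_def by blast
qed

section \<open>Assignments and edit sets\<close>

definition cell_pair :: "nat \<Rightarrow> nat \<Rightarrow> nat set" where
  "cell_pair n j = {j div (n + 1), j mod (n + 1)}"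

definition cell_edit :: "nat \<Rightarrow> nat list \<Rightarrow> nat \<Rightarrow> edit" where
  "cell_edit n Q j = (if Q ! j = 2 then AddE (cell_pair n j) else DelE (cell_pair n j))"

definition edits :: "nat \<Rightarrow> nat list \<Rightarrow> edit set" where
  "edits n Q = cell_edit n Q ` {j. j < length Q \<and> Q ! j \<noteq> 1}"

definition upper :: "nat \<Rightarrow> nat \<Rightarrow> bool" where
  "upper n j \<longleftrightarrow> j < n * (n + 1) \<and> j div (n + 1) < j mod (n + 1) \<and> j mod (n + 1) < n"

lemma graph_matrix_upper:
  assumes "j < n * (n + 1)"
  shows "graph_matrix n E ! j \<in> {1, 2} \<longleftrightarrow> upper n j"
    "upper n j \<Longrightarrow> graph_matrix n E ! j = (if cell_pair n j \<in> E then 2 else 1)"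
proof -
  have "j mod Suc n \<noteq> n \<longleftrightarrow> j mod Suc n < n" using mod_less_divisor[of "Suc n" j] by linarith
  then show "graph_matrix n E ! j \<in> {1, 2} \<longleftrightarrow> upper n j"
    "upper n j \<Longrightarrow> graph_matrix n E ! j = (if cell_pair n j \<in> E then 2 else 1)"
    using assms by (auto simp: graph_matrix_def cell_sym_def upper_def cell_pair_def)
qed

lemma cell_pair_inj:
  assumes "upper n i" "upper n j" "cell_pair n i = cell_pair n j"
  shows "i = j"
proof -
  have "i div (n + 1) = j div (n + 1) \<and> i mod (n + 1) = j mod (n + 1)"
    using assms unfolding upper_def cell_pair_def by (metis doubleton_eq_iff less_asym)
  then show ?thesis by (metis div_mult_mod_eq)
qed

lemma cell_pair_valid: "upper n j \<Longrightarrow> cell_pair n j \<subseteq> {0..<n} \<and> card (cell_pair n j) = 2"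
  by (auto simp: upper_def cell_pair_def)

lemma upper_cell:
  assumes "a < b" "b < n"
  shows "upper n (a * (n + 1) + b)" "cell_pair n (a * (n + 1) + b) = {a, b}" "a * (n + 1) + b < n * (n + 1)"
  using assms cell_div_mod[of b "n + 1" a] cell_less[of a n b] unfolding upper_def cell_pair_def by auto

lemma pair_upper:
  assumes "e \<subseteq> {0..<n}" "card e = 2"
  obtains j where "upper n j" "cell_pair n j = e"
proof -
  obtain a b where ab: "e = {a, b}" "a \<noteq> b" using assms(2) by (auto simp: card_2_iff)
  then consider "a < b" "b < n" | "b < a" "a < n" using assms(1) by fastforce
  then show ?thesis
    by cases (use upper_cell[of a b n] upper_cell[of b a n] that ab in \<open>auto simp: insert_commute\<close>)
qed

text \<open>The three vertices induce a path with two edges, the forbidden induced subgraph of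
  cluster graphs.\<close>

definition open_triple :: "nat set set \<Rightarrow> nat \<Rightarrow> nat \<Rightarrow> nat \<Rightarrow> bool" where
  "open_triple F a b c \<longleftrightarrow> {a, b} \<in> F \<and> {a, c} \<in> F \<and> {b, c} \<notin> F \<or> {a, b} \<in> F \<and> {a, c} \<notin> F \<and> {b, c} \<in> F \<or>
     {a, b} \<notin> F \<and> {a, c} \<in> F \<and> {b, c} \<in> F"

context
  fixes n :: nat and E :: "nat set set" and M :: "nat list"
  assumes E: "graph n E" and M_eq: "M = graph_matrix n E"
begin

lemma length_M: "length M = n * (n + 1)"
  by (simp add: M_eq graph_matrix_def)

lemma forced_upper:
  assumes "length Q = length M" "forced M Q" "j < length Q" "Q ! j \<noteq> 1"
  shows "upper n j"
  using assms graph_matrix_upper(1)[of j n E] by (auto simp: forced_def length_M M_eq[symmetric])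

lemma cell_edit_inj:
  assumes "length Q = length M" "forced M Q"
  shows "inj_on (cell_edit n Q) {j. j < length Q \<and> Q ! j \<noteq> 1}"
proof (rule inj_onI)
  fix i j assume ij: "i \<in> {j. j < length Q \<and> Q ! j \<noteq> 1}" "j \<in> {j. j < length Q \<and> Q ! j \<noteq> 1}"
    and e: "cell_edit n Q i = cell_edit n Q j"
  have "upper n i" "upper n j" using forced_upper[OF assms] ij by auto
  moreover have "cell_pair n i = cell_pair n j" using e by (auto simp: cell_edit_def split: if_splits)
  ultimately show "i = j" by (rule cell_pair_inj)
qed

lemma card_edits: "length Q = length M \<Longrightarrow> forced M Q \<Longrightarrow> card (edits n Q) = weight Q"
  unfolding edits_def weight_def by (rule card_image) (rule cell_edit_inj)

lemma edits_iff:
  assumes Q: "length Q = length M" "forced M Q" "set Q \<subseteq> {1, 2, 3}" and j: "upper n j"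
  shows "AddE (cell_pair n j) \<in> edits n Q \<longleftrightarrow> Q ! j = 2" "DelE (cell_pair n j) \<in> edits n Q \<longleftrightarrow> Q ! j = 3"
proof -
  have jl: "j < length Q" using j Q(1) by (simp add: upper_def length_M)
  have q: "Q ! j \<in> {1, 2, 3}" using Q(3) nth_mem[OF jl] by blast
  have *: "i = j" if "i < length Q" "Q ! i \<noteq> 1" "cell_pair n i = cell_pair n j" for i
    using cell_pair_inj[OF forced_upper[OF Q(1,2) that(1,2)] j that(3)] .
  show "AddE (cell_pair n j) \<in> edits n Q \<longleftrightarrow> Q ! j = 2"
  proof
    assume "AddE (cell_pair n j) \<in> edits n Q"
    then obtain i where "i < length Q" "Q ! i \<noteq> 1" "AddE (cell_pair n j) = cell_edit n Q i" by (auto simp: edits_def)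
    then show "Q ! j = 2" using *[of i] by (auto simp: cell_edit_def split: if_splits)
  next
    assume "Q ! j = 2"
    then show "AddE (cell_pair n j) \<in> edits n Q" using jl by (force simp: edits_def cell_edit_def)
  qed
  show "DelE (cell_pair n j) \<in> edits n Q \<longleftrightarrow> Q ! j = 3"
  proof
    assume "DelE (cell_pair n j) \<in> edits n Q"
    then obtain i where "i < length Q" "Q ! i \<noteq> 1" "DelE (cell_pair n j) = cell_edit n Q i" by (auto simp: edits_def)
    then show "Q ! j = 3" using *[of i] q by (auto simp: cell_edit_def split: if_splits)
  next
    assume "Q ! j = 3"
    then show "DelE (cell_pair n j) \<in> edits n Q" using jl by (force simp: edits_def cell_edit_def)
  qed
qed

lemma edits_valid:
  assumes Q: "length Q = length M" "forced M Q" "set Q \<subseteq> {1, 2, 3}"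
  shows "\<forall>op\<in>edits n Q. valid_edit n op" "consistent (edits n Q)"
proof -
  have up: "upper n j" if "j < length Q" "Q ! j \<noteq> 1" for j using forced_upper[OF Q(1,2) that] .
  show "\<forall>op\<in>edits n Q. valid_edit n op"
  proof
    fix op assume "op \<in> edits n Q"
    then obtain j where j: "j < length Q" "Q ! j \<noteq> 1" "op = cell_edit n Q j" by (auto simp: edits_def)
    then have "edit_pair op = cell_pair n j" by (simp add: cell_edit_def)
    then show "valid_edit n op" using cell_pair_valid[OF up[OF j(1,2)]] by (simp add: valid_edit_def)
  qed
  show "consistent (edits n Q)" unfolding consistent_def
  proof (intro allI notI)
    fix e assume e: "AddE e \<in> edits n Q \<and> DelE e \<in> edits n Q"
    then obtain j where "j < length Q" "Q ! j \<noteq> 1" "e = cell_pair n j"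
      by (auto simp: edits_def cell_edit_def split: if_splits)
    then show False using edits_iff[OF Q up[of j]] e by auto
  qed
qed

text \<open>Consistency makes the letter of each pair unambiguous. Together with
  \<open>edits_inj\<close> this identifies consistent sets of valid edits with the assignments that
  place operations on pairs only.\<close>

lemma edits_surj:
  assumes v: "\<forall>op\<in>S. valid_edit n op" and c: "consistent S"
  obtains Q where "digits (length M) Q" "forced M Q" "edits n Q = S"
proof -
  define Q where "Q = map (\<lambda>j. if \<not> upper n j then 1 else if AddE (cell_pair n j) \<in> S then 2
     else if DelE (cell_pair n j) \<in> S then 3 else 1 :: nat) [0..<length M]"
  have l: "length Q = length M" by (simp add: Q_def)
  have d: "digits (length M) Q" by (auto simp: digits_def Q_def)
  have f: "forced M Q" unfolding forced_def
  proof (intro allI impI)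
    fix j assume "j < length Q" "Q ! j \<noteq> 1"
    then have "j < length M" "upper n j" by (auto simp: Q_def split: if_splits)
    then show "M ! j \<in> {1, 2}" using graph_matrix_upper(1)[of j n E] by (simp add: M_eq[symmetric] length_M)
  qed
  have Qj: "(Q ! j = 2 \<longleftrightarrow> AddE (cell_pair n j) \<in> S) \<and> (Q ! j = 3 \<longleftrightarrow> DelE (cell_pair n j) \<in> S)" if "upper n j" for j
  proof -
    have "j < length M" using that by (simp add: upper_def length_M)
    then show ?thesis using that c by (auto simp: Q_def consistent_def)
  qed
  have s: "set Q \<subseteq> {1, 2, 3}" using d by (simp add: digits_def)
  have "op \<in> edits n Q \<longleftrightarrow> op \<in> S" if val: "valid_edit n op" for op
  proof -
    obtain j where j: "upper n j" "cell_pair n j = edit_pair op"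
      using pair_upper[of "edit_pair op" n] val by (auto simp: valid_edit_def)
    show ?thesis using edits_iff[OF l f s j(1)] Qj[OF j(1)] j(2) by (cases op) auto
  qed
  moreover have "\<forall>op\<in>edits n Q. valid_edit n op" by (rule edits_valid(1)[OF l f s])
  ultimately have "edits n Q = S" using v by blast
  then show ?thesis using that d f by blast
qed

lemma edits_inj:
  assumes "digits (length M) Q" "forced M Q" "digits (length M) Q'" "forced M Q'" "edits n Q = edits n Q'"
  shows "Q = Q'"
proof (rule nth_equalityI)
  have l: "length Q = length M" "length Q' = length M" "set Q \<subseteq> {1, 2, 3}" "set Q' \<subseteq> {1, 2, 3}"
    using assms(1,3) by (auto simp: digits_def)
  then show "length Q = length Q'" by simp
  fix j assume j: "j < length Q"
  have q: "Q ! j \<in> {1, 2, 3}" "Q' ! j \<in> {1, 2, 3}"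
    using subsetD[OF l(3) nth_mem[of j Q]] subsetD[OF l(4) nth_mem[of j Q']] j l by auto
  show "Q ! j = Q' ! j"
  proof (cases "upper n j")
    case True
    have "Q ! j = 2 \<longleftrightarrow> Q' ! j = 2" "Q ! j = 3 \<longleftrightarrow> Q' ! j = 3"
      using edits_iff[OF l(1) assms(2) l(3) True] edits_iff[OF l(2) assms(4) l(4) True] unfolding assms(5) by blast+
    then show ?thesis using q by auto
  next
    case False
    have "Q ! j = 1" using forced_upper[OF l(1) assms(2) j] False by blast
    moreover have "Q' ! j = 1" using forced_upper[OF l(2) assms(4), of j] False j l by auto
    ultimately show ?thesis by simp
  qed
qed

lemma edge_iff:
  assumes Q: "length Q = length M" "forced M Q" "set Q \<subseteq> {1, 2, 3}" and ab: "a < b" "b < n"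
  defines "h \<equiv> loaded M Q ! (a * (n + 1) + b)"
  shows "h \<in> {1, 2, 5, 6}" "h \<in> {2, 6} \<longleftrightarrow> {a, b} \<in> apply_edits (edits n Q) E" "h \<in> {1, 5} \<longleftrightarrow> {a, b} \<notin> apply_edits (edits n Q) E"
proof -
  let ?j = "a * (n + 1) + b"
  note u = upper_cell[OF ab]
  have jl: "?j < length M" using u(3) by (simp add: length_M)
  have q: "Q ! ?j \<in> {1, 2, 3}" using subsetD[OF Q(3) nth_mem[of ?j Q]] jl Q(1) by auto
  have m: "M ! ?j = (if {a, b} \<in> E then 2 else 1)" using graph_matrix_upper(2)[OF u(3,1), of E] u(2) by (simp only: M_eq)
  have h: "h = comb (M ! ?j) (Q ! ?j)" using jl Q(1) by (simp add: h_def loaded_def)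
  have ed: "AddE {a, b} \<in> edits n Q \<longleftrightarrow> Q ! ?j = 2" "DelE {a, b} \<in> edits n Q \<longleftrightarrow> Q ! ?j = 3"
    using edits_iff[OF Q u(1)] u(2) by simp_all
  show "h \<in> {1, 2, 5, 6}" "h \<in> {2, 6} \<longleftrightarrow> {a, b} \<in> apply_edits (edits n Q) E" "h \<in> {1, 5} \<longleftrightarrow> {a, b} \<notin> apply_edits (edits n Q) E"
    using q unfolding h m by (auto simp: comb_def apply_edits_def ed)
qed

lemma loaded_not_upper:
  assumes "a < n" "c \<le> n" "\<not> (a < c \<and> c < n)"
  shows "loaded M Q ! (a * (n + 1) + c) \<notin> {1, 2, 5, 6}"
proof -
  let ?j = "a * (n + 1) + c"
  have j: "?j < n * (n + 1)" by (rule cell_less[OF assms(1,2)])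
  have "\<not> upper n ?j" using cell_div_mod[of c "n + 1" a] assms by (auto simp: upper_def)
  then have "M ! ?j \<notin> {1, 2}" using graph_matrix_upper(1)[OF j, of E] by (simp add: M_eq)
  moreover have "M ! ?j \<in> {1, 2, 3, 4}"
    using matrix_graph[of n E] nth_mem[of ?j M] j unfolding matrix_def M_eq[symmetric] length_M by blast
  moreover have "loaded M Q ! ?j = comb (M ! ?j) (if ?j < length Q then Q ! ?j else 0)"
    using j by (simp add: loaded_def length_M)
  ultimately show ?thesis by (auto simp: comb_def)
qed

text \<open>The letters accepted by \<open>bad3\<close> occur only above the diagonal, so a bad
  index stands for an increasing triple, and the letters at its cells describe the edited
  graph.\<close>

lemma bad_at_iff:
  assumes Q: "length Q = length M" "forced M Q" "set Q \<subseteq> {1, 2, 3}"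
  shows "(\<exists>t. bad_at n (loaded M Q) t) \<longleftrightarrow> (\<exists>a b c. a < b \<and> b < c \<and> c < n \<and> open_triple (apply_edits (edits n Q) E) a b c)"
proof
  let ?h = "loaded M Q" and ?F = "apply_edits (edits n Q) E"
  assume "\<exists>t. bad_at n ?h t"
  then obtain t where t: "t < n * n * (n + 1)" and b: "bad3 (?h ! cell1 n t) (?h ! cell2 n t) (?h ! cell3 n t)"
    by (auto simp: bad_at_def)
  let ?a = "va n t" and ?b = "vb n t" and ?c = "vc n t"
  note r = triple_ranges[OF t]
  have in4: "?h ! cell1 n t \<in> {1, 2, 5, 6}" "?h ! cell2 n t \<in> {1, 2, 5, 6}" "?h ! cell3 n t \<in> {1, 2, 5, 6}"
    using b by (simp_all add: bad3_def)
  have ab: "?a < ?b" using loaded_not_upper[of ?a ?b Q] in4(1) r unfolding cell1_def by fastforce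
  have bc: "?b < ?c \<and> ?c < n" using loaded_not_upper[of ?b ?c Q] in4(3) r unfolding cell3_def by fastforce
  have "open_triple ?F ?a ?b ?c"
    using b edge_iff(2,3)[OF Q ab] edge_iff(2,3)[OF Q, of ?a ?c] edge_iff(2,3)[OF Q, of ?b ?c] ab bc r
    unfolding bad3_def open_triple_def cell1_def cell2_def cell3_def by simp
  then show "\<exists>a b c. a < b \<and> b < c \<and> c < n \<and> open_triple ?F a b c" using ab bc by blast
next
  let ?h = "loaded M Q" and ?F = "apply_edits (edits n Q) E"
  assume "\<exists>a b c. a < b \<and> b < c \<and> c < n \<and> open_triple ?F a b c"
  then obtain a b c where abc: "a < b" "b < c" "c < n" and o: "open_triple ?F a b c" by blast
  \<comment> \<open>This index inverts \<open>va\<close>, \<open>vb\<close> and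
    \<open>vc\<close>.\<close>
  define t where "t = (a * n + b) * (n + 1) + c"
  have "t div (n + 1) = a * n + b" "t mod (n + 1) = c"
    unfolding t_def using cell_div_mod[of c "n + 1" "a * n + b"] abc by auto
  moreover have "(a * n + b) div n = a" "(a * n + b) mod n = b" using cell_div_mod[of b n a] abc by auto
  ultimately have v: "va n t = a" "vb n t = b" "vc n t = c" by (simp_all only: va_def vb_def vc_def)
  have "a * n + b < Suc a * n" using abc by simp
  also have "\<dots> \<le> n * n" using abc by (intro mult_le_mono1) simp
  finally have lt: "a * n + b < n * n" .
  have "t < Suc (a * n + b) * (n + 1)" unfolding t_def using abc by simp
  also have "\<dots> \<le> n * n * (n + 1)" using lt by (intro mult_le_mono1) simp
  finally have "t < n * n * (n + 1)" .
  moreover have "bad3 (?h ! cell1 n t) (?h ! cell2 n t) (?h ! cell3 n t)"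
    using o edge_iff[OF Q, of a b] edge_iff[OF Q, of a c] edge_iff[OF Q, of b c] abc
    unfolding bad3_def open_triple_def cell1_def cell2_def cell3_def v by simp
  ultimately show "\<exists>t. bad_at n ?h t" by (auto simp: bad_at_def)
qed

end

section \<open>Clusters as graphs without induced paths on three vertices\<close>

lemma graph_apply_edits:
  assumes "graph n E" "\<forall>op\<in>S. valid_edit n op"
  shows "graph n (apply_edits S E)"
  using assms by (fastforce simp: graph_def apply_edits_def valid_edit_def)

text \<open>Without open triples two edges sharing a vertex close up to a triangle. By induction
  along a path every two distinct connected vertices are then adjacent.\<close>

lemma is_cluster_iff:
  assumes F: "graph n F"
  shows "is_cluster n F \<longleftrightarrow> \<not> (\<exists>a b c. a < b \<and> b < c \<and> c < n \<and> open_triple F a b c)"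
proof
  assume cl: "is_cluster n F"
  have closed: "{x, z} \<in> F" if "{x, y} \<in> F" "{y, z} \<in> F" "x \<noteq> z" "x < n" "z < n" for x y z
  proof -
    have "(x, y) \<in> adj F" "(y, z) \<in> adj F" using that by (auto simp: adj_def)
    then have "(x, z) \<in> (adj F)\<^sup>*" by (meson r_into_rtrancl rtrancl_trans)
    then show ?thesis using cl that by (auto simp: is_cluster_def)
  qed
  show "\<not> (\<exists>a b c. a < b \<and> b < c \<and> c < n \<and> open_triple F a b c)"
  proof
    assume "\<exists>a b c. a < b \<and> b < c \<and> c < n \<and> open_triple F a b c"
    then obtain a b c where abc: "a < b" "b < c" "c < n" and o: "open_triple F a b c" by blast
    show False
      using o closed[of b a c] closed[of a b c] closed[of a c b] abc
      unfolding open_triple_def by (auto simp: insert_commute)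
  qed
next
  assume no: "\<not> (\<exists>a b c. a < b \<and> b < c \<and> c < n \<and> open_triple F a b c)"
  have closed: "{x, z} \<in> F" if e: "{x, y} \<in> F" "{y, z} \<in> F" and "x \<noteq> z" for x y z
  proof -
    have "card {x, y} = 2" "card {y, z} = 2" "{x, y} \<subseteq> {0..<n}" "{y, z} \<subseteq> {0..<n}" using F e by (auto simp: graph_def)
    then have ne: "x \<noteq> y" "y \<noteq> z" and lt: "x < n" "y < n" "z < n" by auto
    have s: "{y, x} = {x, y}" "{z, y} = {y, z}" "{z, x} = {x, z}" by (rule insert_commute)+
    have t: "\<not> open_triple F a b c" if "a < b" "b < c" "c < n" for a b c using no that by blast
    \<comment> \<open>Open triples are only excluded for increasing vertices, so all six orders of
      x, y, z have to be distinguished.\<close>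
    consider "x < y \<and> y < z" | "x < z \<and> z < y" | "y < x \<and> x < z" | "y < z \<and> z < x" | "z < x \<and> x < y" | "z < y \<and> y < x"
      using ne \<open>x \<noteq> z\<close> by linarith
    then show ?thesis
      using e lt t[of x y z] t[of x z y] t[of y x z] t[of y z x] t[of z x y] t[of z y x]
      unfolding open_triple_def s by cases blast+
  qed
  have "u = v \<or> {u, v} \<in> F" if "(u, v) \<in> (adj F)\<^sup>*" for u v
    using that
  proof (induction rule: rtrancl_induct)
    case (step y z)
    then have "{y, z} \<in> F" by (simp add: adj_def)
    then show ?case using step.IH closed by blast
  qed simp
  then show "is_cluster n F" unfolding is_cluster_def by blast
qed

lemma solves_iff:
  assumes E: "graph n E" and Q: "digits (n * (n + 1)) Q" "forced (graph_matrix n E) Q"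
  shows "solves n (graph_matrix n E) (weight Q) Q \<longleftrightarrow> is_cluster n (apply_edits (edits n Q) E)"
proof -
  have l: "length (graph_matrix n E) = n * (n + 1)" by (simp add: graph_matrix_def)
  have q: "length Q = length (graph_matrix n E)" "set Q \<subseteq> {1, 2, 3}" using Q(1) l by (auto simp: digits_def)
  note F = graph_apply_edits[OF E edits_valid(1)[OF E refl q(1) Q(2) q(2)]]
  show ?thesis
    unfolding solves_def is_cluster_iff[OF F] bad_at_iff[OF E refl q(1) Q(2) q(2)] using Q l by simp
qed

lemma concat_map_filter_Nil: "(\<And>x. \<not> P x \<Longrightarrow> f x = []) \<Longrightarrow> concat (map f (filter P xs)) = concat (map f xs)"
  by (induction xs) auto

lemma encodes_enc_sol:
  assumes E: "graph n E" and Q: "length Q = length (graph_matrix n E)" "forced (graph_matrix n E) Q" "set Q \<subseteq> {1, 2, 3}"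
  shows "encodes_edits (enc_sol n Q) (edits n Q)"
proof -
  define js where "js = filter (\<lambda>j. Q ! j \<noteq> 1) [0..<length Q]"
  have js: "set js = {j. j < length Q \<and> Q ! j \<noteq> 1}" by (auto simp: js_def)
  have "distinct (map (cell_edit n Q) js)"
    unfolding distinct_map js using cell_edit_inj[OF E refl Q(1,2)] by (simp add: js_def)
  moreover have "set (map (cell_edit n Q) js) = edits n Q" by (simp add: js edits_def)
  moreover have "enc_sol n Q = concat (map (enc_cell n Q) js)"
    unfolding enc_sol_def js_def by (rule concat_map_filter_Nil[symmetric]) (simp add: enc_cell_def)
  moreover have "encodes_edit (enc_cell n Q j) (cell_edit n Q j)" if "j \<in> set js" for j
  proof -
    have j: "j < length Q" "Q ! j \<noteq> 1" using that js by auto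
    have "upper n j" by (rule forced_upper[OF E refl Q(1,2) j])
    then have "j div (n + 1) \<noteq> j mod (n + 1)" by (simp add: upper_def)
    then show ?thesis unfolding encodes_edit_def enc_cell_def using j
      by (intro exI[of _ "j div (n + 1)"] exI[of _ "j mod (n + 1)"]) (auto simp: cell_edit_def cell_pair_def)
  qed
  ultimately show ?thesis unfolding encodes_edits_def
    by (intro exI[of _ "map (cell_edit n Q) js"] exI[of _ "map (enc_cell n Q) js"])
      (simp add: list_all2_conv_all_nth)
qed

section \<open>Running time\<close>

text \<open>In the application \<open>l\<close> is the matrix length \<open>n * (n + 1)\<close>,
  \<open>N\<close> the input length plus one and \<open>K\<close> is \<open>2 ^ k\<close>. The
  hypotheses on \<open>K\<close> absorb both the number of letters of a guess string and the number
  of such strings.\<close>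

lemma next_time_bound:
  fixes K N :: nat
  assumes N: "l \<le> 2 * N" "1 \<le> N" and K: "k + 1 \<le> K" "3 ^ k \<le> K ^ 2"
  shows "next_time l k \<le> 12000 * (K ^ 4 * N ^ 4)" "find_time l k + emit_time l \<le> 12000 * (K ^ 4 * N ^ 4)"
proof -
  have K1: "1 \<le> K" using K(1) by simp
  \<comment> \<open>Up to constants, \<open>A\<close> bounds the time for one guess string,
    \<open>B\<close> that for one feasibility test, and \<open>Z\<close> that for the search between
    two outputs.\<close>
  define A where "A = K * N ^ 3"
  define B where "B = K ^ 2 * A"
  define Z where "Z = K * N * B"
  have Z: "Z = K ^ 4 * N ^ 4" by (simp add: Z_def B_def A_def power2_eq_square power4_eq_xxxx power3_eq_cube algebra_simps)
  have pow: "N \<le> N ^ 3" "1 \<le> N ^ 3" "N \<le> N ^ 2" "1 \<le> K ^ 2" using N(2) K1 by (simp_all add: self_le_power)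
  have KA: "K \<le> A" "N ^ 3 \<le> A" unfolding A_def using pow K1 by simp_all
  have AB: "A \<le> B" unfolding B_def using pow by simp
  have BZ: "B \<le> Z" unfolding Z_def using N(2) K1 by simp
  have NB: "N \<le> A" "1 \<le> A" "N \<le> B" "K \<le> B" "1 \<le> B" using KA AB pow by linarith+
  have "l * l * (4 * l + 16) \<le> (2 * N) * (2 * N) * (24 * N)"
    using N by (intro mult_le_mono) auto
  also have "\<dots> = 96 * N ^ 3" by (simp add: power3_eq_cube)
  finally have "check_time l \<le> 96 * N ^ 3 + (40 * N + 61)" unfolding check_time_def using N by linarith
  then have ct: "check_time l \<le> 200 * N ^ 3" using pow by linarith
  have "(k + 1) * check_time l \<le> K * (200 * N ^ 3)" using K(1) ct by (rule mult_le_mono)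
  then have "guess_time l k \<le> 200 * A + (24 * N + 6 * K + 80)" unfolding guess_time_def A_def using N K by simp
  then have gt: "guess_time l k \<le> 310 * A" using KA NB by linarith
  have "3 ^ k * guess_time l k \<le> K ^ 2 * (310 * A)" using K(2) gt by (rule mult_le_mono)
  then have "feas_time l k \<le> 310 * B + (12 * N + 8 * K + 80)" unfolding feas_time_def B_def using N K by simp
  then have "body_time l k \<le> 310 * B + (28 * N + 12 * K + 140)" unfolding body_time_def using N K by linarith
  then have bt: "body_time l k + 1 \<le> 491 * B" using NB by linarith
  have "(k + 1) * (6 * l + 10) \<le> K * (22 * N)" using K(1) N by (intro mult_le_mono) auto
  then have "(k + 1) * (6 * l + 10) + 1 \<le> 23 * (K * N)" using N(2) K1 by (simp add: algebra_simps)
  then have "((k + 1) * (6 * l + 10) + 1) * (body_time l k + 1) \<le> (23 * (K * N)) * (491 * B)"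
    using bt by (rule mult_le_mono)
  then have ft: "find_time l k \<le> 11293 * Z + 1" unfolding find_time_def Z_def by (simp add: algebra_simps)
  have "l * (12 * l + 121) \<le> (2 * N) * (145 * N)" using N by (intro mult_le_mono) auto
  then have "emit_time l \<le> 290 * N ^ 2 + 28 * N + 60" unfolding emit_time_def power2_eq_square using N by simp
  then have et: "emit_time l \<le> 378 * N ^ 2" using N pow by linarith
  have "l * (2 * l + 5) \<le> (2 * N) * (9 * N)" using N by (intro mult_le_mono) auto
  then have ot: "l * (2 * l + 5) \<le> 18 * N ^ 2" by (simp add: power2_eq_square)
  have N2: "N ^ 2 \<le> Z"
  proof -
    have "N ^ 2 \<le> N ^ 3" using N(2) by (intro power_increasing) auto
    then show ?thesis using KA AB BZ by linarith
  qed
  have "next_time l k \<le> 11293 * Z + 1 + 378 * N ^ 2 + 36 * N ^ 2 + 16 * N + 4 * K + 70"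
    unfolding next_time_def using ft et ot N K by linarith
  then have "next_time l k \<le> 12000 * Z" using N2 NB BZ pow by linarith
  then show "next_time l k \<le> 12000 * (K ^ 4 * N ^ 4)" unfolding Z .
  have "find_time l k + emit_time l \<le> 12000 * Z" using ft et N2 NB BZ pow by linarith
  then show "find_time l k + emit_time l \<le> 12000 * (K ^ 4 * N ^ 4)" unfolding Z .
qed

lemma read_time_bound:
  fixes K N :: nat
  assumes N: "n * n \<le> N" "n \<le> N" "length (bin n) \<le> N" "length (bin k) \<le> N" "1 \<le> N" and K: "k + 1 \<le> K"
  shows "read_time n k \<le> 150 * (K ^ 4 * N ^ 4)"
proof -
  have K1: "1 \<le> K" using K by simp
  define Z where "Z = K ^ 4 * N ^ 4"
  have p: "1 \<le> K ^ 4" "N ^ 2 \<le> N ^ 4" "N \<le> N ^ 2" "1 \<le> N ^ 4" "K \<le> K ^ 4"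
    using N(5) K1 by (auto intro: power_increasing simp: self_le_power)
  have Z1: "N ^ 4 \<le> Z" unfolding Z_def using p by simp
  have Z2: "K * N \<le> Z" unfolding Z_def using p by (intro mult_le_mono) auto
  have "length (bin n) * (6 * n + 13) \<le> N * (19 * N)" using N by (intro mult_le_mono) auto
  moreover have "length (bin k) * (6 * k + 13) \<le> N * (19 * K)" using N K by (intro mult_le_mono) auto
  moreover have "n * (6 * n + 31) \<le> N * (37 * N)" using N by (intro mult_le_mono) auto
  moreover have "n * (n + 1) \<le> N * (2 * N)" using N by (intro mult_le_mono) auto
  ultimately have "read_time n k \<le> 60 * N ^ 2 + 19 * (K * N) + 20"
    unfolding read_time_def power2_eq_square by (simp add: algebra_simps)
  then show ?thesis unfolding Z_def[symmetric] using p Z1 Z2 by linarith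
qed

section \<open>The enumeration\<close>

lemma sol_codes_less: "c \<in> sol_codes n M k \<Longrightarrow> c < (k + 1) * 3 ^ length M"
proof -
  assume "c \<in> sol_codes n M k"
  then obtain s Q where Q: "s \<le> k" "solves n M s Q" "c = code (length M) s Q" by (auto simp: sol_codes_def)
  then have "length Q = length M" "dval Q < 3 ^ length M"
    using dval_less[of Q] by (auto simp: solves_def digits_def)
  then have "c < (s + 1) * 3 ^ length M" using Q by (simp add: code_full)
  also have "\<dots> \<le> (k + 1) * 3 ^ length M" using Q(1) by (intro mult_le_mono1) simp
  finally show ?thesis .
qed

lemma finite_sol_codes: "finite (sol_codes n M k)"
  by (rule finite_subset[of _ "{..<(k + 1) * 3 ^ length M}"]) (use sol_codes_less[of _ n M k] in auto)

definition code_list :: "nat \<Rightarrow> nat list \<Rightarrow> nat \<Rightarrow> nat list" where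
  "code_list n M k = sorted_list_of_set (sol_codes n M k)"

lemma set_code_list: "set (code_list n M k) = sol_codes n M k"
  by (simp add: code_list_def finite_sol_codes)

lemma code_list_strict:
  "i < j \<Longrightarrow> j < length (code_list n M k) \<Longrightarrow> code_list n M k ! i < code_list n M k ! j"
  unfolding code_list_def using strict_sorted_list_of_set by (rule sorted_wrt_nth_less)

text \<open>Indices past the last solution ask for the status 2, which makes the sequence of stores
  total.\<close>

definition at_sol :: "nat \<Rightarrow> nat list \<Rightarrow> nat \<Rightarrow> nat \<Rightarrow> store \<Rightarrow> bool" where
  "at_sol n M k j \<sigma> \<longleftrightarrow> (if j < length (code_list n M k)
     then \<exists>s P. main_inv M k s P 1 (enc_sol n P) \<sigma> \<and> solves n M s P \<and> code (length M) s P = code_list n M k ! j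
     else \<sigma> 15 = reg 2)"

text \<open>The list of codes is strictly increasing, so the smallest code beyond entry number
  \<open>j - 1\<close> is entry number \<open>j\<close>; if there is none, the search must have
  ended.\<close>

lemma found_from_at_sol:
  assumes f: "found_from n M k (if j = 0 then 0 else Suc (code_list n M k ! (j - 1))) \<sigma>" and j: "j \<le> length (code_list n M k)"
  shows "at_sol n M k j \<sigma>"
proof -
  let ?cs = "code_list n M k" and ?thr = "if j = 0 then 0 else Suc (code_list n M k ! (j - 1))"
  note cs = set_code_list[of n M k] code_list_strict[where n = n and M = M and k = k]
  have below: "?cs ! i < ?thr" if "i < j" for i
  proof (cases "i = j - 1")
    case False
    then have "i < j - 1" using that by linarith
    then have "?cs ! i < ?cs ! (j - 1)" using cs(2)[of i "j - 1"] j by linarith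
    then show ?thesis using that by simp
  qed (use that in auto)
  have ge: "?cs ! j \<le> c" if "c \<in> sol_codes n M k" "?thr \<le> c" "j < length ?cs" for c
  proof -
    obtain i where i: "i < length ?cs" "c = ?cs ! i" using \<open>c \<in> _\<close> cs(1) by (metis in_set_conv_nth)
    then have "\<not> i < j" using below[of i] that by auto
    then show ?thesis using cs(2)[of j i] i by (cases "i = j") auto
  qed
  show ?thesis
  proof (cases "j < length ?cs")
    case True
    then have c: "?cs ! j \<in> sol_codes n M k" using cs(1) nth_mem by blast
    have thr: "?thr \<le> ?cs ! j" using cs(2)[of "j - 1" j] True by auto
    from f obtain s P where P: "main_inv M k s P 1 (enc_sol n P) \<sigma>" "solves n M s P" "?thr \<le> code (length M) s P"
        "\<forall>c'\<in>sol_codes n M k. ?thr \<le> c' \<longrightarrow> code (length M) s P \<le> c'"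
      unfolding found_from_def using c thr by (meson not_le)
    have "code (length M) s P \<in> sol_codes n M k" using P(1,2) by (auto simp: sol_codes_def main_inv_def)
    then have "code (length M) s P = ?cs ! j" using ge[of "code (length M) s P"] P(3,4) c thr True by (metis le_antisym)
    then show ?thesis unfolding at_sol_def using True P(1,2) by auto
  next
    case False
    have "c < ?thr" if c: "c \<in> sol_codes n M k" for c
    proof -
      obtain i where "i < length ?cs" "c = ?cs ! i" using c cs(1) by (metis in_set_conv_nth)
      then show ?thesis using below[of i] False by simp
    qed
    moreover have "code (length M) s P \<in> sol_codes n M k"
      if "main_inv M k s P 1 (enc_sol n P) \<sigma>" "solves n M s P" for s P
      using that by (auto simp: sol_codes_def main_inv_def)
    ultimately have "\<sigma> 15 = reg 2" using f unfolding found_from_def by (meson not_le)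
    then show ?thesis using False by (simp add: at_sol_def)
  qed
qed

definition enum_machine :: tm where
  "enum_machine = machine 17 8 (\<lambda>r. r 15 = 1) first_sol next_sol"

definition enum_time :: "nat \<Rightarrow> nat \<Rightarrow> nat" where
  "enum_time n k = read_time n k + (find_time (n * (n + 1)) k + emit_time (n * (n + 1)) + 3) + next_time (n * (n + 1)) k"

text \<open>The programs are only known to reach some suitable store, so the sequence of stores is
  obtained by dependent choice; after the end it stays constant.\<close>

lemma enum_sequence:
  fixes n k :: nat and E :: "nat set set"
  defines "M \<equiv> graph_matrix n E"
  shows "\<exists>\<sigma>s. runs first_sol (init_store (enc_ce (n, E, k))) (enum_time n k) (\<sigma>s 0) \<and>
    (\<forall>j. at_sol n M k j (\<sigma>s j)) \<and>
    (\<forall>j<length (code_list n M k). runs next_sol (\<sigma>s j) (enum_time n k) (\<sigma>s (Suc j)))"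
proof -
  let ?cs = "code_list n M k" and ?A = "\<lambda>\<sigma>. runs first_sol (init_store (enc_ce (n, E, k))) (enum_time n k) \<sigma>"
  have M: "matrix n M" unfolding M_def by (rule matrix_graph)
  have l: "length M = n * (n + 1)" by (simp add: M_def graph_matrix_def)
  have "\<exists>\<sigma>s. \<forall>j. (at_sol n M k j (\<sigma>s j) \<and> (j = 0 \<longrightarrow> ?A (\<sigma>s j))) \<and>
     (j < length ?cs \<longrightarrow> runs next_sol (\<sigma>s j) (enum_time n k) (\<sigma>s (Suc j)))"
  proof (rule dependent_nat_choice)
    obtain \<sigma> where s: "runs first_sol (init_store (enc_ce (n, E, k)))
      (read_time n k + find_time (n * (n + 1)) k + emit_time (n * (n + 1)) + 3) \<sigma>" "found_from n M k 0 \<sigma>"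
      using runs_first_sol unfolding M_def by blast
    then have "?A \<sigma>" by (elim runs_mono) (simp add: enum_time_def)
    then show "\<exists>\<sigma>. at_sol n M k 0 \<sigma> \<and> (0 = 0 \<longrightarrow> ?A \<sigma>)"
      using found_from_at_sol[of n M k 0 \<sigma>] s(2) by auto
  next
    fix \<sigma> j assume a: "at_sol n M k j \<sigma> \<and> (j = 0 \<longrightarrow> ?A \<sigma>)"
    show "\<exists>\<sigma>'. (at_sol n M k (Suc j) \<sigma>' \<and> (Suc j = 0 \<longrightarrow> ?A \<sigma>')) \<and>
       (j < length ?cs \<longrightarrow> runs next_sol \<sigma> (enum_time n k) \<sigma>')"
    proof (cases "j < length ?cs")
      case True
      then obtain s P where P: "main_inv M k s P 1 (enc_sol n P) \<sigma>" "solves n M s P" "code (length M) s P = ?cs ! j"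
        using a by (auto simp: at_sol_def)
      obtain \<sigma>' where r: "runs next_sol \<sigma> (next_time (length M) k) \<sigma>'" "found_from n M k (Suc (code (length M) s P)) \<sigma>'"
        using runs_next_sol[OF M P(1,2)] by blast
      have "runs next_sol \<sigma> (enum_time n k) \<sigma>'" using r(1) by (elim runs_mono) (simp add: enum_time_def l)
      moreover have "at_sol n M k (Suc j) \<sigma>'"
        using found_from_at_sol[of n M k "Suc j" \<sigma>'] r(2) P(3) True by simp
      ultimately show ?thesis by blast
    next
      case False
      then have "at_sol n M k (Suc j) \<sigma>" using a by (simp add: at_sol_def)
      then show ?thesis using False by blast
    qed
  qed
  then show ?thesis by blast
qed

lemma enc_sol_nonzero: "0 \<notin> set (enc_sol n P)"
proof -
  have "0 \<notin> set (bin v)" for v using set_bin[of v] by auto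
  then show ?thesis by (auto simp: enc_sol_def enc_cell_def)
qed

lemma enum_machine_correct:
  assumes E: "graph n E"
  shows "\<exists>T Ss. halts_at enum_machine (enc_ce (n, E, k)) T \<and> delay_bounded enum_machine (enc_ce (n, E, k)) (enum_time n k + 2) \<and>
    length Ss = length (outputs enum_machine (enc_ce (n, E, k)) T) \<and>
    (\<forall>i<length Ss. encodes_edits (outputs enum_machine (enc_ce (n, E, k)) T ! i) (Ss ! i)) \<and>
    distinct Ss \<and> set Ss = all_ce_sols (n, E, k) \<and>
    (\<forall>i j. i < j \<and> j < length Ss \<longrightarrow> card (Ss ! i) \<le> card (Ss ! j))"
proof -
  define M where "M = graph_matrix n E"
  let ?w = "enc_ce (n, E, k)"
  define cs where "cs = code_list n M k"
  let ?nn = "length cs"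
  have l: "length M = n * (n + 1)" by (simp add: M_def graph_matrix_def)
  obtain \<sigma>s where \<sigma>s: "runs first_sol (init_store ?w) (enum_time n k) (\<sigma>s 0)" "\<And>j. at_sol n M k j (\<sigma>s j)"
    "\<And>j. j < ?nn \<Longrightarrow> runs next_sol (\<sigma>s j) (enum_time n k) (\<sigma>s (Suc j))"
    using enum_sequence[of n E k] unfolding M_def cs_def by blast
  have "\<forall>j. \<exists>s P. j < ?nn \<longrightarrow> main_inv M k s P 1 (enc_sol n P) (\<sigma>s j) \<and> solves n M s P \<and> code (length M) s P = cs ! j"
    using \<sigma>s(2) unfolding at_sol_def cs_def by metis
  then obtain s P where P: "\<And>j. j < ?nn \<Longrightarrow> main_inv M k (s j) (P j) 1 (enc_sol n (P j)) (\<sigma>s j)"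
    "\<And>j. j < ?nn \<Longrightarrow> solves n M (s j) (P j)" "\<And>j. j < ?nn \<Longrightarrow> code (length M) (s j) (P j) = cs ! j"
    by metis
  have Pd: "digits (length M) (P j)" "forced M (P j)" "weight (P j) = s j" "length (P j) = length M" "set (P j) \<subseteq> {1, 2, 3}"
    if "j < ?nn" for j using P(2)[OF that] by (auto simp: solves_def digits_def)
  have sk: "s j \<le> k" if "j < ?nn" for j using P(1)[OF that] by (simp add: main_inv_def)
  have "\<exists>T. halts_at enum_machine ?w T \<and> run enum_machine ?w T = conf 17 0 (\<sigma>s ?nn) \<and>
     outputs enum_machine ?w T = map (\<lambda>j. out_word (conf 17 1 (\<sigma>s j))) [0..<?nn] \<and>
     delay_bounded enum_machine ?w (enum_time n k + 2)"
    unfolding enum_machine_def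
  proof (rule machine_run[OF refl refl refl])
    show "\<exists>t\<le>enum_time n k. exec first_sol (init_store ?w) t (\<sigma>s 0)" using \<sigma>s(1) by (simp add: runs_def)
    show "rd (\<sigma>s j) 15 = 1 \<and> (\<exists>t\<le>enum_time n k. exec next_sol (\<sigma>s j) t (\<sigma>s (Suc j)))" if "j < ?nn" for j
      using \<sigma>s(3)[OF that] P(1)[OF that] by (simp add: runs_def main_inv_def)
    show "rd (\<sigma>s ?nn) 15 \<noteq> 1" using \<sigma>s(2)[of ?nn] by (simp add: at_sol_def cs_def)
  qed (simp_all add: wf_first_sol wf_next_sol)
  then obtain T where T: "halts_at enum_machine ?w T" "delay_bounded enum_machine ?w (enum_time n k + 2)"
    "outputs enum_machine ?w T = map (\<lambda>j. out_word (conf 17 1 (\<sigma>s j))) [0..<?nn]" by blast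
  have out: "out_word (conf 17 1 (\<sigma>s j)) = enc_sol n (P j)" if "j < ?nn" for j
    by (rule out_word_conf[where p = "length (enc_sol n (P j))"])
      (use P(1)[OF that] enc_sol_nonzero in \<open>simp_all add: main_inv_def\<close>)
  define Ss where "Ss = map (\<lambda>j. edits n (P j)) [0..<?nn]"
  have lS: "length Ss = ?nn" by (simp add: Ss_def)
  have cl: "cs ! i < cs ! j" if "i < j" "j < ?nn" for i j using code_list_strict that by (simp add: cs_def)
  have "encodes_edits (outputs enum_machine ?w T ! i) (Ss ! i)" if "i < ?nn" for i
    using encodes_enc_sol[OF E, of "P i"] Pd[OF that] out[OF that] that by (simp add: T(3) Ss_def M_def del: enc_ce.simps)
  moreover have "distinct Ss"
    unfolding distinct_conv_nth lS
  proof (intro allI impI)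
    fix i j assume ij: "i < ?nn" "j < ?nn" "i \<noteq> j"
    have "cs ! i \<noteq> cs ! j" using cl[of i j] cl[of j i] ij by (metis linorder_neqE_nat nat_neq_iff)
    \<comment> \<open>The weight of an assignment is its size, so equal assignments have equal
      codes.\<close>
    moreover have "cs ! i = cs ! j" if "P i = P j" using P(3) Pd(3) ij that by metis
    ultimately have "P i \<noteq> P j" by blast
    then show "Ss ! i \<noteq> Ss ! j"
      using edits_inj[OF E M_def Pd(1,2)[OF ij(1)] Pd(1,2)[OF ij(2)]] ij by (auto simp: Ss_def)
  qed
  moreover have card: "card (Ss ! j) = s j" if "j < ?nn" for j
    using card_edits[OF E M_def Pd(4,2)[OF that]] Pd(3)[OF that] that by (simp add: Ss_def)
  moreover have "set Ss = all_ce_sols (n, E, k)"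
  proof (intro set_eqI iffI)
    fix S assume "S \<in> set Ss"
    then obtain j where j: "j < ?nn" "S = edits n (P j)" by (auto simp: Ss_def)
    note d = Pd[OF j(1)]
    have "is_cluster n (apply_edits (edits n (P j)) E)"
      using solves_iff[OF E, of "P j"] P(2)[OF j(1)] d l by (simp add: M_def)
    then show "S \<in> all_ce_sols (n, E, k)"
      using edits_valid[OF E M_def d(4,2,5)] card_edits[OF E M_def d(4,2)] d(3) sk[OF j(1)] j(2)
      by (simp add: ce_solution_def)
  next
    fix S assume "S \<in> all_ce_sols (n, E, k)"
    then have S: "\<forall>op\<in>S. valid_edit n op" "consistent S" "card S \<le> k" "is_cluster n (apply_edits S E)"
      by (auto simp: ce_solution_def)
    obtain Q where Q: "digits (length M) Q" "forced M Q" "edits n Q = S" using edits_surj[OF E M_def S(1,2)] by blast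
    have "solves n M (weight Q) Q" using solves_iff[OF E, of Q] Q S(4) l by (simp add: M_def)
    moreover have "weight Q \<le> k" using card_edits[OF E M_def, of Q] Q S(3) by (auto simp: digits_def)
    ultimately have "code (length M) (weight Q) Q \<in> set cs"
      unfolding cs_def set_code_list by (auto simp: sol_codes_def)
    then obtain j where j: "j < ?nn" "cs ! j = code (length M) (weight Q) Q" by (metis in_set_conv_nth)
    have "P j = Q" using code_inj(2)[OF Pd(1)[OF j(1)] Q(1)] P(3)[OF j(1)] j(2) by metis
    then show "S \<in> set Ss" using j(1) Q(3) by (auto simp: Ss_def)
  qed
  moreover have "card (Ss ! i) \<le> card (Ss ! j)" if ij: "i < j" "j < ?nn" for i j
  proof -
    have i: "i < ?nn" using ij by simp
    have c: "cs ! v = s v * 3 ^ length M + dval (P v)" if "v < ?nn" for v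
      using P(3)[OF that] code_full[OF Pd(4)[OF that]] by simp
    have "dval (P j) < 3 ^ length M" using dval_less[OF Pd(5)[OF ij(2)]] Pd(4)[OF ij(2)] by simp
    \<comment> \<open>The size is the quotient of the code by \<open>3 ^ length M\<close>, hence
      increasing codes have non-decreasing sizes.\<close>
    then have "s i * 3 ^ length M \<le> cs ! i" "cs ! j < Suc (s j) * 3 ^ length M"
      unfolding c[OF i] c[OF ij(2)] by simp_all
    then have "s i * 3 ^ length M < Suc (s j) * 3 ^ length M" using cl[OF ij] by linarith
    then have "s i < Suc (s j)" by (metis mult_less_cancel2)
    then show ?thesis using card[OF i] card[OF ij(2)] by simp
  qed
  ultimately show ?thesis using T lS by (intro exI[of _ T] exI[of _ Ss]) auto
qed

lemma enum_time_bound: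
  "enum_time n k + 2 \<le> 2 ^ (4 * k) * (25000 * (length (enc_ce (n, E, k)) + 1) ^ 4)"
proof -
  let ?N = "length (enc_ce (n, E, k)) + 1" and ?K = "2 ^ k :: nat"
  have len: "length (enc_ce (n, E, k)) = length (bin n) + length (bin k) + n * n + 2"
    by (simp add: concat_rows[where f = "\<lambda>i j. if {i, j} \<in> E then 2 else 1"])
  have nn: "n \<le> n * n" "n * (n + 1) = n * n + n" by simp_all
  have N: "n * n \<le> ?N" "n \<le> ?N" "length (bin n) \<le> ?N" "length (bin k) \<le> ?N" "1 \<le> ?N"
    using len nn(1) by linarith+
  have N6: "n * (n + 1) \<le> 2 * ?N" 
  proof -
    have "q + n \<le> 2 * (x + 1)" if "x = b + d + q + 2" "n \<le> q" for x b d q :: nat using that by simp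
    from this[OF len nn(1)] show ?thesis unfolding nn(2) .
  qed
  have K: "k + 1 \<le> ?K" "3 ^ k \<le> ?K ^ 2"
  proof -
    show "k + 1 \<le> ?K" by (induction k) auto
    \<comment> \<open>The number of guess strings is compared with \<open>4 ^ k\<close>, the square
      of \<open>2 ^ k\<close>.\<close>
    have "(3::nat) ^ k \<le> 4 ^ k" by (rule power_mono) auto
    also have "\<dots> = ?K ^ 2" by (simp add: power2_eq_square flip: power_mult_distrib)
    finally show "3 ^ k \<le> ?K ^ 2" .
  qed
  let ?Z = "?K ^ 4 * ?N ^ 4"
  have "1 \<le> ?Z" by (simp add: Suc_le_eq del: enc_ce.simps)
  \<comment> \<open>The constant covers 12000 for the first search, 12000 for each later one, 150
    for reading the input and the 5 remaining steps.\<close>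
  then have "enum_time n k + 2 \<le> 25000 * ?Z"
    using next_time_bound[OF N6 N(5) K] read_time_bound[OF N(1-5) K(1)] unfolding enum_time_def by linarith
  also have "\<dots> = 2 ^ (4 * k) * (25000 * ?N ^ 4)"
    by (simp only: power_mult[symmetric] mult.commute[of k 4] mult.left_commute)
  finally show ?thesis .
qed

lemma delay_bounded_mono: "delay_bounded M w B \<Longrightarrow> B \<le> B' \<Longrightarrow> delay_bounded M w B'"
  unfolding delay_bounded_def Let_def by (meson le_trans)

theorem mainTheorem4:
  shows "DelayFPT ce_instances enc_ce ce_kappa all_ce_sols encodes_edits"
proof -
  have "wf_tm enum_machine"
    unfolding enum_machine_def by (rule wf_M[OF refl refl refl]) (simp_all add: wf_first_sol wf_next_sol)
  then have "enum_algorithm enum_machine ce_instances enc_ce all_ce_sols encodes_edits"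
    unfolding enum_algorithm_def
  proof (intro conjI ballI)
    fix x assume "x \<in> ce_instances"
    then obtain n E k where x: "x = (n, E, k)" "graph n E" by (auto simp: ce_instances_def)
    from enum_machine_correct[OF x(2), of k]
    show "\<exists>T. halts_at enum_machine (enc_ce x) T \<and>
        (\<exists>Ss. length Ss = length (outputs enum_machine (enc_ce x) T) \<and>
              (\<forall>i<length Ss. encodes_edits (outputs enum_machine (enc_ce x) T ! i) (Ss ! i)) \<and>
              distinct Ss \<and> set Ss = all_ce_sols x \<and>
              (\<forall>i j. i < j \<and> j < length Ss \<longrightarrow> card (Ss ! i) \<le> card (Ss ! j)))"
      unfolding x(1) by blast
  qed
  moreover have "delay_bounded enum_machine (enc_ce x) (2 ^ (4 * ce_kappa x) * (25000 * (length (enc_ce x) + 1) ^ 4))"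
    if "x \<in> ce_instances" for x
  proof -
    obtain n E k where x: "x = (n, E, k)" "graph n E" using \<open>x \<in> _\<close> by (auto simp: ce_instances_def)
    have "delay_bounded enum_machine (enc_ce (n, E, k)) (enum_time n k + 2)"
      using enum_machine_correct[OF x(2), of k] by blast
    then show ?thesis unfolding x(1) ce_kappa.simps by (rule delay_bounded_mono) (rule enum_time_bound)
  qed
  ultimately show ?thesis
    unfolding DelayFPT_def using power_computable by blast
qed

end
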